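(* Let $M$ be an infinite metric space. The following are equivalent: (1) the space $\mathcal{F}(M)$ has the Schur property; (2) for every complete discrete metric space $N$ with cardinality $d(M)$, the spaces $\mathcal{F}(M)_w$ and $\mathcal{F}(N)_w$ are sequentially homeomorphic; (3) there is a complete discrete metric space $N$ with cardinality $d(M)$ for which the spaces $\mathcal{F}(M)_w$ and $\mathcal{F}(N)_w$ are sequentially homeomorphic.
   Context: All vector spaces are real. $d(M)$ is the density of $M$ (minimal cardinality of a dense subset). A metric space is discrete if its topology is discrete. For a metric space $(M,\rho)$ with a distinguished base point $e$, $\mathrm{Lip}_0(M)$ is the Banach space of all Lipschitz functions $f\colon M\to\mathbb{R}$ with $f(e)=0$, with norm $\|f\|=\mathrm{Lip}(f)=\sup_{x\neq y}|f(x)-f(y)|/\rho(x,y)$. The Lipschitz-free space $\mathcal{F}(M)$ is the norm closure in the dual $\mathrm{Lip}_0(M)^*$ of the linear span of the evaluation functionals $\delta_x\colon f\mapsto f(x)$, $x\in M$. For a Banach space $E$, $E_w$ denotes $E$ with its weak topology. A Banach space has the Schur property if every weakly convergent sequence in it is norm convergent. Two topological spaces $X$ and $Y$ are sequentially homeomorphic if there exists a sequentially continuous bijection $f\colon X\to Y$ (not required to be linear) whose inverse is also sequentially continuous. *)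

theory Defs
  imports "HOL-Analysis.Analysis"
begin

unbundle cardinal_syntax
no_notation Set_Algebras.elt_set_eq  (infix "=o" 50)

section \<open>Density\<close>

definition is_dense :: "'a metric \<Rightarrow> 'a set \<Rightarrow> bool" where
  "is_dense M D \<longleftrightarrow> D \<subseteq> mspace M \<and> mtopology_of M closure_of D = mspace M"

text \<open>A cardinal is represented by a well-order of minimal type, here \<^term>\<open>|D|\<close> for a dense set
  \<^term>\<open>D\<close> of least cardinality. It is only meaningful up to order isomorphism.\<close>

definition metric_density :: "'a metric \<Rightarrow> 'a rel" where
  "metric_density M = |SOME D. is_dense M D \<and> (\<forall>D'. is_dense M D' \<longrightarrow> |D| \<le>o |D'| )|"

lemma metric_density_minimal:
  obtains D where "is_dense M D" "metric_density M = |D|"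
    "\<And>D'. is_dense M D' \<Longrightarrow> metric_density M \<le>o |D'|"
proof -
  have "is_dense M (mspace M)"
    using closure_of_topspace[of "mtopology_of M"] by (simp add: is_dense_def)
  then have "card_of ` Collect (is_dense M) \<noteq> {}"
    by blast
  moreover have "\<forall>r \<in> card_of ` Collect (is_dense M). Well_order r"
    using card_of_Well_order by blast
  ultimately obtain r where r: "r \<in> card_of ` Collect (is_dense M)"
      "\<forall>r' \<in> card_of ` Collect (is_dense M). r \<le>o r'"
    using exists_minim_Well_order by metis
  then obtain D where D: "is_dense M D" "r = |D|"
    by blast
  with r(2) have "is_dense M D \<and> (\<forall>D'. is_dense M D' \<longrightarrow> |D| \<le>o |D'| )"
    by simp
  from someI[where P = "\<lambda>D. is_dense M D \<and> (\<forall>D'. is_dense M D' \<longrightarrow> |D| \<le>o |D'| )", OF this]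
  show ?thesis
    by (intro that[OF _ metric_density_def]) (simp_all add: metric_density_def)
qed

text \<open>A metric space of cardinality \<^term>\<open>metric_density M\<close> can be placed on a type \<^typ>\<open>'b\<close> exactly
  when some \<^term>\<open>B :: 'b set\<close> has that cardinality. Statements quantifying over such spaces assume
  this of \<^typ>\<open>'b\<close>; the carrier type of \<^term>\<open>M\<close> itself always qualifies.\<close>

lemma metric_density_same_type: "\<exists>B::'a set. |B| =o metric_density (M :: 'a metric)"
  by (metis metric_density_minimal card_of_refl)

definition complete_discrete :: "'a metric \<Rightarrow> bool" where
  "complete_discrete N \<longleftrightarrow> mcomplete_of N \<and> mtopology_of N = discrete_topology (mspace N)"

section \<open>Normed spaces of real-valued functions\<close>

text \<open>Every normed space below is a linear space \<^term>\<open>V\<close> of functions \<^typ>\<open>'b \<Rightarrow> real\<close> with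
  pointwise operations, together with a norm \<^term>\<open>nrm\<close>. Functions with a mathematical domain
  smaller than \<^typ>\<open>'b\<close> are extended by \<^term>\<open>0::real\<close>, so that each of them has exactly one
  representative and pointwise operations need no restriction.\<close>

definition bdual :: "('b \<Rightarrow> real) set \<Rightarrow> (('b \<Rightarrow> real) \<Rightarrow> real) \<Rightarrow> (('b \<Rightarrow> real) \<Rightarrow> real) set" where
  "bdual V nrm = {\<phi>.
     (\<forall>f. f \<notin> V \<longrightarrow> \<phi> f = 0) \<and>
     (\<forall>f\<in>V. \<forall>g\<in>V. \<phi> (\<lambda>x. f x + g x) = \<phi> f + \<phi> g) \<and>
     (\<forall>c. \<forall>f\<in>V. \<phi> (\<lambda>x. c * f x) = c * \<phi> f) \<and>
     (\<exists>C. \<forall>f\<in>V. \<bar>\<phi> f\<bar> \<le> C * nrm f)}"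

definition dual_norm ::
  "('b \<Rightarrow> real) set \<Rightarrow> (('b \<Rightarrow> real) \<Rightarrow> real) \<Rightarrow> (('b \<Rightarrow> real) \<Rightarrow> real) \<Rightarrow> real" where
  "dual_norm V nrm \<phi> = Sup {\<bar>\<phi> f\<bar> | f. f \<in> V \<and> nrm f \<le> 1}"

definition weak_topology ::
  "('b \<Rightarrow> real) set \<Rightarrow> (('b \<Rightarrow> real) \<Rightarrow> real) \<Rightarrow> ('b \<Rightarrow> real) topology" where
  "weak_topology V nrm =
     topology_generated_by {{f \<in> V. \<phi> f \<in> U} | \<phi> U. \<phi> \<in> bdual V nrm \<and> open U}"

lemma topspace_weak_topology [simp]: "topspace (weak_topology V nrm) = V"
proof -
  have "(\<lambda>_. 0) \<in> bdual V nrm"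
    by (auto simp: bdual_def intro!: exI[of _ 0])
  then have "V \<in> {{f \<in> V. \<phi> f \<in> U} | \<phi> U. \<phi> \<in> bdual V nrm \<and> open U}"
    by (intro CollectI exI[of _ "\<lambda>_. 0"] exI[of _ UNIV]) simp
  then show ?thesis
    unfolding weak_topology_def topology_generated_by_topspace by blast
qed

definition Schur_property :: "('b \<Rightarrow> real) set \<Rightarrow> (('b \<Rightarrow> real) \<Rightarrow> real) \<Rightarrow> bool" where
  "Schur_property V nrm \<longleftrightarrow>
     (\<forall>\<sigma> l. range \<sigma> \<subseteq> V \<and> limitin (weak_topology V nrm) \<sigma> l sequentially \<longrightarrow>
        (\<lambda>n. nrm (\<lambda>x. \<sigma> n x - l x)) \<longlonglongrightarrow> 0)"

section \<open>Lipschitz-free spaces\<close>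

definition Lip0 :: "'a metric \<Rightarrow> 'a \<Rightarrow> ('a \<Rightarrow> real) set" where
  "Lip0 M e = {f. Lipschitz_continuous_map M euclidean_metric f \<and> f e = 0 \<and>
     (\<forall>x. x \<notin> mspace M \<longrightarrow> f x = 0)}"

text \<open>Inserting \<^term>\<open>0::real\<close> only matters for a one-point space, where the set of quotients
  is empty.\<close>

definition lip_norm :: "'a metric \<Rightarrow> ('a \<Rightarrow> real) \<Rightarrow> real" where
  "lip_norm M f = Sup (insert 0
     {\<bar>f x - f y\<bar> / mdist M x y | x y. x \<in> mspace M \<and> y \<in> mspace M \<and> x \<noteq> y})"

definition evaluation :: "'a metric \<Rightarrow> 'a \<Rightarrow> 'a \<Rightarrow> ('a \<Rightarrow> real) \<Rightarrow> real" where
  "evaluation M e x = (\<lambda>f. if f \<in> Lip0 M e then f x else 0)"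

definition evaluation_span :: "'a metric \<Rightarrow> 'a \<Rightarrow> (('a \<Rightarrow> real) \<Rightarrow> real) set" where
  "evaluation_span M e =
     {(\<lambda>f. \<Sum>x\<in>A. c x * evaluation M e x f) | A c. finite A \<and> A \<subseteq> mspace M}"

definition free_norm :: "'a metric \<Rightarrow> 'a \<Rightarrow> (('a \<Rightarrow> real) \<Rightarrow> real) \<Rightarrow> real" where
  "free_norm M e = dual_norm (Lip0 M e) (lip_norm M)"

definition free_space :: "'a metric \<Rightarrow> 'a \<Rightarrow> (('a \<Rightarrow> real) \<Rightarrow> real) set" where
  "free_space M e = {\<phi> \<in> bdual (Lip0 M e) (lip_norm M).
     \<forall>\<epsilon>>0. \<exists>\<psi>\<in>evaluation_span M e. free_norm M e (\<lambda>f. \<phi> f - \<psi> f) < \<epsilon>}"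

abbreviation free_space_weak :: "'a metric \<Rightarrow> 'a \<Rightarrow> (('a \<Rightarrow> real) \<Rightarrow> real) topology" where
  "free_space_weak M e \<equiv> weak_topology (free_space M e) (free_norm M e)"

section \<open>Sequential homeomorphisms\<close>

definition sequentially_continuous_map :: "'a topology \<Rightarrow> 'b topology \<Rightarrow> ('a \<Rightarrow> 'b) \<Rightarrow> bool" where
  "sequentially_continuous_map X Y f \<longleftrightarrow>
     f \<in> topspace X \<rightarrow> topspace Y \<and>
     (\<forall>\<sigma> l. range \<sigma> \<subseteq> topspace X \<and> limitin X \<sigma> l sequentially \<longrightarrow>
        limitin Y (f \<circ> \<sigma>) (f l) sequentially)"

definition sequentially_homeomorphic :: "'a topology \<Rightarrow> 'b topology \<Rightarrow> bool" where
  "sequentially_homeomorphic X Y \<longleftrightarrow>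
     (\<exists>f. bij_betw f (topspace X) (topspace Y) \<and>
        sequentially_continuous_map X Y f \<and>
        sequentially_continuous_map Y X (inv_into (topspace X) f))"

end

theory Submission
  imports Defs "HOL-Probability.Discrete_Topology"
begin

text \<open>
  Two facts carry the theorem. First, the topological type of \<^term>\<open>free_space M e\<close> with its norm
  depends only on the density of \<^term>\<open>M\<close>: for infinite \<^term>\<open>M\<close> it is homeomorphic to the space
  of absolutely summable families indexed by a set of cardinality \<^term>\<open>metric_density M\<close>
  (\<open>free_image_homeomorphic_ell1\<close>). Secondly, the free space of a complete discrete metric space has
  the Schur property (\<open>Schur_complete_discrete\<close>). If \<^term>\<open>free_space M e\<close> has the Schur property
  too, then on both free spaces a sequence converges weakly iff it converges in norm, and a norm
  homeomorphism is a sequential homeomorphism of the weak topologies. Conversely, a sequential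
  homeomorphism onto a space with the Schur property makes weak sequential convergence in
  \<^term>\<open>free_space M e\<close> metrizable. If a weakly null sequence \<open>x\<close> stayed away from \<open>0\<close> in norm, each
  sequence \<open>9\<^sup>k x\<close> would still be weakly null, and a diagonal choice would give a weakly null
  sequence of terms \<open>9\<^sup>k x(n k)\<close> with unbounded norms, against uniform boundedness
  (\<open>Schur_of_sequentially_homeomorphic\<close>).

  The homeomorphism comes from a nonlinear version of the decomposition method of Pelczynski. Let
  \<open>L\<close> be the space of absolutely summable families over \<open>K\<close>. A free space \<open>F\<close> of density \<open>|K|\<close> is a
  quotient of \<open>L\<close>, because it has a dense set of \<open>|K|\<close> elements, and the quotient map has a
  continuous right inverse of linear growth (\<open>Bartle_Graves_selection\<close>). Since \<open>L\<close> absorbs a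
  sequence of copies of itself, this gives a homeomorphism of \<open>F \<times> L\<close> and \<open>L\<close>
  (\<open>ell1_absorbs_quotient\<close>). On the other hand \<open>L\<close> is complemented in \<open>F\<close>: a metric space of density
  \<open>|K|\<close> contains a relatively discrete set of that cardinality
  (\<open>dense_ordLeq_relatively_discrete\<close>), and disjointly supported bumps at its points are biorthogonal
  to normalised differences of evaluations. Hence \<open>F\<close> is homeomorphic to \<open>L \<times> F\<close>, and so to \<open>L\<close>
  (\<open>homeomorphic_ell1_on\<close>).

  For the Schur property, a weakly null sequence is first approximated by finitely supported
  elements. A gliding hump argument shows that such a sequence is, up to a uniform error, carried by
  a small relative neighbourhood of one finite set (\<open>weakly_null_tight\<close>). Multiplying by cutoff
  functions and repeating this for shrinking neighbourhoods confines the sequence, again up to a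
  uniform error, to a totally bounded set, which is finite in a complete discrete space
  (\<open>weakly_null_finite_tight\<close>). On a finite set weak and norm convergence agree.
\<close>

no_notation Infinite_Set_Sum.abs_summable_on (infix "abs'_summable'_on" 50)

text \<open>The space of absolutely summable families is a type, so that the library's results on Banach
  spaces and infinite sums apply to it; the families indexed by a set \<open>K\<close> of
  arbitrary cardinality form the closed subspace \<open>ell1_on K\<close> below.\<close>

typedef 'k ell1 = "{a :: 'k \<Rightarrow> real. a abs_summable_on UNIV}"
  morphisms coef Abs_ell1
  by (rule exI[of _ "\<lambda>_. 0"]) simp

setup_lifting type_definition_ell1

lemma coef_abs_summable: "coef a abs_summable_on A"
  using coef[of a] by (auto intro: summable_on_subset_banach)

lemma ell1_eqI: "(\<And>k. coef a k = coef b k) \<Longrightarrow> a = b"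
  by (simp add: coef_inject[symmetric] fun_eq_iff)

instantiation ell1 :: (type) real_normed_vector
begin

lift_definition zero_ell1 :: "'a ell1" is "\<lambda>_. 0" by simp
lift_definition plus_ell1 :: "'a ell1 \<Rightarrow> 'a ell1 \<Rightarrow> 'a ell1" is "\<lambda>a b k. a k + b k"
  subgoal for a b
    by (rule summable_on_comparison_test[OF summable_on_add[of "\<lambda>k. norm (a k)" UNIV "\<lambda>k. norm (b k)"]]) auto
  done
lift_definition minus_ell1 :: "'a ell1 \<Rightarrow> 'a ell1 \<Rightarrow> 'a ell1" is "\<lambda>a b k. a k - b k"
  subgoal for a b
    by (rule summable_on_comparison_test[OF summable_on_add[of "\<lambda>k. norm (a k)" UNIV "\<lambda>k. norm (b k)"]]) auto
  done
lift_definition uminus_ell1 :: "'a ell1 \<Rightarrow> 'a ell1" is "\<lambda>a k. - a k" by simp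
lift_definition scaleR_ell1 :: "real \<Rightarrow> 'a ell1 \<Rightarrow> 'a ell1" is "\<lambda>c a k. c * a k"
  by (simp add: abs_mult summable_on_cmult_right)
definition norm_ell1 :: "'a ell1 \<Rightarrow> real" where "norm_ell1 a = (\<Sum>\<^sub>\<infinity>k. \<bar>coef a k\<bar>)"
definition sgn_ell1 :: "'a ell1 \<Rightarrow> 'a ell1" where "sgn_ell1 a = inverse (norm a) *\<^sub>R a"
definition dist_ell1 :: "'a ell1 \<Rightarrow> 'a ell1 \<Rightarrow> real" where "dist_ell1 a b = norm (a - b)"
definition uniformity_ell1 :: "('a ell1 \<times> 'a ell1) filter" where
  "uniformity_ell1 = (INF e\<in>{0<..}. principal {(x, y). dist x y < e})"
definition open_ell1 :: "'a ell1 set \<Rightarrow> bool" where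
  "open_ell1 U \<longleftrightarrow> (\<forall>x\<in>U. \<forall>\<^sub>F (x', y) in uniformity. x' = x \<longrightarrow> y \<in> U)"

instance
proof
  fix a b c :: "'a ell1" and r s :: real
  show "a + b + c = a + (b + c)" by transfer (simp add: fun_eq_iff)
  show "a + b = b + a" by transfer (simp add: fun_eq_iff)
  show "0 + a = a" by transfer (simp add: fun_eq_iff)
  show "- a + a = 0" by transfer (simp add: fun_eq_iff)
  show "a - b = a + - b" by transfer (simp add: fun_eq_iff)
  show "r *\<^sub>R (a + b) = r *\<^sub>R a + r *\<^sub>R b" by transfer (simp add: fun_eq_iff algebra_simps)
  show "(r + s) *\<^sub>R a = r *\<^sub>R a + s *\<^sub>R a" by transfer (simp add: fun_eq_iff algebra_simps)
  show "r *\<^sub>R s *\<^sub>R a = (r * s) *\<^sub>R a" by transfer (simp add: fun_eq_iff algebra_simps)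
  show "1 *\<^sub>R a = a" by transfer (simp add: fun_eq_iff)
  have S: "(\<lambda>k. \<bar>coef x k\<bar>) summable_on UNIV" for x :: "'a ell1"
    using coef_abs_summable[of x UNIV] by simp
  show "norm a = 0 \<longleftrightarrow> a = 0"
  proof
    assume "norm a = 0"
    then have "\<bar>coef a k\<bar> = 0" for k
      using nonneg_infsum_le_0D[of "\<lambda>k. \<bar>coef a k\<bar>" UNIV k] S by (simp add: norm_ell1_def)
    then show "a = 0" by (intro ell1_eqI) (simp add: zero_ell1.rep_eq)
  qed (simp add: norm_ell1_def zero_ell1.rep_eq)
  have "(\<Sum>\<^sub>\<infinity>k. \<bar>coef (a + b) k\<bar>) \<le> (\<Sum>\<^sub>\<infinity>k. \<bar>coef a k\<bar> + \<bar>coef b k\<bar>)"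
    by (intro infsum_mono S summable_on_add) (simp add: plus_ell1.rep_eq)
  also have "\<dots> = norm a + norm b"
    by (simp add: norm_ell1_def infsum_add S)
  finally show "norm (a + b) \<le> norm a + norm b" by (simp add: norm_ell1_def)
  show "norm (r *\<^sub>R a) = \<bar>r\<bar> * norm a"
    by (simp add: norm_ell1_def scaleR_ell1.rep_eq abs_mult infsum_cmult_right')
qed (simp_all add: sgn_ell1_def dist_ell1_def uniformity_ell1_def open_ell1_def)

end

lemma coef_simps [simp]:
  "coef 0 k = 0" "coef (a + b) k = coef a k + coef b k" "coef (a - b) k = coef a k - coef b k"
  "coef (- a) k = - coef a k" "coef (c *\<^sub>R a) k = c * coef a k"
  by (simp_all add: zero_ell1.rep_eq plus_ell1.rep_eq minus_ell1.rep_eq uminus_ell1.rep_eq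
      scaleR_ell1.rep_eq)

lemma sum_coef_le_norm: "finite G \<Longrightarrow> (\<Sum>k\<in>G. \<bar>coef a k\<bar>) \<le> norm a"
  unfolding norm_ell1_def
  using finite_sum_le_infsum[of "\<lambda>k. \<bar>coef a k\<bar>" UNIV G] coef_abs_summable[of a UNIV] by simp

lemma ell1_memI:
  fixes f :: "'k \<Rightarrow> real"
  assumes "\<And>G. finite G \<Longrightarrow> (\<Sum>k\<in>G. \<bar>f k\<bar>) \<le> C"
  shows "f abs_summable_on UNIV"
  by (rule nonneg_bdd_above_summable_on) (auto intro!: bdd_aboveI[of _ C] assms)

text \<open>Bounds on finite partial sums are the form in which absolute summability becomes available
  for families of values of functionals.\<close>

lemma coef_Abs_ell1:
  assumes "\<And>G. finite G \<Longrightarrow> (\<Sum>k\<in>G. \<bar>f k\<bar>) \<le> C"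
  shows "coef (Abs_ell1 f) = f"
  by (rule Abs_ell1_inverse) (simp add: ell1_memI[OF assms, simplified])

lemma norm_ell1_le:
  assumes "\<And>G. finite G \<Longrightarrow> (\<Sum>k\<in>G. \<bar>coef a k\<bar>) \<le> C"
  shows "norm a \<le> C"
  unfolding norm_ell1_def using assms coef_abs_summable[of a UNIV] by (intro infsum_le_finite_sums) auto

lemma bounded_linear_coef: "bounded_linear (\<lambda>a. coef a k)"
  using sum_coef_le_norm[of "{k}"] by (intro bounded_linear_intro[of _ 1]) auto

instance ell1 :: (type) banach
proof
  fix X :: "nat \<Rightarrow> 'a ell1"
  assume X: "Cauchy X"
  define f where "f k = lim (\<lambda>n. coef (X n) k)" for k
  have f: "(\<lambda>n. coef (X n) k) \<longlonglongrightarrow> f k" for k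
    unfolding f_def
    by (rule convergent_LIMSEQ_iff[THEN iffD1, OF Cauchy_convergent])
       (rule bounded_linear.Cauchy[OF bounded_linear_coef X])
  have le: "(\<Sum>k\<in>G. \<bar>coef (X m) k - f k\<bar>) \<le> \<epsilon>"
    if "finite G" "\<And>n. n \<ge> m \<Longrightarrow> norm (X m - X n) < \<epsilon>" for G m \<epsilon>
  proof (rule tendsto_upperbound)
    show "(\<lambda>n. \<Sum>k\<in>G. \<bar>coef (X m) k - coef (X n) k\<bar>) \<longlonglongrightarrow> (\<Sum>k\<in>G. \<bar>coef (X m) k - f k\<bar>)"
      by (intro tendsto_intros f)
    show "\<forall>\<^sub>F n in sequentially. (\<Sum>k\<in>G. \<bar>coef (X m) k - coef (X n) k\<bar>) \<le> \<epsilon>"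
    proof (rule eventually_sequentiallyI[of m])
      fix n assume "m \<le> n"
      then have "norm (X m - X n) < \<epsilon>" by (rule that(2))
      then show "(\<Sum>k\<in>G. \<bar>coef (X m) k - coef (X n) k\<bar>) \<le> \<epsilon>"
        using sum_coef_le_norm[OF that(1), of "X m - X n"] by simp
    qed
  qed simp
  have C: "\<exists>m. \<forall>k\<ge>m. \<forall>n\<ge>m. norm (X k - X n) < \<epsilon>" if "\<epsilon> > 0" for \<epsilon>
    using X that by (auto simp: Cauchy_iff)
  obtain m where m: "\<And>n. n \<ge> m \<Longrightarrow> norm (X m - X n) < 1" using C[of 1] by auto
  have "(\<Sum>k\<in>G. \<bar>f k\<bar>) \<le> norm (X m) + 1" if "finite G" for G
  proof -
    have "(\<Sum>k\<in>G. \<bar>f k\<bar>) \<le> (\<Sum>k\<in>G. \<bar>coef (X m) k\<bar> + \<bar>coef (X m) k - f k\<bar>)"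
      by (intro sum_mono) auto
    then show ?thesis using le[OF that m] sum_coef_le_norm[OF that, of "X m"]
      by (simp add: sum.distrib)
  qed
  then have F: "coef (Abs_ell1 f) = f" by (rule coef_Abs_ell1)
  have "X \<longlonglongrightarrow> Abs_ell1 f"
  proof (rule LIMSEQ_I)
    fix \<epsilon> :: real assume "\<epsilon> > 0"
    then obtain m where m: "\<And>k n. k \<ge> m \<Longrightarrow> n \<ge> m \<Longrightarrow> norm (X k - X n) < \<epsilon> / 2"
      using C[of "\<epsilon> / 2"] by auto
    have "norm (X k - Abs_ell1 f) \<le> \<epsilon> / 2" if "k \<ge> m" for k
    proof (rule norm_ell1_le)
      fix G :: "'a set" assume "finite G"
      then have "(\<Sum>j\<in>G. \<bar>coef (X k) j - f j\<bar>) \<le> \<epsilon> / 2"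
        using that m by (intro le) auto
      then show "(\<Sum>j\<in>G. \<bar>coef (X k - Abs_ell1 f) j\<bar>) \<le> \<epsilon> / 2" by (simp add: F)
    qed
    with \<open>\<epsilon> > 0\<close> show "\<exists>m. \<forall>k\<ge>m. norm (X k - Abs_ell1 f) < \<epsilon>"
      by (intro exI[of _ m]) force
  qed
  then show "convergent X" by (rule convergentI)
qed

lift_definition unit_ell1 :: "'k \<Rightarrow> 'k ell1" is "\<lambda>j k. if k = j then 1 else 0"
  by (rule ell1_memI[of _ 1]) (simp add: if_distrib cong: if_cong)

lemma coef_unit_ell1: "coef (unit_ell1 j) k = (if k = j then 1 else 0)"
  by (simp add: unit_ell1.rep_eq)

lemma norm_unit_ell1 [simp]: "norm (unit_ell1 j) = 1"
proof (rule antisym)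
  show "norm (unit_ell1 j) \<le> 1"
    by (rule norm_ell1_le) (simp add: coef_unit_ell1 if_distrib cong: if_cong)
  show "1 \<le> norm (unit_ell1 j)"
    using sum_coef_le_norm[of "{j}" "unit_ell1 j"] by (simp add: coef_unit_ell1)
qed

section \<open>Operators defined by bounded families\<close>

text \<open>For a bounded family \<open>z\<close> this is the unique bounded operator that sends the
  \<open>k\<close>-th unit vector to \<open>z k\<close>. All linear maps out of
  \<^typ>\<open>'k ell1\<close> used below, including reindexings, are of this form, and
  identities between them reduce to identities between unit vectors.\<close>

definition ell1_op :: "('k \<Rightarrow> 'x::banach) \<Rightarrow> 'k ell1 \<Rightarrow> 'x" where
  "ell1_op z a = (\<Sum>\<^sub>\<infinity>k. coef a k *\<^sub>R z k)"

context
  fixes z :: "'k \<Rightarrow> 'x::banach" and C :: real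
  assumes z: "\<And>k. norm (z k) \<le> C"
begin

lemma ell1_op_abs_summable: "(\<lambda>k. coef a k *\<^sub>R z k) abs_summable_on A"
proof (rule Infinite_Sum.abs_summable_on_comparison_test)
  show "(\<lambda>k. C * coef a k) abs_summable_on A"
    using coef_abs_summable[of a A] by (simp add: abs_mult summable_on_cmult_right)
  show "norm (coef a k *\<^sub>R z k) \<le> norm (C * coef a k)" for k
    using z[of k] by (simp add: abs_mult mult.commute mult_right_mono abs_of_nonneg[OF order.trans[OF norm_ge_zero z]])
qed

lemma ell1_op_has_sum: "((\<lambda>k. coef a k *\<^sub>R z k) has_sum ell1_op z a) UNIV"
  unfolding ell1_op_def by (rule has_sum_infsum[OF abs_summable_summable[OF ell1_op_abs_summable]])

lemma norm_ell1_op_le: "norm (ell1_op z a) \<le> (\<Sum>\<^sub>\<infinity>k. \<bar>coef a k\<bar> * norm (z k))"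
  unfolding ell1_op_def using norm_infsum_bound[OF ell1_op_abs_summable[of a UNIV]] by simp

lemma bounded_linear_ell1_op: "bounded_linear (ell1_op z)"
proof (rule bounded_linear_intro)
  fix a b :: "'k ell1" and r
  show "ell1_op z (a + b) = ell1_op z a + ell1_op z b"
    using has_sum_add[OF ell1_op_has_sum[of a] ell1_op_has_sum[of b]]
    by (intro has_sum_unique[OF ell1_op_has_sum]) (simp add: scaleR_add_left)
  show "ell1_op z (r *\<^sub>R a) = r *\<^sub>R ell1_op z a"
    using has_sum_bounded_linear[OF bounded_linear_scaleR_right ell1_op_has_sum[of a], of r]
    by (intro has_sum_unique[OF ell1_op_has_sum]) (simp add: o_def)
  have "(\<Sum>\<^sub>\<infinity>k. \<bar>coef a k\<bar> * norm (z k)) \<le> (\<Sum>\<^sub>\<infinity>k. \<bar>coef a k\<bar> * C)"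
    using ell1_op_abs_summable[of a UNIV] coef_abs_summable[of a UNIV] z
    by (intro infsum_mono summable_on_cmult_left) (auto intro: mult_left_mono)
  then show "norm (ell1_op z a) \<le> norm a * C"
    using norm_ell1_op_le[of a] by (simp add: norm_ell1_def infsum_cmult_left')
qed

lemma ell1_op_unit [simp]: "ell1_op z (unit_ell1 k) = z k"
proof -
  have "((\<lambda>j. coef (unit_ell1 k) j *\<^sub>R z j) has_sum z k) UNIV"
    by (rule has_sum_finite_neutralI[of "{k}"]) (auto simp: coef_unit_ell1)
  then show ?thesis by (rule has_sum_unique[OF ell1_op_has_sum])
qed

lemma bounded_linear_ell1_op_comp:
  fixes T :: "'x \<Rightarrow> 'y::banach"
  assumes "bounded_linear T"
  shows "T (ell1_op z a) = ell1_op (\<lambda>k. T (z k)) a"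
proof -
  have "((\<lambda>k. T (coef a k *\<^sub>R z k)) has_sum T (ell1_op z a)) UNIV"
    by (rule has_sum_bounded_linear[OF assms ell1_op_has_sum[of a]])
  then have "((\<lambda>k. coef a k *\<^sub>R T (z k)) has_sum T (ell1_op z a)) UNIV"
    by (simp add: linear_cmul[OF bounded_linear.linear[OF assms]])
  then show ?thesis unfolding ell1_op_def[of "\<lambda>k. T (z k)"] by (rule infsumI[symmetric])
qed

text \<open>Requiring \<open>z k \<in> V\<close> only where the family \<open>a\<close> does not vanish
  makes it possible to treat families in \<open>ell1_on K\<close> by looking at
  \<open>K\<close> alone.\<close>

lemma ell1_op_in_closed_subspace:
  assumes "subspace V" "closed V" "\<And>k. coef a k \<noteq> 0 \<Longrightarrow> z k \<in> V"
  shows "ell1_op z a \<in> V"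
proof -
  have "((\<lambda>G. \<Sum>k\<in>G. coef a k *\<^sub>R z k) \<longlongrightarrow> ell1_op z a) (finite_subsets_at_top UNIV)"
    using ell1_op_has_sum[of a] by (simp add: has_sum_def)
  moreover have "(\<Sum>k\<in>G. coef a k *\<^sub>R z k) \<in> V" for G
    using assms by (intro subspace_sum) (metis scaleR_zero_left subspace_0 subspace_scale)+
  ultimately show ?thesis
    using Lim_in_closed_set[OF assms(2)] by (metis (mono_tags, lifting) always_eventually finite_subsets_at_top_neq_bot)
qed

end

lemma ell1_op_unit_self [simp]: "ell1_op unit_ell1 a = a"
proof (rule ell1_eqI)
  fix j :: 'a
  have n: "norm (unit_ell1 k) \<le> 1" for k :: 'a by simp
  have "coef (ell1_op unit_ell1 a) j = ell1_op (\<lambda>k. coef (unit_ell1 k) j) a"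
    by (rule bounded_linear_ell1_op_comp[OF n bounded_linear_coef])
  also have "\<dots> = (\<Sum>\<^sub>\<infinity>k\<in>{j}. coef a k)"
    unfolding ell1_op_def by (rule infsum_cong_neutral) (auto simp: coef_unit_ell1)
  finally show "coef (ell1_op unit_ell1 a) j = coef a j" by simp
qed

lemma ell1_op_cong: "(\<And>k. coef a k \<noteq> 0 \<Longrightarrow> z k = w k) \<Longrightarrow> ell1_op z a = ell1_op w a"
  unfolding ell1_op_def by (rule infsum_cong) (metis scaleR_zero_left)

definition ell1_on :: "'k set \<Rightarrow> 'k ell1 set" where
  "ell1_on K = {a. \<forall>k. k \<notin> K \<longrightarrow> coef a k = 0}"

lemma subspace_ell1_on: "subspace (ell1_on K)"
  by (auto simp: subspace_def ell1_on_def)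

lemma closed_ell1_on: "closed (ell1_on K)"
proof -
  have "ell1_on K = (\<Inter>k\<in>-K. {a. coef a k = 0})" by (auto simp: ell1_on_def)
  moreover have "closed {a :: 'a ell1. coef a k = 0}" for k
    by (intro closed_Collect_eq bounded_linear.continuous_on[OF bounded_linear_coef] continuous_intros)
  ultimately show ?thesis by (metis (no_types, lifting) closed_INT)
qed

lemma unit_ell1_in_ell1_on: "k \<in> K \<Longrightarrow> unit_ell1 k \<in> ell1_on K"
  by (auto simp: ell1_on_def coef_unit_ell1)

section \<open>Dominated sums and partitions of unity\<close>

lemma infsum_in_closed_subspace:
  fixes f :: "'i \<Rightarrow> 'x::real_normed_vector"
  assumes "subspace V" "closed V" "\<And>i. i \<in> I \<Longrightarrow> f i \<in> V"
  shows "infsum f I \<in> V"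
proof (cases "f summable_on I")
  case True
  then have "(sum f \<longlongrightarrow> infsum f I) (finite_subsets_at_top I)"
    by (simp add: has_sum_infsum flip: has_sum_def)
  moreover have "\<forall>\<^sub>F G in finite_subsets_at_top I. sum f G \<in> V"
    using assms(1,3) by (intro eventually_finite_subsets_at_top_weakI subspace_sum) auto
  ultimately show ?thesis
    using Lim_in_closed_set[OF assms(2)] by (metis finite_subsets_at_top_neq_bot)
qed (use assms(1) in \<open>simp add: infsum_not_exists subspace_0\<close>)

text \<open>Dominated convergence with a varying majorant: the tails of \<open>f t\<close> are
  controlled by the tails of \<open>B t\<close>, and these are small because the total sums
  and the finite partial sums of \<open>B t\<close> converge. With a majorant of constant
  total sum, pointwise convergence already gives convergence in mean.\<close>

lemma infsum_norm_diff_tendsto_0: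
  fixes f :: "'t \<Rightarrow> 'i \<Rightarrow> 'x::real_normed_vector" and B :: "'t \<Rightarrow> 'i \<Rightarrow> real"
  assumes f: "\<And>i. i \<in> I \<Longrightarrow> ((\<lambda>t. f t i) \<longlongrightarrow> g i) F"
    and B: "\<And>i. i \<in> I \<Longrightarrow> ((\<lambda>t. B t i) \<longlongrightarrow> b i) F"
    and f_le: "\<forall>\<^sub>F t in F. B t summable_on I \<and> (\<forall>i\<in>I. norm (f t i) \<le> B t i)"
    and b: "b summable_on I" and g_le: "\<And>i. i \<in> I \<Longrightarrow> norm (g i) \<le> b i"
    and S: "((\<lambda>t. infsum (B t) I) \<longlongrightarrow> infsum b I) F"
  shows "((\<lambda>t. \<Sum>\<^sub>\<infinity>i\<in>I. norm (f t i - g i)) \<longlongrightarrow> 0) F"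
proof (rule tendstoI)
  fix e :: real assume "e > 0"
  then have "e / 8 > 0" by simp
  then obtain G where G: "finite G" "G \<subseteq> I" "dist (sum b G) (infsum b I) \<le> e / 8"
    using infsum_finite_approximation[OF b] by blast
  have 1: "\<forall>\<^sub>F t in F. dist (infsum (B t) I) (infsum b I) < e / 8"
    using S \<open>e / 8 > 0\<close> by (rule tendstoD)
  have "((\<lambda>t. \<Sum>i\<in>G. B t i) \<longlongrightarrow> (\<Sum>i\<in>G. b i)) F"
    using G by (intro tendsto_sum B) auto
  from tendstoD[OF this \<open>e / 8 > 0\<close>]
  have 2: "\<forall>\<^sub>F t in F. dist (\<Sum>i\<in>G. B t i) (\<Sum>i\<in>G. b i) < e / 8" .
  have "((\<lambda>t. \<Sum>i\<in>G. norm (f t i - g i)) \<longlongrightarrow> (\<Sum>i\<in>G. norm (g i - g i))) F"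
    using G by (intro tendsto_intros f) auto
  from tendstoD[OF this \<open>e / 8 > 0\<close>]
  have 3: "\<forall>\<^sub>F t in F. dist (\<Sum>i\<in>G. norm (f t i - g i)) 0 < e / 8" by simp
  show "\<forall>\<^sub>F t in F. dist (\<Sum>\<^sub>\<infinity>i\<in>I. norm (f t i - g i)) 0 < e"
    using 1 2 3 f_le
  proof eventually_elim
    fix t
    assume d: "dist (infsum (B t) I) (infsum b I) < e / 8" "dist (\<Sum>i\<in>G. B t i) (\<Sum>i\<in>G. b i) < e / 8"
      "dist (\<Sum>i\<in>G. norm (f t i - g i)) 0 < e / 8"
      and B': "B t summable_on I \<and> (\<forall>i\<in>I. norm (f t i) \<le> B t i)"
    have split: "infsum h I = sum h G + infsum h (I - G)" if "h summable_on I" for h :: "'i \<Rightarrow> real"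
      using infsum_Un_disjoint[of h G "I - G"] G summable_on_subset[OF that, of "I - G"]
      by (simp add: Un_absorb1)
    have le: "norm (f t i - g i) \<le> B t i + b i" if "i \<in> I" for i
      using norm_triangle_ineq4[of "f t i" "g i"] B' g_le[OF that] that by fastforce
    have sBb: "(\<lambda>i. B t i + b i) summable_on I" using B' b by (intro summable_on_add) auto
    have sn: "(\<lambda>i. norm (f t i - g i)) summable_on I"
      by (rule summable_on_comparison_test[OF sBb]) (auto intro: le)
    have "infsum (\<lambda>i. norm (f t i - g i)) (I - G) \<le> infsum (\<lambda>i. B t i + b i) (I - G)"
      by (intro infsum_mono summable_on_subset[OF sn] summable_on_subset[OF sBb] le) auto
    also have "\<dots> = infsum (B t) (I - G) + infsum b (I - G)"
      using B' b by (intro infsum_add) (auto intro: summable_on_subset)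
    also have "\<dots> = (infsum (B t) I - sum (B t) G) + (infsum b I - sum b G)"
      using split[of "B t"] split[OF b] B' by simp
    also have "\<dots> < 5 * e / 8" using d G(3) \<open>e > 0\<close> unfolding dist_real_def by linarith
    finally have "infsum (\<lambda>i. norm (f t i - g i)) I < e"
      using split[OF sn] d(3) \<open>e > 0\<close> unfolding dist_real_def by linarith
    moreover have "infsum (\<lambda>i. norm (f t i - g i)) I \<ge> 0" by (rule infsum_nonneg) simp
    ultimately show "dist (\<Sum>\<^sub>\<infinity>i\<in>I. norm (f t i - g i)) 0 < e" by (simp add: dist_real_def)
  qed
qed

lemma infsum_tendsto_dominated:
  fixes f :: "'t \<Rightarrow> 'i \<Rightarrow> 'x::banach" and B :: "'t \<Rightarrow> 'i \<Rightarrow> real"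
  assumes f: "\<And>i. i \<in> I \<Longrightarrow> ((\<lambda>t. f t i) \<longlongrightarrow> g i) F"
    and B: "\<And>i. i \<in> I \<Longrightarrow> ((\<lambda>t. B t i) \<longlongrightarrow> b i) F"
    and f_le: "\<forall>\<^sub>F t in F. B t summable_on I \<and> (\<forall>i\<in>I. norm (f t i) \<le> B t i)"
    and b: "b summable_on I" and g_le: "\<And>i. i \<in> I \<Longrightarrow> norm (g i) \<le> b i"
    and S: "((\<lambda>t. infsum (B t) I) \<longlongrightarrow> infsum b I) F"
  shows "((\<lambda>t. infsum (f t) I) \<longlongrightarrow> infsum g I) F"
proof -
  have "((\<lambda>t. \<Sum>\<^sub>\<infinity>i\<in>I. norm (f t i - g i)) \<longlongrightarrow> 0) F"
    by (rule infsum_norm_diff_tendsto_0[OF assms])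
  moreover have "\<forall>\<^sub>F t in F. norm (infsum (f t) I - infsum g I) \<le> (\<Sum>\<^sub>\<infinity>i\<in>I. norm (f t i - g i))"
    using f_le
  proof eventually_elim
    fix t assume *: "B t summable_on I \<and> (\<forall>i\<in>I. norm (f t i) \<le> B t i)"
    have sf: "(\<lambda>i. norm (f t i)) summable_on I"
      by (rule summable_on_comparison_test[of "B t"]) (use * in auto)
    have sg: "(\<lambda>i. norm (g i)) summable_on I"
      by (rule summable_on_comparison_test[OF b]) (use g_le in auto)
    have "(\<lambda>i. norm (f t i - g i)) summable_on I"
      by (rule summable_on_comparison_test[OF summable_on_add[OF sf sg]]) (auto intro: norm_triangle_ineq4)
    from norm_infsum_bound[OF this]
    show "norm (infsum (f t) I - infsum g I) \<le> (\<Sum>\<^sub>\<infinity>i\<in>I. norm (f t i - g i))"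
      using infsum_add[OF abs_summable_summable[OF sf] summable_on_uminus[THEN iffD2, OF abs_summable_summable[OF sg]]]
      by (simp add: infsum_uminus)
  qed
  ultimately have "((\<lambda>t. infsum (f t) I - infsum g I) \<longlongrightarrow> 0) F"
    by (rule Lim_null_comparison[rotated])
  then show ?thesis by (rule Lim_null[THEN iffD2])
qed

text \<open>Well-order the points and let \<open>\<gamma>\<^sub>t(y)\<close> be the first point of
  \<open>S\<close> at distance less than \<open>t\<close> from \<open>y\<close>. The function
  \<open>\<phi> x\<close> measures, up to a constant, the set of those \<open>t\<close>
  between \<open>\<epsilon>/2\<close> and \<open>\<epsilon>\<close> for which
  \<open>\<gamma>\<^sub>t(y) = x\<close>. This set is an interval whose end points are a
  distance and an infimum of distances, hence Lipschitz in \<open>y\<close>, and the intervals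
  of the different points fill the range of \<open>t\<close>. The family need not be locally
  finite; in its applications the constant total sum takes the place of local finiteness, by
  dominated convergence.\<close>

lemma metric_partition_of_unity:
  fixes S :: "'x::metric_space set" and \<epsilon> :: real
  assumes "\<epsilon> > 0"
  obtains \<phi> :: "'x \<Rightarrow> 'x \<Rightarrow> real" where
    "\<And>x y. 0 \<le> \<phi> x y" "\<And>x y. \<phi> x y \<noteq> 0 \<Longrightarrow> dist y x < \<epsilon>"
    "\<And>x. continuous_on UNIV (\<phi> x)" "\<And>y. y \<in> S \<Longrightarrow> ((\<lambda>x. \<phi> x y) has_sum 1) S"
proof -
  obtain r :: "'x rel" where r: "well_order_on UNIV r" using well_order_on by blast
  define R where "R = r - Id"
  have wfR: "wf R" using r by (simp add: R_def well_order_on_def)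
  have lin: "linear_order_on UNIV r" using r by (simp add: well_order_on_def)
  have R_trans: "(x, z) \<in> R" if "(x, y) \<in> R" "(y, z) \<in> R" for x y z
  proof -
    have "trans r" "antisym r"
      using lin by (auto simp: linear_order_on_def partial_order_on_def preorder_on_def)
    have "(x, y) \<in> r" "(y, z) \<in> r" "x \<noteq> y" using that by (auto simp: R_def)
    then have "(x, z) \<in> r" "x \<noteq> z"
      using transD[OF \<open>trans r\<close>] antisymD[OF \<open>antisym r\<close>] by blast+
    then show ?thesis by (simp add: R_def)
  qed
  have R_total: "x = y \<or> (x, y) \<in> R \<or> (y, x) \<in> R" for x y
    using lin unfolding R_def linear_order_on_def total_on_def by auto
  have R_irrefl: "(x, x) \<notin> R" for x by (simp add: R_def)
  \<comment> \<open>The interval of \<open>x\<close> runs from \<open>n x y\<close> to \<open>m x y\<close>,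
    where \<open>m\<close> is the infimum of the truncated distances to the predecessors of
    \<open>x\<close>, and \<open>n\<close> takes \<open>x\<close> itself into account as
    well.\<close>
  define c where "c z y = max (\<epsilon> / 2) (dist y z)" for z y :: 'x
  define A where "A x y = insert \<epsilon> ((\<lambda>z. c z y) ` {z \<in> S. (z, x) \<in> R})" for x y
  define m where "m x y = Inf (A x y)" for x y
  define n where "n x y = min (m x y) (c x y)" for x y
  define \<phi> where "\<phi> x y = (m x y - n x y) * (2 / \<epsilon>)" for x y
  have A_lb: "\<epsilon> / 2 \<le> a" if "a \<in> A x y" for a x y
    using that \<open>\<epsilon> > 0\<close> by (auto simp: A_def c_def)
  then have A_bdd: "bdd_below (A x y)" for x y by (rule bdd_belowI)
  have A_ne: "A x y \<noteq> {}" for x y by (simp add: A_def)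
  have A_cases: "a = \<epsilon> \<or> (\<exists>z. z \<in> S \<and> (z, x) \<in> R \<and> a = c z y)" if "a \<in> A x y" for a x y
    using that unfolding A_def by blast
  have m_lb: "\<epsilon> / 2 \<le> m x y" for x y
    unfolding m_def using A_ne A_lb by (rule cInf_greatest)
  have m_ub: "m x y \<le> \<epsilon>" for x y
    unfolding m_def by (rule cInf_lower[OF _ A_bdd]) (simp add: A_def)
  have m_le_c: "m x y \<le> c z y" if "z \<in> S" "(z, x) \<in> R" for x y z
    unfolding m_def by (rule cInf_lower[OF _ A_bdd]) (use that in \<open>auto simp: A_def\<close>)
  have m_mono: "m x y \<le> m z y" if "(z, x) \<in> R" for x y z
    unfolding m_def by (rule cInf_superset_mono[OF A_ne A_bdd]) (use that R_trans in \<open>auto simp: A_def\<close>)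
  have n_lb: "\<epsilon> / 2 \<le> n x y" for x y using m_lb by (simp add: n_def c_def)
  have n_le: "n x y \<le> m x y" for x y by (simp add: n_def)
  have c_lip: "c z y \<le> c z y' + dist y y'" for z y y'
    using dist_triangle[of y z y'] zero_le_dist[of y y'] unfolding c_def by linarith
  have m_lip: "m x y \<le> m x y' + dist y y'" for x y y'
  proof -
    have "m x y - dist y y' \<le> m x y'"
      unfolding m_def[of x y']
    proof (rule cInf_greatest[OF A_ne])
      fix a assume "a \<in> A x y'"
      from A_cases[OF this] consider "a = \<epsilon>" | z where "z \<in> S" "(z, x) \<in> R" "a = c z y'"
        by blast
      then show "m x y - dist y y' \<le> a"
      proof cases
        case 1
        then show ?thesis using m_ub[of x y] zero_le_dist[of y y'] by linarith
      next
        case (2 z)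
        then show ?thesis using m_le_c[of z x y] c_lip[of z y y'] by linarith
      qed
    qed
    then show ?thesis by simp
  qed
  have cont: "continuous_on UNIV h" if h: "\<And>y y'. h y \<le> h y' + dist y y'" for h :: "'x \<Rightarrow> real"
  proof (rule continuous_on_iff[THEN iffD2], intro ballI allI impI)
    fix y :: 'x and e :: real assume "e > 0"
    have "\<bar>h y' - h y\<bar> \<le> dist y' y" for y'
      using h[of y y'] h[of y' y] by (simp add: dist_commute abs_le_iff)
    then show "\<exists>d>0. \<forall>y'\<in>UNIV. dist y' y < d \<longrightarrow> dist (h y') (h y) < e"
      using \<open>e > 0\<close> by (intro exI[of _ e]) (auto simp: dist_real_def intro: le_less_trans)
  qed
  have \<phi>_cont: "continuous_on UNIV (\<phi> x)" for x
    unfolding \<phi>_def n_def by (intro continuous_intros cont m_lip c_lip)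
  have \<phi>_nonneg: "0 \<le> \<phi> x y" for x y
    using n_le[of x y] \<open>\<epsilon> > 0\<close> by (simp add: \<phi>_def)
  have \<phi>_supp: "dist y x < \<epsilon>" if "\<phi> x y \<noteq> 0" for x y
  proof -
    have "n x y < m x y" using that n_le[of x y] by (auto simp: \<phi>_def)
    then have "c x y < m x y" by (auto simp: n_def min_def split: if_splits)
    then show ?thesis using m_ub[of x y] by (simp add: c_def)
  qed
  have max_ex: "\<exists>z\<in>G. \<forall>w\<in>G. w = z \<or> (w, z) \<in> R" if "finite G" "G \<noteq> {}" for G
    using that
  proof (induction rule: finite_ne_induct)
    case (insert x G)
    then obtain z where z: "z \<in> G" "\<forall>w\<in>G. w = z \<or> (w, z) \<in> R" by blast
    show ?case
    proof (cases "(x, z) \<in> R")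
      case True then show ?thesis using z by blast
    next
      case False
      then have "x = z \<or> (z, x) \<in> R" using R_total by blast
      then have "w = x \<or> (w, x) \<in> R" if "w \<in> G" for w
        using z(2) that R_trans[of w z x] by metis
      then show ?thesis by blast
    qed
  qed simp
  \<comment> \<open>The intervals of the points before \<open>x\<close> are disjoint and lie above \<open>m
    x y\<close>.\<close>
  have ub: "(\<Sum>z\<in>G. m z y - n z y) \<le> \<epsilon> - m x y"
    if "finite G" "G \<subseteq> S" "\<forall>z\<in>G. (z, x) \<in> R" for G x y
    using wfR that
  proof (induction x arbitrary: G rule: wf_induct_rule)
    case (less x)
    show ?case
    proof (cases "G = {}")
      case True
      have "0 \<le> \<epsilon> - m x y" using m_ub[of x y] by linarith
      then show ?thesis unfolding True sum.empty .
    next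
      case False
      then obtain z where z: "z \<in> G" "\<forall>w\<in>G. w = z \<or> (w, z) \<in> R"
        using max_ex[OF less.prems(1)] by blast
      have "(z, x) \<in> R" "z \<in> S" using less.prems z(1) by auto
      have "(\<Sum>w\<in>G - {z}. m w y - n w y) \<le> \<epsilon> - m z y"
        by (rule less.IH[OF \<open>(z, x) \<in> R\<close>]) (use less.prems z in auto)
      moreover have "(\<Sum>w\<in>G. m w y - n w y) = (m z y - n z y) + (\<Sum>w\<in>G - {z}. m w y - n w y)"
        using z(1) less.prems(1) by (simp add: sum.remove)
      moreover have "m x y \<le> n z y"
        using m_mono[OF \<open>(z, x) \<in> R\<close>, of y] m_le_c[OF \<open>z \<in> S\<close> \<open>(z, x) \<in> R\<close>, of y]
        by (simp add: n_def)
      ultimately show ?thesis by linarith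
    qed
  qed
  have ub': "(\<Sum>z\<in>G. m z y - n z y) \<le> \<epsilon> / 2" if "finite G" "G \<subseteq> S" for G y
  proof (cases "G = {}")
    case False
    then obtain z where z: "z \<in> G" "\<forall>w\<in>G. w = z \<or> (w, z) \<in> R" using max_ex[OF \<open>finite G\<close>] by blast
    have "(\<Sum>w\<in>G - {z}. m w y - n w y) \<le> \<epsilon> - m z y" by (rule ub) (use that z in auto)
    moreover have "(\<Sum>w\<in>G. m w y - n w y) = (m z y - n z y) + (\<Sum>w\<in>G - {z}. m w y - n w y)"
      using z that by (simp add: sum.remove)
    ultimately show ?thesis using n_lb[of z y] by linarith
  qed (use \<open>\<epsilon> > 0\<close> in simp)
  \<comment> \<open>Finitely many of them fill the range from \<open>m x y\<close> to
    \<open>\<epsilon>\<close> up to \<open>\<eta>\<close>. Choosing a predecessor that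
    nearly attains the infimum covers successor and limit positions alike.\<close>
  have lb: "\<exists>G. finite G \<and> G \<subseteq> S \<and> (\<forall>z\<in>G. (z, x) \<in> R) \<and> \<epsilon> - m x y - \<eta> \<le> (\<Sum>z\<in>G. m z y - n z y)"
    if "\<eta> > 0" for x y \<eta>
    using wfR that
  proof (induction x arbitrary: \<eta> rule: wf_induct_rule)
    case (less x)
    have "Inf (A x y) < m x y + \<eta> / 2" using less.prems by (simp add: m_def)
    then obtain a where a: "a \<in> A x y" "a < m x y + \<eta> / 2"
      using cInf_lessD[OF A_ne] by blast
    from A_cases[OF a(1)] consider "a = \<epsilon>" | z where "z \<in> S" "(z, x) \<in> R" "a = c z y" by blast
    then show ?case
    proof cases
      case 1
      then show ?thesis using a less.prems by (intro exI[of _ "{}"]) auto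
    next
      case (2 z)
      obtain G where G: "finite G" "G \<subseteq> S" "\<forall>w\<in>G. (w, z) \<in> R"
        "\<epsilon> - m z y - \<eta> / 2 \<le> (\<Sum>z\<in>G. m z y - n z y)"
        using less.IH[OF 2(2), of "\<eta> / 2"] less.prems by auto
      have "z \<notin> G" using G(3) R_irrefl by blast
      then have "(\<Sum>z\<in>insert z G. m z y - n z y) = m z y - n z y + (\<Sum>z\<in>G. m z y - n z y)"
        using G by simp
      moreover have "n z y \<le> c z y" by (simp add: n_def)
      ultimately have "\<epsilon> - m x y - \<eta> \<le> (\<Sum>z\<in>insert z G. m z y - n z y)"
        using G(4) a(2) 2(3) by linarith
      moreover have "\<forall>w\<in>insert z G. (w, x) \<in> R" using G(3) 2(2) R_trans[OF _ 2(2)] by auto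
      ultimately show ?thesis using G(1,2) 2(1) by (intro exI[of _ "insert z G"]) auto
    qed
  qed
  have \<phi>_sum: "((\<lambda>x. \<phi> x y) has_sum 1) S" if "y \<in> S" for y
  proof -
    have sum_\<phi>: "(\<Sum>x\<in>G. \<phi> x y) = (\<Sum>x\<in>G. m x y - n x y) * (2 / \<epsilon>)" for G
      by (simp only: \<phi>_def sum_distrib_right)
    have le: "(\<Sum>x\<in>G. \<phi> x y) \<le> 1" if "finite G" "G \<subseteq> S" for G
      using mult_right_mono[OF ub'[OF that, of y], of "2 / \<epsilon>"] \<open>\<epsilon> > 0\<close> by (simp add: sum_\<phi>)
    have s: "(\<lambda>x. \<phi> x y) summable_on S"
      by (rule nonneg_bdd_above_summable_on) (auto intro!: \<phi>_nonneg bdd_aboveI[of _ 1] le)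
    have "1 - \<eta> \<le> (\<Sum>\<^sub>\<infinity>x\<in>S. \<phi> x y)" if "\<eta> > 0" for \<eta>
    proof -
      obtain G where G: "finite G" "G \<subseteq> S" "\<forall>w\<in>G. (w, y) \<in> R"
        "\<epsilon> - m y y - \<eta> * (\<epsilon> / 2) \<le> (\<Sum>z\<in>G. m z y - n z y)"
        using lb[of "\<eta> * (\<epsilon> / 2)" y y] \<open>\<epsilon> > 0\<close> \<open>\<eta> > 0\<close> by auto
      have "y \<notin> G" using G(3) R_irrefl by blast
      then have "(\<Sum>z\<in>insert y G. m z y - n z y) = m y y - n y y + (\<Sum>z\<in>G. m z y - n z y)"
        using G by simp
      moreover have "n y y \<le> \<epsilon> / 2" using \<open>\<epsilon> > 0\<close> by (simp add: n_def c_def)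
      ultimately have "\<epsilon> / 2 - \<eta> * (\<epsilon> / 2) \<le> (\<Sum>z\<in>insert y G. m z y - n z y)"
        using G(4) by linarith
      then have "(\<epsilon> / 2 - \<eta> * (\<epsilon> / 2)) * (2 / \<epsilon>) \<le> (\<Sum>x\<in>insert y G. \<phi> x y)"
        unfolding sum_\<phi> using \<open>\<epsilon> > 0\<close> by (intro mult_right_mono) auto
      moreover have "(\<epsilon> / 2 - \<eta> * (\<epsilon> / 2)) * (2 / \<epsilon>) = 1 - \<eta>" using \<open>\<epsilon> > 0\<close> by (simp add: field_simps)
      moreover have "(\<Sum>x\<in>insert y G. \<phi> x y) \<le> (\<Sum>\<^sub>\<infinity>x\<in>S. \<phi> x y)"
        using G \<open>y \<in> S\<close> \<phi>_nonneg by (intro finite_sum_le_infsum[OF s]) auto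
      ultimately show ?thesis by linarith
    qed
    then have "1 \<le> (\<Sum>\<^sub>\<infinity>x\<in>S. \<phi> x y)" by (metis diff_le_eq field_le_epsilon)
    moreover have "(\<Sum>\<^sub>\<infinity>x\<in>S. \<phi> x y) \<le> 1" by (rule infsum_le_finite_sums[OF s le])
    ultimately show ?thesis using has_sum_infsum[OF s] by (metis antisym)
  qed
  show ?thesis by (rule that[OF \<phi>_nonneg \<phi>_supp \<phi>_cont \<phi>_sum])
qed

section \<open>Continuous selections\<close>

text \<open>A partition of unity glues the approximate preimages \<open>v x\<close> into a continuous
  \<open>s0\<close> that solves \<open>q v = y\<close> with relative error \<open>3/4\<close>:
  half of the norm from the approximate preimage, a quarter from the radius of the partition.
  Applying \<open>s0\<close> repeatedly to the remaining error gives a series that converges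
  geometrically to an exact solution.\<close>

theorem Bartle_Graves_selection:
  fixes q :: "'e::banach \<Rightarrow> 'x::banach"
  assumes q: "bounded_linear q" and V: "subspace V" "closed V" and F: "subspace F" and qV: "\<And>v. v \<in> V \<Longrightarrow> q v \<in> F"
    and approx: "\<And>y. y \<in> F \<Longrightarrow> norm y = 1 \<Longrightarrow> \<exists>v\<in>V. norm v \<le> C \<and> norm (y - q v) \<le> 1 / 2"
    and "0 \<le> C"
  obtains s D where "continuous_on F s" "\<And>y. y \<in> F \<Longrightarrow> s y \<in> V" "\<And>y. y \<in> F \<Longrightarrow> q (s y) = y"
    "\<And>y. y \<in> F \<Longrightarrow> norm (s y) \<le> D * norm y"
proof -
  define S where "S = {y \<in> F. norm y = 1}"
  obtain v where v: "\<And>y. y \<in> S \<Longrightarrow> v y \<in> V \<and> norm (v y) \<le> C \<and> norm (y - q (v y)) \<le> 1 / 2"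
    using approx unfolding S_def by (metis (mono_tags, lifting) mem_Collect_eq)
  obtain \<phi> :: "'x \<Rightarrow> 'x \<Rightarrow> real" where \<phi>: "\<And>x y. 0 \<le> \<phi> x y" "\<And>x y. \<phi> x y \<noteq> 0 \<Longrightarrow> dist y x < 1 / 4"
    "\<And>x. continuous_on UNIV (\<phi> x)" "\<And>y. y \<in> S \<Longrightarrow> ((\<lambda>x. \<phi> x y) has_sum 1) S"
    using metric_partition_of_unity[of "1 / 4" S] by auto
  define s1 where "s1 y = (\<Sum>\<^sub>\<infinity>x\<in>S. \<phi> x y *\<^sub>R v x)" for y
  have \<phi>C: "((\<lambda>x. \<phi> x y * C) has_sum C) S" if "y \<in> S" for y
    using has_sum_cmult_left[OF \<phi>(4)[OF that], of C] by simp
  have le: "norm (\<phi> x y *\<^sub>R v x) \<le> \<phi> x y * C" if "x \<in> S" for x y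
    using v[OF that] \<phi>(1) by (simp add: mult_left_mono)
  have abs: "(\<lambda>x. norm (\<phi> x y *\<^sub>R v x)) summable_on S" if "y \<in> S" for y
    by (rule summable_on_comparison_test[OF has_sum_imp_summable[OF \<phi>C[OF that]]]) (auto simp del: norm_scaleR intro: le)
  have s1_norm: "norm (s1 y) \<le> C" if "y \<in> S" for y
  proof -
    have "norm (s1 y) \<le> (\<Sum>\<^sub>\<infinity>x\<in>S. norm (\<phi> x y *\<^sub>R v x))"
      unfolding s1_def by (rule norm_infsum_bound[OF abs[OF that]])
    also have "\<dots> \<le> (\<Sum>\<^sub>\<infinity>x\<in>S. \<phi> x y * C)"
      by (rule infsum_mono[OF abs[OF that] has_sum_imp_summable[OF \<phi>C[OF that]]]) (rule le)
    also have "\<dots> = C" by (rule infsumI[OF \<phi>C[OF that]])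
    finally show ?thesis .
  qed
  have s1_V: "s1 y \<in> V" for y
    unfolding s1_def by (rule infsum_in_closed_subspace[OF V]) (use v V in \<open>auto intro: subspace_scale\<close>)
  have s1_cont: "continuous_on S s1"
    unfolding continuous_on_def
  proof
    fix y assume "y \<in> S"
    have *: "((\<lambda>t. \<phi> x t) \<longlongrightarrow> \<phi> x y) (at y within S)" for x
      using continuous_on_subset[OF \<phi>(3) subset_UNIV[of S]] \<open>y \<in> S\<close> by (auto simp: continuous_on_def)
    have ev: "\<forall>\<^sub>F t in at y within S. t \<in> S" by (simp add: eventually_at_filter)
    show "(s1 \<longlongrightarrow> s1 y) (at y within S)"
      unfolding s1_def
    proof (rule infsum_tendsto_dominated[where B = "\<lambda>t x. \<phi> x t * C" and b = "\<lambda>x. \<phi> x y * C"])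
      show "((\<lambda>t. \<phi> x t *\<^sub>R v x) \<longlongrightarrow> \<phi> x y *\<^sub>R v x) (at y within S)" for x by (intro tendsto_intros *)
      show "((\<lambda>t. \<phi> x t * C) \<longlongrightarrow> \<phi> x y * C) (at y within S)" for x by (intro tendsto_intros *)
      show "\<forall>\<^sub>F t in at y within S. (\<lambda>x. \<phi> x t * C) summable_on S \<and> (\<forall>x\<in>S. norm (\<phi> x t *\<^sub>R v x) \<le> \<phi> x t * C)"
        using ev by eventually_elim (use has_sum_imp_summable[OF \<phi>C] le in blast)
      show "(\<lambda>x. \<phi> x y * C) summable_on S" by (rule has_sum_imp_summable[OF \<phi>C[OF \<open>y \<in> S\<close>]])
      show "norm (\<phi> x y *\<^sub>R v x) \<le> \<phi> x y * C" if "x \<in> S" for x by (rule le[OF that])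
      have "\<forall>\<^sub>F t in at y within S. infsum (\<lambda>x. \<phi> x y * C) S = infsum (\<lambda>x. \<phi> x t * C) S"
        using ev by eventually_elim (simp only: infsumI[OF \<phi>C] infsumI[OF \<phi>C[OF \<open>y \<in> S\<close>]])
      then show "((\<lambda>t. \<Sum>\<^sub>\<infinity>x\<in>S. \<phi> x t * C) \<longlongrightarrow> (\<Sum>\<^sub>\<infinity>x\<in>S. \<phi> x y * C)) (at y within S)"
        by (rule Lim_transform_eventually[OF tendsto_const])
    qed
  qed
  have s1_approx: "norm (y - q (s1 y)) \<le> 3 / 4" if "y \<in> S" for y
  proof -
    have "((\<lambda>x. q (\<phi> x y *\<^sub>R v x)) has_sum q (s1 y)) S"
      unfolding s1_def by (rule has_sum_bounded_linear[OF q has_sum_infsum[OF abs_summable_summable[OF abs[OF that]]]])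
    moreover have "((\<lambda>x. \<phi> x y *\<^sub>R y) has_sum 1 *\<^sub>R y) S"
      by (rule has_sum_bounded_linear[OF bounded_linear_scaleR_left \<phi>(4)[OF that]])
    ultimately have "((\<lambda>x. \<phi> x y *\<^sub>R y + - q (\<phi> x y *\<^sub>R v x)) has_sum 1 *\<^sub>R y + - q (s1 y)) S"
      by (intro has_sum_add has_sum_uminus[THEN iffD2]) auto
    then have *: "((\<lambda>x. \<phi> x y *\<^sub>R (y - q (v x))) has_sum y - q (s1 y)) S"
      by (simp add: linear_cmul[OF bounded_linear.linear[OF q]] scaleR_diff_right)
    have **: "norm (\<phi> x y *\<^sub>R (y - q (v x))) \<le> \<phi> x y * (3 / 4)" if "x \<in> S" for x
    proof (cases "\<phi> x y = 0")
      case False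
      have "norm (y - q (v x)) \<le> norm (y - x) + norm (x - q (v x))" by (metis norm_triangle_ineq diff_add_cancel add_diff_eq)
      also have "\<dots> \<le> 3 / 4" using v[OF that] \<phi>(2)[OF False] by (simp add: dist_norm)
      finally have "norm (y - q (v x)) \<le> 3 / 4" .
      from mult_left_mono[OF this \<phi>(1)[of x y]] show ?thesis using \<phi>(1)[of x y] by simp
    qed simp
    show ?thesis
      using norm_infsum_le[OF * has_sum_cmult_left[OF \<phi>(4)[OF that], of "3 / 4"] **] by simp
  qed
  \<comment> \<open>The selection is built on the unit sphere and extended homogeneously; since
    \<^term>\<open>sgn 0 = 0\<close>, the origin needs no separate clause.\<close>
  define s0 where "s0 y = norm y *\<^sub>R s1 (sgn y)" for y
  have sgnS: "sgn y \<in> S" if "y \<in> F" "y \<noteq> 0" for y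
    using that F by (auto simp: S_def sgn_div_norm subspace_scale)
  have s0_V: "s0 y \<in> V" for y using s1_V V(1) by (simp add: s0_def subspace_scale)
  have s0_norm: "norm (s0 y) \<le> C * norm y" if "y \<in> F" for y
  proof (cases "y = 0")
    case False
    then show ?thesis using s1_norm[OF sgnS[OF that False]] by (simp add: s0_def mult.commute mult_right_mono)
  qed (simp add: s0_def)
  have s0_approx: "norm (y - q (s0 y)) \<le> 3 / 4 * norm y" if "y \<in> F" for y
  proof (cases "y = 0")
    case True
    then show ?thesis by (simp add: s0_def linear_0[OF bounded_linear.linear[OF q]])
  next
    case False
    have "y - q (s0 y) = norm y *\<^sub>R (sgn y - q (s1 (sgn y)))"
      using False by (simp add: s0_def linear_cmul[OF bounded_linear.linear[OF q]] scaleR_diff_right sgn_div_norm)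
    then show ?thesis
      using mult_left_mono[OF s1_approx[OF sgnS[OF that False]] norm_ge_zero[of y]] by (simp add: mult.commute)
  qed
  have s0_cont: "continuous_on F s0"
    unfolding continuous_on_def
  proof
    fix y assume "y \<in> F"
    show "(s0 \<longlongrightarrow> s0 y) (at y within F)"
    proof (cases "y = 0")
      case True
      have "(s0 \<longlongrightarrow> 0) (at 0 within F)"
      proof (rule Lim_null_comparison)
        show "\<forall>\<^sub>F x in at 0 within F. norm (s0 x) \<le> C * norm x"
          by (simp add: eventually_at_filter s0_norm)
        show "((\<lambda>x. C * norm x) \<longlongrightarrow> 0) (at 0 within F)"
          by (rule tendsto_eq_intros tendsto_ident_at refl | simp)+
      qed
      then show ?thesis using True by (simp add: s0_def)
    next
      case False
      have "continuous_on (F - {0}) s0"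
        unfolding s0_def
        by (intro continuous_intros continuous_on_compose2[OF s1_cont]) (use sgnS in auto)
      then have "(s0 \<longlongrightarrow> s0 y) (at y within F - {0})"
        using False \<open>y \<in> F\<close> by (auto simp: continuous_on_def)
      moreover have "at y within F - {0} = at y within F"
        by (rule at_within_nhd[of _ "- {0}"]) (use False in auto)
      ultimately show ?thesis by simp
    qed
  qed
  \<comment> \<open>The error that is left after one approximate solution; \<open>R n\<close> is the error
    after \<open>n\<close> of them.\<close>
  define r where "r y = y - q (s0 y)" for y
  have r_F: "r y \<in> F" if "y \<in> F" for y using that F qV s0_V by (auto simp: r_def subspace_diff)
  have r_cont: "continuous_on F r"
    unfolding r_def by (intro continuous_intros bounded_linear.continuous_on[OF q] s0_cont)
  define R where "R n = r ^^ n" for n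
  have R_F: "R n y \<in> F" if "y \<in> F" for n y using that by (induction n) (auto simp: R_def r_F)
  have R_cont: "continuous_on F (R n)" for n
  proof (induction n)
    case (Suc n)
    then show ?case
      unfolding R_def using R_F[of _ n] continuous_on_compose2[OF r_cont, of F "r ^^ n"]
      by (auto simp: R_def o_def)
  qed (simp add: R_def continuous_on_id)
  have R_norm: "norm (R n y) \<le> (3 / 4) ^ n * norm y" if "y \<in> F" for n y
  proof (induction n)
    case (Suc n)
    have "norm (R (Suc n) y) \<le> 3 / 4 * norm (R n y)"
      using s0_approx[OF R_F[OF that, of n]] by (simp add: R_def r_def)
    then show ?case using Suc by simp
  qed (simp add: R_def)
  define g where "g = (\<Sum>\<^sub>\<infinity>n. (3 / 4 :: real) ^ n)"
  have g: "((\<lambda>n. (3 / 4 :: real) ^ n) has_sum g) UNIV"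
    unfolding g_def by (rule has_sum_infsum) (simp add: summable_on_UNIV_nonneg_real_iff summable_geometric)
  define s where "s y = (\<Sum>\<^sub>\<infinity>n. s0 (R n y))" for y
  have B: "norm (s0 (R n y)) \<le> C * ((3 / 4) ^ n * norm y)" if "y \<in> F" for n y
    using s0_norm[OF R_F[OF that, of n]] mult_left_mono[OF R_norm[OF that, of n] \<open>0 \<le> C\<close>] by linarith
  have gB: "((\<lambda>n. C * ((3 / 4) ^ n * norm y)) has_sum C * (g * norm y)) UNIV" for y :: 'x
    by (intro has_sum_cmult_right has_sum_cmult_left g)
  have s_abs: "(\<lambda>n. norm (s0 (R n y))) summable_on UNIV" if "y \<in> F" for y
    by (rule summable_on_comparison_test[OF has_sum_imp_summable[OF gB[of y]]]) (auto intro: B that)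
  have hs: "((\<lambda>n. s0 (R n y)) has_sum s y) UNIV" if "y \<in> F" for y
    unfolding s_def by (rule has_sum_infsum[OF abs_summable_summable[OF s_abs[OF that]]])
  show thesis
  proof (rule that[of s "C * g"])
    show "continuous_on F s"
      unfolding continuous_on_def
    proof
      fix y assume "y \<in> F"
      have c: "((\<lambda>t. s0 (R n t)) \<longlongrightarrow> s0 (R n y)) (at y within F)" for n
        using continuous_on_compose2[OF s0_cont R_cont] R_F \<open>y \<in> F\<close> by (auto simp: continuous_on_def)
      show "(s \<longlongrightarrow> s y) (at y within F)"
        unfolding s_def
      proof (rule infsum_tendsto_dominated[where B = "\<lambda>t n. C * ((3 / 4) ^ n * norm t)" and b = "\<lambda>n. C * ((3 / 4) ^ n * norm y)"])
        show "((\<lambda>t. s0 (R n t)) \<longlongrightarrow> s0 (R n y)) (at y within F)" for n by (rule c)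
        show "((\<lambda>t. C * ((3 / 4) ^ n * norm t)) \<longlongrightarrow> C * ((3 / 4) ^ n * norm y)) (at y within F)" for n
          by (intro tendsto_intros)
        show "\<forall>\<^sub>F t in at y within F. (\<lambda>n. C * ((3 / 4) ^ n * norm t)) summable_on UNIV \<and>
            (\<forall>n\<in>UNIV. norm (s0 (R n t)) \<le> C * ((3 / 4) ^ n * norm t))"
          unfolding eventually_at_filter using has_sum_imp_summable[OF gB] B by (intro always_eventually) blast
        show "(\<lambda>n. C * ((3 / 4) ^ n * norm y)) summable_on UNIV" by (rule has_sum_imp_summable[OF gB])
        show "norm (s0 (R n y)) \<le> C * ((3 / 4) ^ n * norm y)" for n by (rule B[OF \<open>y \<in> F\<close>])
        show "((\<lambda>t. \<Sum>\<^sub>\<infinity>n. C * ((3 / 4) ^ n * norm t)) \<longlongrightarrow> (\<Sum>\<^sub>\<infinity>n. C * ((3 / 4) ^ n * norm y))) (at y within F)"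
          unfolding infsumI[OF gB] by (intro tendsto_intros)
      qed
    qed
    fix y assume "y \<in> F"
    show "s y \<in> V" unfolding s_def by (rule infsum_in_closed_subspace[OF V s0_V])
    show "norm (s y) \<le> C * g * norm y"
      using norm_infsum_le[OF hs[OF \<open>y \<in> F\<close>] gB] B[OF \<open>y \<in> F\<close>] by (simp add: mult.assoc)
    have "(\<lambda>n. q (s0 (R n y))) sums q (s y)"
      by (rule has_sum_imp_sums[OF has_sum_bounded_linear[OF q hs[OF \<open>y \<in> F\<close>]]])
    moreover have "(\<lambda>n. R n y - R (Suc n) y) sums (R 0 y - 0)"
    proof (rule telescope_sums')
      show "(\<lambda>n. R n y) \<longlonglongrightarrow> 0"
      proof (rule Lim_null_comparison)
        show "\<forall>\<^sub>F n in sequentially. norm (R n y) \<le> (3 / 4) ^ n * norm y"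
          using R_norm[OF \<open>y \<in> F\<close>] by simp
        show "(\<lambda>n. (3 / 4) ^ n * norm y) \<longlonglongrightarrow> 0"
          by (rule tendsto_mult_left_zero) (simp add: LIMSEQ_realpow_zero)
      qed
    qed
    moreover have "R n y - R (Suc n) y = q (s0 (R n y))" for n by (simp add: R_def r_def)
    ultimately show "q (s y) = y" using sums_unique2 by (fastforce simp: R_def)
  qed
qed

section \<open>The decomposition method\<close>

text \<open>The indices \<open>k\<close> with \<open>\<iota> k = n\<close> form disjoint blocks, and
  restricting a family to its blocks and relabelling each of them splits its norm.\<close>

lemma sum_norm_block_ops_le:
  fixes K :: "'k set" and \<iota> :: "'k \<Rightarrow> nat" and \<kappa> :: "'k \<Rightarrow> 'j"
  assumes "finite G"
  shows "(\<Sum>n\<in>G. norm (ell1_op (\<lambda>k. if k \<in> K \<and> \<iota> k = n then unit_ell1 (\<kappa> k) else 0) a)) \<le> norm a"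
proof -
  let ?z = "\<lambda>n k. if k \<in> K \<and> \<iota> k = n then unit_ell1 (\<kappa> k) else 0"
  let ?A = "\<lambda>n. {k \<in> K. \<iota> k = n}"
  have s: "(\<lambda>k. \<bar>coef a k\<bar>) summable_on A" for A using coef_abs_summable[of a A] by simp
  have "norm (ell1_op (?z n) a) \<le> (\<Sum>\<^sub>\<infinity>k\<in>?A n. \<bar>coef a k\<bar>)" for n
  proof -
    have "norm (ell1_op (?z n) a) \<le> (\<Sum>\<^sub>\<infinity>k. \<bar>coef a k\<bar> * norm (?z n k))"
      by (rule norm_ell1_op_le[of _ 1]) simp
    also have "\<dots> = (\<Sum>\<^sub>\<infinity>k\<in>?A n. \<bar>coef a k\<bar>)"
      by (rule infsum_cong_neutral) auto
    finally show ?thesis .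
  qed
  then have "(\<Sum>n\<in>G. norm (ell1_op (?z n) a)) \<le> (\<Sum>n\<in>G. \<Sum>\<^sub>\<infinity>k\<in>?A n. \<bar>coef a k\<bar>)"
    by (rule sum_mono)
  also have "\<dots> = (\<Sum>\<^sub>\<infinity>k\<in>(\<Union>n\<in>G. ?A n). \<bar>coef a k\<bar>)"
    by (rule sum_infsum[OF assms s]) auto
  also have "\<dots> \<le> norm a"
    unfolding norm_ell1_def by (rule infsum_mono2[OF s s]) auto
  finally show ?thesis .
qed

text \<open>Write \<open>l\<^sub>n\<close> for the slices of a family \<open>l\<close> under a bijection
  of \<open>nat \<times> K\<close> and \<open>K\<close>. The selection splits each slice into
  its image \<open>q l\<^sub>n\<close> and the kernel part \<open>l\<^sub>n - s (q
  l\<^sub>n)\<close>. Shifting the images by one place makes room for a further element of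
  \<open>F\<close>: the pair \<open>(y, l)\<close> is sent to the family with slices
  \<open>l\<^sub>n - s (q l\<^sub>n) + s (y\<^sub>n)\<close>, where \<open>y\<^sub>0 =
  y\<close> and \<open>y\<^sub>n\<close> is \<open>q\<close> of the slice before the
  \<open>n\<close>-th. The image parts of the new family are the \<open>y\<^sub>n\<close>, so
  shifting back inverts the map. Linear growth of \<open>s\<close> keeps the new slices
  summable and gives continuity by dominated convergence.\<close>

theorem ell1_absorbs_quotient:
  fixes q :: "'k ell1 \<Rightarrow> 'x::banach"
  assumes K: "infinite K" and q: "bounded_linear q" and F: "subspace F"
    and qF: "\<And>a. a \<in> ell1_on K \<Longrightarrow> q a \<in> F"
    and s_cont: "continuous_on F s" and s_on: "\<And>y. y \<in> F \<Longrightarrow> s y \<in> ell1_on K"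
    and qs: "\<And>y. y \<in> F \<Longrightarrow> q (s y) = y" and s_norm: "\<And>y. y \<in> F \<Longrightarrow> norm (s y) \<le> D * norm y"
  shows "(F \<times> ell1_on K) homeomorphic ell1_on K"
proof -
  let ?L = "ell1_on K"
  note L = subspace_ell1_on[of K]
  have "|UNIV :: nat set| \<le>o |K|" using K infinite_iff_card_of_nat by blast
  then have "|(UNIV :: nat set) \<times> K| =o |K|"
    using card_of_Times_infinite[OF K] by blast
  then obtain \<beta> where \<beta>: "bij_betw \<beta> ((UNIV :: nat set) \<times> K) K"
    using card_of_ordIso by blast
  define \<pi> where "\<pi> = inv_into ((UNIV :: nat set) \<times> K) \<beta>"
  have \<beta>_K: "\<beta> (n, k) \<in> K" if "k \<in> K" for n k using \<beta> that by (auto simp: bij_betw_def)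
  have \<pi>\<beta>: "\<pi> (\<beta> (n, k)) = (n, k)" if "k \<in> K" for n k
    unfolding \<pi>_def by (rule bij_betw_inv_into_left[OF \<beta>]) (use that in auto)
  have \<beta>\<pi>: "\<beta> (\<pi> k) = k" and \<pi>_K: "snd (\<pi> k) \<in> K" if "k \<in> K" for k
    using bij_betw_inv_into_right[OF \<beta> that] bij_betw_apply[OF bij_betw_inv_into[OF \<beta>] that]
    by (auto simp: \<pi>_def)
  define zS where "zS n k = (if k \<in> K \<and> fst (\<pi> k) = n then unit_ell1 (snd (\<pi> k)) else 0 :: 'k ell1)" for n k
  define zI where "zI n k = (if k \<in> K then unit_ell1 (\<beta> (n, k)) else 0 :: 'k ell1)" for n k
  have nS: "norm (zS n k) \<le> 1" and nI: "norm (zI n k) \<le> 1" for n k by (auto simp: zS_def zI_def)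
  define slice where "slice n = ell1_op (zS n)" for n
  define inj where "inj n = ell1_op (zI n)" for n
  have bl_slice: "bounded_linear (slice n)" for n unfolding slice_def by (rule bounded_linear_ell1_op[OF nS])
  have bl_inj: "bounded_linear (inj n)" for n unfolding inj_def by (rule bounded_linear_ell1_op[OF nI])
  have slice_L: "slice n a \<in> ?L" for n a
    unfolding slice_def by (rule ell1_op_in_closed_subspace[OF nS L closed_ell1_on])
      (use L in \<open>auto simp: zS_def subspace_0 intro: unit_ell1_in_ell1_on \<pi>_K\<close>)
  have inj_L: "inj n a \<in> ?L" for n a
    unfolding inj_def by (rule ell1_op_in_closed_subspace[OF nI L closed_ell1_on])
      (use L in \<open>auto simp: zI_def subspace_0 intro: unit_ell1_in_ell1_on \<beta>_K\<close>)
  have inj_norm: "norm (inj n a) \<le> norm a" for n a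
  proof -
    have "norm (inj n a) \<le> (\<Sum>\<^sub>\<infinity>k. \<bar>coef a k\<bar> * norm (zI n k))"
      unfolding inj_def by (rule norm_ell1_op_le[OF nI])
    also have "\<dots> \<le> (\<Sum>\<^sub>\<infinity>k. \<bar>coef a k\<bar>)"
    proof (rule infsum_mono)
      show "(\<lambda>k. \<bar>coef a k\<bar>) summable_on UNIV" using coef_abs_summable[of a UNIV] by simp
      then show "(\<lambda>k. \<bar>coef a k\<bar> * norm (zI n k)) summable_on UNIV"
        by (rule summable_on_comparison_test) (use nI[of n] in \<open>auto intro: mult_right_le_one_le\<close>)
      show "\<bar>coef a k\<bar> * norm (zI n k) \<le> \<bar>coef a k\<bar>" for k
        using nI[of n k] by (auto intro: mult_right_le_one_le)
    qed
    finally show ?thesis by (simp add: norm_ell1_def)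
  qed
  have slice_inj: "slice m (inj n a) = (if m = n then a else 0)" if "a \<in> ?L" for m n a
  proof -
    have "slice m (inj n a) = ell1_op (\<lambda>k. slice m (zI n k)) a"
      unfolding inj_def by (rule bounded_linear_ell1_op_comp[OF nI bl_slice])
    also have "\<dots> = ell1_op (\<lambda>k. if m = n then unit_ell1 k else 0) a"
    proof (rule ell1_op_cong)
      fix k assume "coef a k \<noteq> 0"
      then have "k \<in> K" using that by (auto simp: ell1_on_def)
      then show "slice m (zI n k) = (if m = n then unit_ell1 k else 0)"
        using \<beta>_K \<pi>\<beta> by (simp add: zI_def slice_def ell1_op_unit[OF nS]) (simp add: zS_def)
    qed
    also have "\<dots> = (if m = n then a else 0)" by (cases "m = n") (simp_all add: ell1_op_def[of "\<lambda>k. 0"])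
    finally show ?thesis .
  qed
  have slice_sum: "(\<Sum>n\<in>G. norm (slice n a)) \<le> norm a" if "finite G" for G a
    unfolding slice_def zS_def by (rule sum_norm_block_ops_le[OF that])
  have slice_norm: "norm (slice n a) \<le> norm a" for n a using slice_sum[of "{n}" a] by simp
  define N where "N a = (\<Sum>\<^sub>\<infinity>n. norm (slice n a))" for a
  have N: "((\<lambda>n. norm (slice n a)) has_sum N a) UNIV" for a
    unfolding N_def
    by (rule has_sum_infsum[OF nonneg_bdd_above_summable_on]) (auto intro!: bdd_aboveI[of _ "norm a"] slice_sum)
  have N_le: "N a \<le> norm a" for a
    unfolding N_def by (rule infsum_le_finite_sums[OF has_sum_imp_summable[OF N] slice_sum])
  have N_diff: "N a \<le> N b + N (a - b)" for a b
  proof (rule has_sum_mono[OF N has_sum_add[OF N N]])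
    fix n
    have "slice n a = slice n b + slice n (a - b)"
      using linear_add[OF bounded_linear.linear[OF bl_slice[of n]], of b "a - b"] by simp
    then show "norm (slice n a) \<le> norm (slice n b) + norm (slice n (a - b))"
      by (simp add: norm_triangle_ineq)
  qed
  have N_cont: "continuous_on UNIV N"
  proof (rule continuous_on_iff[THEN iffD2], intro ballI allI impI)
    fix a :: "'k ell1" and e :: real assume "e > 0"
    have "\<bar>N b - N a\<bar> \<le> dist b a" for b
      using N_diff[of a b] N_diff[of b a] N_le[of "a - b"] N_le[of "b - a"]
      by (simp add: dist_norm norm_minus_commute abs_le_iff)
    then show "\<exists>d>0. \<forall>b\<in>UNIV. dist b a < d \<longrightarrow> dist (N b) (N a) < e"
      using \<open>e > 0\<close> unfolding dist_real_def by (metis le_less_trans)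
  qed
  have slices_eqI: "a = b" if "a \<in> ?L" "b \<in> ?L" "\<And>n. slice n a = slice n b" for a b
  proof (rule ell1_eqI)
    have *: "coef c (\<beta> (n, j)) = coef (slice n c) j" if "j \<in> K" for c n j
    proof -
      have "coef (slice n c) j = ell1_op (\<lambda>k. coef (zS n k) j) c"
        unfolding slice_def by (rule bounded_linear_ell1_op_comp[OF nS bounded_linear_coef])
      also have "\<dots> = (\<Sum>\<^sub>\<infinity>k\<in>{\<beta> (n, j)}. coef c k)"
        unfolding ell1_op_def
      proof (rule infsum_cong_neutral)
        fix k assume "k \<in> UNIV - {\<beta> (n, j)}"
        then have "\<not> (k \<in> K \<and> fst (\<pi> k) = n \<and> snd (\<pi> k) = j)"
          using \<beta>\<pi>[of k] by (metis DiffD2 insertI1 prod.collapse)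
        then show "coef c k *\<^sub>R coef (zS n k) j = 0" by (auto simp: zS_def coef_unit_ell1)
      qed (use that \<pi>\<beta> \<beta>_K in \<open>auto simp: zS_def coef_unit_ell1\<close>)
      finally show ?thesis by simp
    qed
    fix k show "coef a k = coef b k"
    proof (cases "k \<in> K")
      case True
      then show ?thesis
        using *[OF \<pi>_K[OF True], of a "fst (\<pi> k)"] *[OF \<pi>_K[OF True], of b "fst (\<pi> k)"] \<beta>\<pi>[OF True] that(3)
        by simp
    next
      case False then show ?thesis using that by (auto simp: ell1_on_def)
    qed
  qed
  define assemble where "assemble l = (\<Sum>\<^sub>\<infinity>n. inj n (l n))" for l :: "nat \<Rightarrow> 'k ell1"
  have assemble_L: "assemble l \<in> ?L" for l
    unfolding assemble_def by (rule infsum_in_closed_subspace[OF L closed_ell1_on inj_L])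
  have slice_assemble: "slice m (assemble l) = l m"
    if "B summable_on UNIV" "\<And>n. norm (l n) \<le> B n" "\<And>n. l n \<in> ?L" for l B m
  proof -
    have "(\<lambda>n. norm (inj n (l n))) summable_on UNIV"
      by (rule summable_on_comparison_test[OF that(1)]) (auto intro: order.trans[OF inj_norm that(2)])
    then have "((\<lambda>n. slice m (inj n (l n))) has_sum slice m (assemble l)) UNIV"
      unfolding assemble_def
      by (rule has_sum_bounded_linear[OF bl_slice has_sum_infsum[OF abs_summable_summable]])
    moreover have "((\<lambda>n. slice m (inj n (l n))) has_sum l m) UNIV"
      by (rule has_sum_finite_neutralI[of "{m}"]) (auto simp: slice_inj that(3))
    ultimately show ?thesis by (rule has_sum_unique)
  qed
  \<comment> \<open>Slices that depend continuously on a parameter can be put together continuously if a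
    majorant with continuous total sum is known.\<close>
  have assemble_cont: "continuous_on X (\<lambda>t. assemble (T t))"
    if T: "\<And>n. continuous_on X (\<lambda>t. T t n)" and B: "\<And>n. continuous_on X (\<lambda>t. B t n)"
      and TB: "\<And>t n. t \<in> X \<Longrightarrow> norm (T t n) \<le> B t n"
      and b: "\<And>t. t \<in> X \<Longrightarrow> (B t has_sum b t) UNIV" and b_cont: "continuous_on X b"
    for X :: "'t::topological_space set" and T :: "'t \<Rightarrow> nat \<Rightarrow> 'k ell1" and B b
    unfolding continuous_on_def
  proof
    fix t assume t: "t \<in> X"
    have ev: "\<forall>\<^sub>F u in at t within X. u \<in> X" by (simp add: eventually_at_filter)
    show "((\<lambda>u. assemble (T u)) \<longlongrightarrow> assemble (T t)) (at t within X)"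
      unfolding assemble_def
    proof (rule infsum_tendsto_dominated[where B = B and b = "B t"])
      show "((\<lambda>u. inj n (T u n)) \<longlongrightarrow> inj n (T t n)) (at t within X)" for n
        by (rule bounded_linear.tendsto[OF bl_inj]) (use T[of n] t in \<open>auto simp: continuous_on_def\<close>)
      show "((\<lambda>u. B u n) \<longlongrightarrow> B t n) (at t within X)" for n
        using B[of n] t by (auto simp: continuous_on_def)
      show "\<forall>\<^sub>F u in at t within X. B u summable_on UNIV \<and> (\<forall>n\<in>UNIV. norm (inj n (T u n)) \<le> B u n)"
        using ev by eventually_elim (use has_sum_imp_summable[OF b] order.trans[OF inj_norm TB] in blast)
      show "B t summable_on UNIV" by (rule has_sum_imp_summable[OF b[OF t]])
      show "norm (inj n (T t n)) \<le> B t n" for n by (rule order.trans[OF inj_norm TB[OF t]])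
      have "(b \<longlongrightarrow> infsum (B t) UNIV) (at t within X)"
        unfolding infsumI[OF b[OF t]] using b_cont t by (simp add: continuous_on_def)
      moreover have "\<forall>\<^sub>F u in at t within X. b u = infsum (B u) UNIV"
        using ev by eventually_elim (simp only: infsumI[OF b])
      ultimately show "((\<lambda>u. infsum (B u) UNIV) \<longlongrightarrow> infsum (B t) UNIV) (at t within X)"
        by (rule Lim_transform_eventually)
    qed
  qed
  obtain Q where Q: "0 \<le> Q" "\<And>a. norm (q a) \<le> norm a * Q"
    using bounded_linear.nonneg_bounded[OF q] by blast
  define E where "E = max D 0"
  have E: "0 \<le> E" "norm (s y) \<le> E * norm y" if "y \<in> F" for y
    using s_norm[OF that] mult_right_mono[of D E "norm y"] by (auto simp: E_def)
  have E0: "0 \<le> E" by (simp add: E_def)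
  note q_lin = bounded_linear.linear[OF q]
  have q_add: "q (a - b + c) = q a - q b + q c" for a b c
    by (simp add: linear_add[OF q_lin] linear_diff[OF q_lin])
  have sq_norm: "norm (s (q a)) \<le> E * Q * norm a" if "a \<in> ?L" for a
    using E(2)[OF qF[OF that]] mult_left_mono[OF Q(2)[of a] E0] by (simp add: mult_ac)
  have cont_sl: "continuous_on X (\<lambda>l. slice n (f l))" if "continuous_on X f" for X :: "'t::topological_space set" and f n
    by (rule bounded_linear.continuous_on[OF bl_slice that])
  have cont_sq: "continuous_on X (\<lambda>l. s (q (slice n (f l))))" if "continuous_on X f" for X :: "'t::topological_space set" and f n
    by (rule continuous_on_compose2[OF s_cont bounded_linear.continuous_on[OF q cont_sl[OF that]]])
       (use qF slice_L in auto)
  define Y where "Y p n = (if n = 0 then fst p else q (slice (n - 1) (snd p)))" for p :: "'x \<times> 'k ell1" and n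
  define T\<Psi> where "T\<Psi> p n = slice n (snd p) - s (q (slice n (snd p))) + s (Y p n)" for p n
  define T\<Phi> where "T\<Phi> l n = slice n l - s (q (slice n l)) + s (q (slice (Suc n) l))" for l n
  define B\<Psi> where "B\<Psi> p n = (1 + E * Q) * norm (slice n (snd p)) +
     (if n = 0 then E * norm (fst p) else E * Q * norm (slice (n - 1) (snd p)))" for p :: "'x \<times> 'k ell1" and n
  define B\<Phi> where "B\<Phi> l n = (1 + E * Q) * norm (slice n l) + E * Q * norm (slice (Suc n) l)" for l n
  have Y_F: "Y p n \<in> F" if "p \<in> F \<times> ?L" for p n using that qF slice_L by (auto simp: Y_def)
  \<comment> \<open>The majorants \<open>B\<Psi>\<close> and \<open>B\<Phi>\<close> are sums of multiples of
    \<open>norm (slice n l)\<close> and of its shift by one place, whose sums are continuous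
    functions of \<open>l\<close>.\<close>
  have diff_norm: "norm (a - s (q a)) \<le> (1 + E * Q) * norm a" if "a \<in> ?L" for a
    using norm_triangle_ineq4[of a "s (q a)"] sq_norm[OF that] by (simp add: algebra_simps)
  have \<Psi>_B: "norm (T\<Psi> p n) \<le> B\<Psi> p n" if "p \<in> F \<times> ?L" for p n
  proof -
    have "norm (s (Y p n)) \<le> (if n = 0 then E * norm (fst p) else E * Q * norm (slice (n - 1) (snd p)))"
      using sq_norm[OF slice_L[of "n - 1"]] that E(2) by (auto simp: Y_def)
    then show ?thesis
      unfolding T\<Psi>_def B\<Psi>_def
      by (intro order.trans[OF norm_triangle_ineq] add_mono diff_norm slice_L)
  qed
  have \<Phi>_B: "norm (T\<Phi> l n) \<le> B\<Phi> l n" for l n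
    unfolding T\<Phi>_def B\<Phi>_def
    by (intro order.trans[OF norm_triangle_ineq] add_mono diff_norm sq_norm slice_L)
  have N_sums: "(\<lambda>n. norm (slice n l)) sums N l" for l by (rule has_sum_imp_sums[OF N])
  have \<Psi>_b: "(B\<Psi> p has_sum (1 + E * Q) * N (snd p) + (E * norm (fst p) + E * Q * N (snd p))) UNIV" for p
  proof (rule sums_nonneg_imp_has_sum)
    have "(\<lambda>n. E * Q * norm (slice n (snd p))) sums (E * Q * N (snd p))" by (intro sums_mult N_sums)
    then have "(\<lambda>n. if n = 0 then E * norm (fst p) else E * Q * norm (slice (n - 1) (snd p))) sums
        (E * Q * N (snd p) + E * norm (fst p))"
      by (subst sums_Suc_iff[symmetric, where f = "\<lambda>n. if n = 0 then E * norm (fst p) else E * Q * norm (slice (n - 1) (snd p))", simplified]) simp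
    then show "B\<Psi> p sums ((1 + E * Q) * N (snd p) + (E * norm (fst p) + E * Q * N (snd p)))"
      unfolding B\<Psi>_def by (subst add.commute[of "E * norm (fst p)"]) (intro sums_add sums_mult N_sums)
  qed (use E0 Q in \<open>auto simp: B\<Psi>_def\<close>)
  have \<Phi>_b: "(B\<Phi> l has_sum (1 + E * Q) * N l + E * Q * (N l - norm (slice 0 l))) UNIV" for l
  proof (rule sums_nonneg_imp_has_sum)
    have "(\<lambda>n. norm (slice (Suc n) l)) sums (N l - norm (slice 0 l))"
      using N_sums[of l] by (subst sums_Suc_iff) simp
    then show "B\<Phi> l sums ((1 + E * Q) * N l + E * Q * (N l - norm (slice 0 l)))"
      unfolding B\<Phi>_def by (intro sums_add sums_mult N_sums)
  qed (use E0 Q in \<open>auto simp: B\<Phi>_def\<close>)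
  have \<Psi>_L: "T\<Psi> p n \<in> ?L" if "p \<in> F \<times> ?L" for p n
    unfolding T\<Psi>_def by (intro subspace_add[OF L] subspace_diff[OF L] slice_L s_on qF Y_F that)
  have \<Phi>_L: "T\<Phi> l n \<in> ?L" for l n
    unfolding T\<Phi>_def by (intro subspace_add[OF L] subspace_diff[OF L] slice_L s_on qF)
  define \<Psi> where "\<Psi> p = assemble (T\<Psi> p)" for p
  define \<Phi> where "\<Phi> l = (q (slice 0 l), assemble (T\<Phi> l))" for l
  have sl\<Psi>: "slice n (\<Psi> p) = T\<Psi> p n" if "p \<in> F \<times> ?L" for p n
    unfolding \<Psi>_def by (rule slice_assemble[OF has_sum_imp_summable[OF \<Psi>_b] \<Psi>_B[OF that] \<Psi>_L[OF that]])
  have sl\<Phi>: "slice n (snd (\<Phi> l)) = T\<Phi> l n" for l n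
    unfolding \<Phi>_def snd_conv by (rule slice_assemble[OF has_sum_imp_summable[OF \<Phi>_b] \<Phi>_B \<Phi>_L])
  have \<Psi>_in: "\<Psi> p \<in> ?L" for p unfolding \<Psi>_def by (rule assemble_L)
  have \<Phi>_in: "\<Phi> l \<in> F \<times> ?L" for l using assemble_L qF slice_L by (auto simp: \<Phi>_def)
  have q\<Psi>: "q (slice n (\<Psi> p)) = Y p n" if "p \<in> F \<times> ?L" for p n
    unfolding sl\<Psi>[OF that] T\<Psi>_def q_add using qs qF slice_L Y_F[OF that] by simp
  have q\<Phi>: "q (slice n (snd (\<Phi> l))) = q (slice (Suc n) l)" for l n
    unfolding sl\<Phi> T\<Phi>_def q_add using qs qF slice_L by simp
  have \<Phi>\<Psi>: "\<Phi> (\<Psi> p) = p" if "p \<in> F \<times> ?L" for p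
  proof (rule prod_eqI)
    show "fst (\<Phi> (\<Psi> p)) = fst p" using q\<Psi>[OF that, of 0] by (simp add: \<Phi>_def Y_def)
    show "snd (\<Phi> (\<Psi> p)) = snd p"
    proof (rule slices_eqI)
      show "slice n (snd (\<Phi> (\<Psi> p))) = slice n (snd p)" for n
        unfolding sl\<Phi> T\<Phi>_def unfolding q\<Psi>[OF that] unfolding sl\<Psi>[OF that] T\<Psi>_def
          by (simp add: Y_def)
    qed (use \<Phi>_in[of "\<Psi> p"] that in auto)
  qed
  have \<Psi>\<Phi>: "\<Psi> (\<Phi> l) = l" if "l \<in> ?L" for l
  proof (rule slices_eqI[OF \<Psi>_in that])
    fix n
    have "Y (\<Phi> l) n = q (slice n l)"
      by (cases n) (simp_all add: Y_def q\<Phi> \<Phi>_def[THEN arg_cong[where f = fst]])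
    then show "slice n (\<Psi> (\<Phi> l)) = slice n l"
      unfolding sl\<Psi>[OF \<Phi>_in] T\<Psi>_def unfolding q\<Phi> unfolding sl\<Phi> T\<Phi>_def by simp
  qed
  have \<Psi>_cont: "continuous_on (F \<times> ?L) \<Psi>"
    unfolding \<Psi>_def
  proof (rule assemble_cont[OF _ _ \<Psi>_B \<Psi>_b])
    fix n
    have "continuous_on (F \<times> ?L) (\<lambda>p. s (Y p n))"
    proof (cases "n = 0")
      case True
      then show ?thesis
        unfolding Y_def by (auto intro!: continuous_on_compose2[OF s_cont] continuous_intros)
    next
      case False
      then show ?thesis
        unfolding Y_def by (simp add: cont_sq continuous_on_snd continuous_on_id)
    qed
    then show "continuous_on (F \<times> ?L) (\<lambda>p. T\<Psi> p n)"
      unfolding T\<Psi>_def by (intro continuous_intros cont_sl cont_sq)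
    show "continuous_on (F \<times> ?L) (\<lambda>p. B\<Psi> p n)"
      unfolding B\<Psi>_def by (cases "n = 0") (auto intro!: continuous_intros cont_sl)
  next
    show "continuous_on (F \<times> ?L) (\<lambda>p. (1 + E * Q) * N (snd p) + (E * norm (fst p) + E * Q * N (snd p)))"
      by (intro continuous_intros continuous_on_compose2[OF N_cont]) auto
  qed
  have \<Phi>_cont: "continuous_on ?L \<Phi>"
    unfolding \<Phi>_def
  proof (intro continuous_on_Pair)
    show "continuous_on ?L (\<lambda>l. q (slice 0 l))"
      by (intro bounded_linear.continuous_on[OF q] cont_sl continuous_on_id)
    show "continuous_on ?L (\<lambda>l. assemble (T\<Phi> l))"
    proof (rule assemble_cont[OF _ _ \<Phi>_B \<Phi>_b])
      show "continuous_on ?L (\<lambda>l. T\<Phi> l n)" for n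
        unfolding T\<Phi>_def by (intro continuous_intros cont_sl cont_sq)
      show "continuous_on ?L (\<lambda>l. B\<Phi> l n)" for n
        unfolding B\<Phi>_def by (intro continuous_intros cont_sl)
      show "continuous_on ?L (\<lambda>l. (1 + E * Q) * N l + E * Q * (N l - norm (slice 0 l)))"
        by (intro continuous_intros continuous_on_subset[OF N_cont] cont_sl) auto
    qed
  qed
  have "homeomorphism (F \<times> ?L) ?L \<Psi> \<Phi>"
    by (rule homeomorphismI[OF \<Psi>_cont \<Phi>_cont image_subsetI[OF \<Psi>_in] image_subsetI[OF \<Phi>_in] \<Phi>\<Psi> \<Psi>\<Phi>])
  then show ?thesis unfolding homeomorphic_def by blast
qed

text \<open>The vectors \<open>z k\<close> exhibit \<open>F\<close> as a quotient of \<open>L = ell1_on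
  K\<close>, and \<open>u\<close> and \<open>g\<close> form a biorthogonal system that embeds
  \<open>L\<close> in \<open>F\<close> as a complemented subspace, with projection \<open>J
  \<circ> P\<close>. Since \<open>L\<close> is a quotient of itself, \<open>L \<times>
  L\<close> is homeomorphic to \<open>L\<close>, so the coordinate \<open>P x\<close> of a
  vector \<open>x\<close> can be split in two and one half moved out of \<open>F\<close>. This
  gives \<open>F\<close> as \<open>L \<times> F\<close>, and
  \<open>ell1_absorbs_quotient\<close> finishes the proof.\<close>

theorem homeomorphic_ell1_on:
  fixes F :: "'x::banach set" and K :: "'k set" and z u :: "'k \<Rightarrow> 'x" and g :: "'k \<Rightarrow> 'x \<Rightarrow> real"
  assumes K: "infinite K" and F: "subspace F" "closed F"
    and z: "\<And>k. z k \<in> F" "\<And>k. norm (z k) \<le> 1"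
    and dense: "\<And>y. y \<in> F \<Longrightarrow> norm y = 1 \<Longrightarrow> \<exists>k\<in>K. \<exists>t. \<bar>t\<bar> \<le> 2 \<and> norm (y - t *\<^sub>R z k) \<le> 1 / 2"
    and u: "\<And>k. u k \<in> F" "\<And>k. norm (u k) \<le> C"
    and g: "\<And>k. bounded_linear (g k)" "\<And>k v. k \<notin> K \<Longrightarrow> g k v = 0"
    and g_sum: "\<And>G v. finite G \<Longrightarrow> v \<in> F \<Longrightarrow> (\<Sum>k\<in>G. \<bar>g k v\<bar>) \<le> C' * norm v"
    and gu: "\<And>j k. j \<in> K \<Longrightarrow> k \<in> K \<Longrightarrow> g j (u k) = (if j = k then 1 else 0)"
  shows "F homeomorphic ell1_on K"
proof -
  let ?L = "ell1_on K"
  have L: "subspace ?L" "closed ?L" by (rule subspace_ell1_on closed_ell1_on)+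
  define q where "q = ell1_op z"
  have q: "bounded_linear q" unfolding q_def by (rule bounded_linear_ell1_op[OF z(2)])
  have qF: "q a \<in> F" for a unfolding q_def by (rule ell1_op_in_closed_subspace[OF z(2) F z(1)])
  have "\<exists>v\<in>?L. norm v \<le> 2 \<and> norm (y - q v) \<le> 1 / 2" if "y \<in> F" "norm y = 1" for y
  proof -
    obtain k t where k: "k \<in> K" "\<bar>t\<bar> \<le> 2" "norm (y - t *\<^sub>R z k) \<le> 1 / 2" using dense[OF \<open>y \<in> F\<close> \<open>norm y = 1\<close>] by blast
    have "q (t *\<^sub>R unit_ell1 k) = t *\<^sub>R z k"
      by (simp add: linear_cmul[OF bounded_linear.linear[OF q]]) (simp add: q_def ell1_op_unit[OF z(2)])
    then show ?thesis
      using k by (intro bexI[of _ "t *\<^sub>R unit_ell1 k"]) (auto intro: subspace_scale[OF L(1)] unit_ell1_in_ell1_on)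
  qed
  then obtain s D where s: "continuous_on F s" "\<And>y. y \<in> F \<Longrightarrow> s y \<in> ?L" "\<And>y. y \<in> F \<Longrightarrow> q (s y) = y"
    "\<And>y. y \<in> F \<Longrightarrow> norm (s y) \<le> D * norm y"
    using Bartle_Graves_selection[OF q L F(1) qF, of 2] by auto
  have FL: "(F \<times> ?L) homeomorphic ?L"
    by (rule ell1_absorbs_quotient[OF K q F(1) qF s])
  have "(?L \<times> ?L) homeomorphic ?L"
    by (rule ell1_absorbs_quotient[OF K bounded_linear_ident L(1), where s = "\<lambda>x. x" and D = 1])
       (auto intro: continuous_on_id)
  then obtain h h' where h: "homeomorphism ?L (?L \<times> ?L) h h'"
    using homeomorphic_sym unfolding homeomorphic_def by blast
  define P where "P v = Abs_ell1 (\<lambda>k. g k v)" for v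
  have coef_P: "coef (P v) k = g k v" if "v \<in> F" for v k
    unfolding P_def using coef_Abs_ell1[of "\<lambda>k. g k v", OF g_sum[OF _ that]] by simp
  have P_L: "P v \<in> ?L" if "v \<in> F" for v using coef_P[OF that] g(2) by (simp add: ell1_on_def)
  note g_lin = bounded_linear.linear[OF g(1)]
  have P_diff: "P (v - w) = P v - P w" if "v \<in> F" "w \<in> F" for v w
    using that subspace_diff[OF F(1) that] by (intro ell1_eqI) (simp add: coef_P linear_diff[OF g_lin])
  have P_add: "P (v + w) = P v + P w" if "v \<in> F" "w \<in> F" for v w
    using that subspace_add[OF F(1) that] by (intro ell1_eqI) (simp add: coef_P linear_add[OF g_lin])
  have P_norm: "norm (P v) \<le> C' * norm v" if "v \<in> F" for v
    using g_sum[OF _ that] by (intro norm_ell1_le) (simp add: coef_P[OF that])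
  have P_cont: "continuous_on F P"
  proof (rule lipschitz_on_continuous_on[OF lipschitz_onI[where L = "\<bar>C'\<bar> + 1"]])
    fix v w assume "v \<in> F" "w \<in> F"
    have "norm (P (v - w)) \<le> C' * norm (v - w)" by (rule P_norm[OF subspace_diff[OF F(1) \<open>v \<in> F\<close> \<open>w \<in> F\<close>]])
    also have "\<dots> \<le> (\<bar>C'\<bar> + 1) * norm (v - w)" by (intro mult_right_mono) auto
    finally show "dist (P v) (P w) \<le> (\<bar>C'\<bar> + 1) * dist v w"
      by (simp add: dist_norm P_diff[OF \<open>v \<in> F\<close> \<open>w \<in> F\<close>])
  qed simp
  define J where "J = ell1_op u"
  have J: "bounded_linear J" unfolding J_def by (rule bounded_linear_ell1_op[OF u(2)])
  have J_F: "J a \<in> F" for a unfolding J_def by (rule ell1_op_in_closed_subspace[OF u(2) F u(1)])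
  have PJ: "P (J a) = a" if "a \<in> ?L" for a
  proof (rule ell1_eqI)
    fix k
    have "coef (P (J a)) k = g k (J a)" by (rule coef_P[OF J_F])
    also have "\<dots> = ell1_op (\<lambda>j. g k (u j)) a"
      unfolding J_def by (rule bounded_linear_ell1_op_comp[OF u(2) g(1)])
    also have "\<dots> = ell1_op (\<lambda>j. coef (unit_ell1 j) k) a"
    proof (rule ell1_op_cong)
      fix j assume "coef a j \<noteq> 0"
      then have "j \<in> K" using that by (auto simp: ell1_on_def)
      then show "g k (u j) = coef (unit_ell1 j) k"
        using gu[of k j] g(2)[of k] by (cases "k \<in> K") (auto simp: coef_unit_ell1)
    qed
    also have "\<dots> = coef (ell1_op unit_ell1 a) k"
      by (rule bounded_linear_ell1_op_comp[OF _ bounded_linear_coef, of _ 1, symmetric]) simp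
    finally show "coef (P (J a)) k = coef a k" by simp
  qed
  note hD = homeomorphism_apply1[OF h] homeomorphism_apply2[OF h]
  have h_in: "h a \<in> ?L \<times> ?L" if "a \<in> ?L" for a using homeomorphism_image1[OF h] that by blast
  have h'_in: "h' p \<in> ?L" if "p \<in> ?L \<times> ?L" for p using homeomorphism_image2[OF h] that by blast
  note J_lin = bounded_linear.linear[OF J]
  define f where "f x = (fst (h (P x)), J (snd (h (P x))) + (x - J (P x)))" for x
  define f' where "f' p = J (h' (fst p, P (snd p))) + (snd p - J (P (snd p)))" for p
  have Psnd: "P (J b + (x - J (P x))) = b" if "x \<in> F" "b \<in> ?L" for x b
    using that P_L[OF that(1)] by (simp add: P_add P_diff J_F subspace_diff[OF F(1)] PJ)
  have "homeomorphism F (?L \<times> F) f f'"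
  proof (rule homeomorphismI)
    have hP: "continuous_on F (\<lambda>x. h (P x))"
      by (rule continuous_on_compose2[OF homeomorphism_cont1[OF h] P_cont]) (use P_L in auto)
    show "continuous_on F f"
      unfolding f_def by (intro continuous_intros hP P_cont bounded_linear.continuous_on[OF J])
    have P2: "continuous_on (?L \<times> F) (\<lambda>p. P (snd p))"
      by (rule continuous_on_compose2[OF P_cont]) (auto intro: continuous_intros)
    have "continuous_on (?L \<times> F) (\<lambda>p. h' (fst p, P (snd p)))"
      by (rule continuous_on_compose2[OF homeomorphism_cont2[OF h]]) (use P_L in \<open>auto intro!: continuous_intros P2\<close>)
    then show "continuous_on (?L \<times> F) f'"
      unfolding f'_def by (intro continuous_intros P2 bounded_linear.continuous_on[OF J])
    show "f ` F \<subseteq> ?L \<times> F"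
      using h_in P_L by (auto simp: f_def mem_Times_iff intro!: subspace_add[OF F(1)] subspace_diff[OF F(1)] J_F)
    show "f' ` (?L \<times> F) \<subseteq> F"
      by (auto simp: f'_def intro!: subspace_add[OF F(1)] subspace_diff[OF F(1)] J_F)
    show "f' (f x) = x" if "x \<in> F" for x
    proof -
      have "snd (h (P x)) \<in> ?L" using h_in[OF P_L[OF that]] by (simp add: mem_Times_iff)
      from Psnd[OF that this] have "P (snd (f x)) = snd (h (P x))" by (simp add: f_def)
      then show ?thesis
        using hD(1)[OF P_L[OF that]] by (simp add: f'_def) (simp add: f_def)
    qed
    show "f (f' p) = p" if "p \<in> ?L \<times> F" for p
    proof -
      have p: "fst p \<in> ?L" "snd p \<in> F" using that by auto
      have in': "(fst p, P (snd p)) \<in> ?L \<times> ?L" using p P_L by auto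
      have "P (f' p) = h' (fst p, P (snd p))"
        unfolding f'_def by (rule Psnd[OF p(2) h'_in[OF in']])
      then show ?thesis
        using hD(2)[OF in'] by (intro prod_eqI) (simp_all add: f_def, simp add: f'_def)
    qed
  qed
  then have "F homeomorphic (?L \<times> F)" unfolding homeomorphic_def by blast
  also have "(?L \<times> F) homeomorphic (F \<times> ?L)"
    unfolding homeomorphic_def
    by (intro exI[of _ prod.swap] homeomorphismI) (auto intro: continuous_on_swap)
  also note FL
  finally show ?thesis .
qed

section \<open>Lipschitz functions and functionals on them\<close>

definition lipschitz_bound :: "'a metric \<Rightarrow> real \<Rightarrow> ('a \<Rightarrow> real) \<Rightarrow> bool" where
  "lipschitz_bound M C f \<longleftrightarrow> (\<forall>x\<in>mspace M. \<forall>y\<in>mspace M. \<bar>f x - f y\<bar> \<le> C * mdist M x y)"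

lemma lipschitz_boundD:
  "lipschitz_bound M C f \<Longrightarrow> x \<in> mspace M \<Longrightarrow> y \<in> mspace M \<Longrightarrow> \<bar>f x - f y\<bar> \<le> C * mdist M x y"
  by (simp add: lipschitz_bound_def)

lemma Lip0_iff:
  "f \<in> Lip0 M e \<longleftrightarrow> (\<exists>C. lipschitz_bound M C f) \<and> f e = 0 \<and> (\<forall>x. x \<notin> mspace M \<longrightarrow> f x = 0)"
  by (auto simp: Lip0_def Lipschitz_continuous_map_def lipschitz_bound_def dist_real_def)

lemma mdist_pos: "x \<in> mspace M \<Longrightarrow> y \<in> mspace M \<Longrightarrow> x \<noteq> y \<Longrightarrow> 0 < mdist M x y"
  using mdist_nonneg[of M x y] mdist_zero[of x M y] by linarith

lemma mdist_self [simp]: "x \<in> mspace M \<Longrightarrow> mdist M x x = 0"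
  by simp

lemma lip_quotients_bdd:
  assumes "lipschitz_bound M C f"
  shows "bdd_above (insert 0 {\<bar>f x - f y\<bar> / mdist M x y | x y. x \<in> mspace M \<and> y \<in> mspace M \<and> x \<noteq> y})"
proof (rule bdd_aboveI[of _ "max 0 C"])
  fix r assume "r \<in> insert 0 {\<bar>f x - f y\<bar> / mdist M x y | x y. x \<in> mspace M \<and> y \<in> mspace M \<and> x \<noteq> y}"
  then consider "r = 0" | x y where "x \<in> mspace M" "y \<in> mspace M" "x \<noteq> y" "r = \<bar>f x - f y\<bar> / mdist M x y"
    by blast
  then show "r \<le> max 0 C"
  proof cases
    case 2
    then have "0 < mdist M x y" by (intro mdist_pos)
    then show ?thesis using lipschitz_boundD[OF assms 2(1,2)] 2(4) by (simp add: divide_le_eq le_max_iff_disj)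
  qed simp
qed

lemma lip_norm_nonneg:
  assumes "lipschitz_bound M C f" shows "0 \<le> lip_norm M f"
  unfolding lip_norm_def by (rule cSup_upper[OF _ lip_quotients_bdd[OF assms]]) simp

lemma lipschitz_bound_lip_norm:
  assumes "lipschitz_bound M C f" shows "lipschitz_bound M (lip_norm M f) f"
  unfolding lipschitz_bound_def
proof (intro ballI)
  fix x y assume xy: "x \<in> mspace M" "y \<in> mspace M"
  show "\<bar>f x - f y\<bar> \<le> lip_norm M f * mdist M x y"
  proof (cases "x = y")
    case False
    then have "0 < mdist M x y" by (intro mdist_pos xy)
    moreover have "\<bar>f x - f y\<bar> / mdist M x y \<le> lip_norm M f"
      unfolding lip_norm_def by (rule cSup_upper[OF _ lip_quotients_bdd[OF assms]]) (use xy False in blast)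
    ultimately show ?thesis by (simp add: divide_le_eq)
  qed (use xy in simp)
qed

lemma lip_norm_le:
  assumes "lipschitz_bound M C f" "0 \<le> C" shows "lip_norm M f \<le> C"
  unfolding lip_norm_def
proof (rule cSup_least)
  fix r assume "r \<in> insert 0 {\<bar>f x - f y\<bar> / mdist M x y | x y. x \<in> mspace M \<and> y \<in> mspace M \<and> x \<noteq> y}"
  then consider "r = 0" | x y where "x \<in> mspace M" "y \<in> mspace M" "x \<noteq> y" "r = \<bar>f x - f y\<bar> / mdist M x y"
    by blast
  then show "r \<le> C"
  proof cases
    case 2
    then have "0 < mdist M x y" by (intro mdist_pos)
    then show ?thesis using lipschitz_boundD[OF assms(1) 2(1,2)] 2(4) by (simp add: divide_le_eq)
  qed (use assms in simp)
qed simp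

lemma Lip0_lip_norm:
  assumes "f \<in> Lip0 M e"
  shows "0 \<le> lip_norm M f" "lipschitz_bound M (lip_norm M f) f"
  using assms lip_norm_nonneg lipschitz_bound_lip_norm unfolding Lip0_iff by blast+

lemma Lip0_add: "f \<in> Lip0 M e \<Longrightarrow> g \<in> Lip0 M e \<Longrightarrow> (\<lambda>x. f x + g x) \<in> Lip0 M e"
  and Lip0_scale: "f \<in> Lip0 M e \<Longrightarrow> (\<lambda>x. c * f x) \<in> Lip0 M e"
  and Lip0_0: "(\<lambda>x. 0) \<in> Lip0 M e"
proof -
  assume f: "f \<in> Lip0 M e"
  note F = lipschitz_boundD[OF Lip0_lip_norm(2)[OF f]]
  have "\<bar>c * f x - c * f y\<bar> \<le> (\<bar>c\<bar> * lip_norm M f) * mdist M x y" if "x \<in> mspace M" "y \<in> mspace M" for x y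
    using mult_left_mono[OF F[OF that], of "\<bar>c\<bar>"] by (simp add: abs_mult mult.assoc flip: right_diff_distrib)
  then show "(\<lambda>x. c * f x) \<in> Lip0 M e" using f unfolding Lip0_iff lipschitz_bound_def by auto
  assume g: "g \<in> Lip0 M e"
  note G = lipschitz_boundD[OF Lip0_lip_norm(2)[OF g]]
  have "\<bar>f x + g x - (f y + g y)\<bar> \<le> (lip_norm M f + lip_norm M g) * mdist M x y" if "x \<in> mspace M" "y \<in> mspace M" for x y
    using F[OF that] G[OF that] by (simp add: distrib_right)
  then show "(\<lambda>x. f x + g x) \<in> Lip0 M e" using f g unfolding Lip0_iff lipschitz_bound_def by auto
next
  show "(\<lambda>x. 0) \<in> Lip0 M e" by (auto simp: Lip0_iff lipschitz_bound_def intro!: exI[of _ 0])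
qed

lemma Lip0_diff: "f \<in> Lip0 M e \<Longrightarrow> g \<in> Lip0 M e \<Longrightarrow> (\<lambda>x. f x - g x) \<in> Lip0 M e"
  using Lip0_add[of f M e "\<lambda>x. -1 * g x"] Lip0_scale[of g M e "-1"] by simp

lemma lip_norm_scale:
  assumes "f \<in> Lip0 M e" shows "lip_norm M (\<lambda>x. c * f x) \<le> \<bar>c\<bar> * lip_norm M f"
proof (rule lip_norm_le)
  show "lipschitz_bound M (\<bar>c\<bar> * lip_norm M f) (\<lambda>x. c * f x)"
    unfolding lipschitz_bound_def
    using mult_left_mono[OF lipschitz_boundD[OF Lip0_lip_norm(2)[OF assms]] abs_ge_zero[of c]]
    by (simp add: abs_mult mult.assoc flip: right_diff_distrib)
qed (use Lip0_lip_norm(1)[OF assms] in simp)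

text \<open>The representative in \<^const>\<open>Lip0\<close> of a Lipschitz function, normalised at
  the base point.\<close>

definition based_at :: "'a metric \<Rightarrow> 'a \<Rightarrow> ('a \<Rightarrow> real) \<Rightarrow> 'a \<Rightarrow> real" where
  "based_at M e f x = (if x \<in> mspace M then f x - f e else 0)"

lemma based_at_Lip0:
  assumes "lipschitz_bound M C f" "e \<in> mspace M"
  shows "based_at M e f \<in> Lip0 M e" "0 \<le> C \<Longrightarrow> lip_norm M (based_at M e f) \<le> C"
proof -
  have l: "lipschitz_bound M C (based_at M e f)"
    using assms by (auto simp: lipschitz_bound_def based_at_def)
  then show "based_at M e f \<in> Lip0 M e" using assms by (auto simp: Lip0_iff based_at_def)
  show "lip_norm M (based_at M e f) \<le> C" if "0 \<le> C" by (rule lip_norm_le[OF l that])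
qed

abbreviation Lip0_dual :: "'a metric \<Rightarrow> 'a \<Rightarrow> (('a \<Rightarrow> real) \<Rightarrow> real) set" where
  "Lip0_dual M e \<equiv> bdual (Lip0 M e) (lip_norm M)"

lemma bdualD:
  assumes "\<phi> \<in> bdual V nrm"
  shows "f \<notin> V \<Longrightarrow> \<phi> f = 0" "f \<in> V \<Longrightarrow> g \<in> V \<Longrightarrow> \<phi> (\<lambda>x. f x + g x) = \<phi> f + \<phi> g"
    "f \<in> V \<Longrightarrow> \<phi> (\<lambda>x. c * f x) = c * \<phi> f"
  using assms unfolding bdual_def by blast+

lemma Lip0_dual_bound:
  assumes "\<mu> \<in> Lip0_dual M e"
  obtains C where "0 \<le> C" "\<And>f. f \<in> Lip0 M e \<Longrightarrow> \<bar>\<mu> f\<bar> \<le> C * lip_norm M f"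
proof -
  obtain C where C: "\<And>f. f \<in> Lip0 M e \<Longrightarrow> \<bar>\<mu> f\<bar> \<le> C * lip_norm M f"
    using assms unfolding bdual_def by blast
  have "\<bar>\<mu> f\<bar> \<le> \<bar>C\<bar> * lip_norm M f" if "f \<in> Lip0 M e" for f
    using C[OF that] mult_right_mono[of C "\<bar>C\<bar>" "lip_norm M f"] Lip0_lip_norm(1)[OF that] by linarith
  then show ?thesis using that[of "\<bar>C\<bar>"] by simp
qed

lemma free_norm_le:
  assumes "\<And>f. f \<in> Lip0 M e \<Longrightarrow> lip_norm M f \<le> 1 \<Longrightarrow> \<bar>\<mu> f\<bar> \<le> C"
  shows "free_norm M e \<mu> \<le> C"
  unfolding free_norm_def dual_norm_def
proof (rule cSup_least)
  have "lip_norm M (\<lambda>x. 0) \<le> 0" by (rule lip_norm_le) (auto simp: lipschitz_bound_def)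
  then have "lip_norm M (\<lambda>x. 0) \<le> 1" by simp
  then show "{\<bar>\<mu> f\<bar> |f. f \<in> Lip0 M e \<and> lip_norm M f \<le> 1} \<noteq> {}"
    using Lip0_0[of M e] by (auto intro!: exI[of _ "\<lambda>x. 0"])
qed (auto intro: assms)

lemma le_free_norm_unit:
  assumes "\<mu> \<in> Lip0_dual M e" "f \<in> Lip0 M e" "lip_norm M f \<le> 1"
  shows "\<bar>\<mu> f\<bar> \<le> free_norm M e \<mu>"
proof -
  obtain C where C: "0 \<le> C" "\<And>f. f \<in> Lip0 M e \<Longrightarrow> \<bar>\<mu> f\<bar> \<le> C * lip_norm M f"
    using Lip0_dual_bound[OF assms(1)] by blast
  have le: "\<bar>\<mu> g\<bar> \<le> C" if "g \<in> Lip0 M e" "lip_norm M g \<le> 1" for g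
    using C(2)[OF that(1)] mult_left_mono[OF that(2) C(1)] by simp
  show ?thesis
    unfolding free_norm_def dual_norm_def
    by (rule cSup_upper[OF _ bdd_aboveI[of _ C]]) (use assms le in auto)
qed

text \<open>For \<open>lip_norm M f = 0\<close> the estimate comes from the boundedness of
  \<open>\<mu>\<close>, in all other cases by scaling \<open>f\<close> to norm one.\<close>

lemma le_free_norm:
  assumes "\<mu> \<in> Lip0_dual M e" "f \<in> Lip0 M e"
  shows "\<bar>\<mu> f\<bar> \<le> free_norm M e \<mu> * lip_norm M f"
proof (cases "lip_norm M f = 0")
  case True
  obtain C where C: "0 \<le> C" "\<And>f. f \<in> Lip0 M e \<Longrightarrow> \<bar>\<mu> f\<bar> \<le> C * lip_norm M f"
    using Lip0_dual_bound[OF assms(1)] by blast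
  show ?thesis using C(2)[OF assms(2)] True by simp
next
  case False
  then have l: "0 < lip_norm M f" using Lip0_lip_norm(1)[OF assms(2)] by simp
  let ?g = "\<lambda>x. inverse (lip_norm M f) * f x"
  have "lip_norm M ?g \<le> 1" using lip_norm_scale[OF assms(2), of "inverse (lip_norm M f)"] l by simp
  from le_free_norm_unit[OF assms(1) Lip0_scale[OF assms(2)] this]
  have "\<bar>\<mu> f\<bar> * inverse (lip_norm M f) \<le> free_norm M e \<mu>"
    using l unfolding bdualD(3)[OF assms(1,2)] by (simp add: abs_mult mult.commute)
  then show ?thesis using l by (simp add: field_simps)
qed

section \<open>The free space inside a Banach space of bounded functions\<close>

text \<open>A functional is represented by its difference quotients \<open>\<mu> f / lip_norm M
  f\<close>. They form a bounded function on the set of all \<open>f\<close>, which is given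
  the discrete topology so that the type of bounded continuous functions can serve as the
  ambient Banach space. Division by zero is harmless, since a function of norm
  \<open>0\<close> in \<^const>\<open>Lip0\<close> is annihilated by every functional in the
  dual.\<close>

definition emb :: "'a metric \<Rightarrow> 'a \<Rightarrow> (('a \<Rightarrow> real) \<Rightarrow> real) \<Rightarrow> ('a \<Rightarrow> real) discrete \<Rightarrow>\<^sub>C real" where
  "emb M e \<mu> = Bcontfun (\<lambda>d. if of_discrete d \<in> Lip0 M e then \<mu> (of_discrete d) / lip_norm M (of_discrete d) else 0)"

text \<open>Evaluation at \<open>f\<close>, extended from functionals to the whole ambient space.\<close>

definition ev :: "'a metric \<Rightarrow> ('a \<Rightarrow> real) \<Rightarrow> (('a \<Rightarrow> real) discrete \<Rightarrow>\<^sub>C real) \<Rightarrow> real" where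
  "ev M f v = lip_norm M f * apply_bcontfun v (discrete f)"

lemma apply_emb:
  assumes "\<mu> \<in> Lip0_dual M e"
  shows "apply_bcontfun (emb M e \<mu>) d = (if of_discrete d \<in> Lip0 M e then \<mu> (of_discrete d) / lip_norm M (of_discrete d) else 0)"
proof -
  obtain C where C: "0 \<le> C" "\<And>f. f \<in> Lip0 M e \<Longrightarrow> \<bar>\<mu> f\<bar> \<le> C * lip_norm M f"
    using Lip0_dual_bound[OF assms(1)] by blast
  have "(\<lambda>d. if of_discrete d \<in> Lip0 M e then \<mu> (of_discrete d) / lip_norm M (of_discrete d) else 0) \<in> bcontfun"
  proof (rule bcontfun_normI)
    fix d :: "('a \<Rightarrow> real) discrete"
    show "norm (if of_discrete d \<in> Lip0 M e then \<mu> (of_discrete d) / lip_norm M (of_discrete d) else 0) \<le> C"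
      using C(2)[of "of_discrete d"] Lip0_lip_norm(1)[of "of_discrete d" M e] C(1)
      by (auto simp: divide_le_eq)
  qed (simp add: continuous_on_open_invariant open_discrete)
  then show ?thesis unfolding emb_def by (simp add: Bcontfun_inverse)
qed

lemma bounded_linear_ev: "bounded_linear (ev M f)"
proof (rule bounded_linear_intro)
  fix v
  show "norm (ev M f v) \<le> norm v * \<bar>lip_norm M f\<bar>"
    using mult_left_mono[OF norm_bounded[of v "discrete f"] abs_ge_zero[of "lip_norm M f"]]
    by (simp add: ev_def abs_mult mult.commute)
qed (simp_all add: ev_def algebra_simps)

lemma ev_emb:
  assumes "\<mu> \<in> Lip0_dual M e" "f \<in> Lip0 M e" shows "ev M f (emb M e \<mu>) = \<mu> f"
  using le_free_norm[OF assms] assms(2)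
  by (auto simp: ev_def apply_emb[OF assms(1)] discrete_inverse)

lemma abs_ev_le: "f \<in> Lip0 M e \<Longrightarrow> \<bar>ev M f v\<bar> \<le> lip_norm M f * norm v"
  using norm_bounded[of v "discrete f"] Lip0_lip_norm(1)[of f M e]
  by (simp add: ev_def abs_mult mult_left_mono)

lemma norm_emb:
  assumes "\<mu> \<in> Lip0_dual M e" shows "norm (emb M e \<mu>) = free_norm M e \<mu>"
proof (rule antisym)
  show "norm (emb M e \<mu>) \<le> free_norm M e \<mu>"
  proof (rule norm_bound)
    fix d :: "('a \<Rightarrow> real) discrete"
    have "0 \<le> free_norm M e \<mu>"
    proof -
      have "lip_norm M (\<lambda>x. 0) \<le> 0" by (rule lip_norm_le) (auto simp: lipschitz_bound_def)
      then show ?thesis using le_free_norm_unit[OF assms Lip0_0] by simp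
    qed
    then show "norm (apply_bcontfun (emb M e \<mu>) d) \<le> free_norm M e \<mu>"
      using le_free_norm[OF assms, of "of_discrete d"] Lip0_lip_norm(1)[of "of_discrete d" M e]
      by (auto simp: apply_emb[OF assms] divide_le_eq)
  qed
  show "free_norm M e \<mu> \<le> norm (emb M e \<mu>)"
  proof (rule free_norm_le)
    fix f assume f: "f \<in> Lip0 M e" "lip_norm M f \<le> 1"
    show "\<bar>\<mu> f\<bar> \<le> norm (emb M e \<mu>)"
      using abs_ev_le[OF f(1), of "emb M e \<mu>"] mult_right_mono[OF f(2) norm_ge_zero[of "emb M e \<mu>"]]
      by (simp add: ev_emb[OF assms f(1)])
  qed
qed

lemma Lip0_dual_lincomb:
  assumes "\<mu> \<in> Lip0_dual M e" "\<nu> \<in> Lip0_dual M e"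
  shows "(\<lambda>f. a * \<mu> f + b * \<nu> f) \<in> Lip0_dual M e"
    "emb M e (\<lambda>f. a * \<mu> f + b * \<nu> f) = a *\<^sub>R emb M e \<mu> + b *\<^sub>R emb M e \<nu>"
proof -
  have "\<bar>a * \<mu> f + b * \<nu> f\<bar> \<le> (\<bar>a\<bar> * free_norm M e \<mu> + \<bar>b\<bar> * free_norm M e \<nu>) * lip_norm M f" if "f \<in> Lip0 M e" for f
  proof -
    have "\<bar>a * \<mu> f + b * \<nu> f\<bar> \<le> \<bar>a\<bar> * \<bar>\<mu> f\<bar> + \<bar>b\<bar> * \<bar>\<nu> f\<bar>" by (metis abs_mult abs_triangle_ineq)
    also have "\<dots> \<le> \<bar>a\<bar> * (free_norm M e \<mu> * lip_norm M f) + \<bar>b\<bar> * (free_norm M e \<nu> * lip_norm M f)"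
      by (intro add_mono mult_left_mono le_free_norm assms that abs_ge_zero)
    finally show ?thesis by (simp add: algebra_simps)
  qed
  then show 1: "(\<lambda>f. a * \<mu> f + b * \<nu> f) \<in> Lip0_dual M e"
    unfolding bdual_def using bdualD[OF assms(1)] bdualD[OF assms(2)]
    by (intro CollectI conjI allI ballI impI exI[of _ "\<bar>a\<bar> * free_norm M e \<mu> + \<bar>b\<bar> * free_norm M e \<nu>"])
       (simp_all add: algebra_simps)
  show "emb M e (\<lambda>f. a * \<mu> f + b * \<nu> f) = a *\<^sub>R emb M e \<mu> + b *\<^sub>R emb M e \<nu>"
    by (rule bcontfun_eqI) (simp add: apply_emb[OF 1] apply_emb[OF assms(1)] apply_emb[OF assms(2)] add_divide_distrib)
qed

lemma Lip0_dual_0: "(\<lambda>f. 0) \<in> Lip0_dual M e" "emb M e (\<lambda>f. 0) = 0"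
proof -
  show "(\<lambda>f. 0) \<in> Lip0_dual M e" by (auto simp: bdual_def intro!: exI[of _ 0])
  from apply_emb[OF this] show "emb M e (\<lambda>f. 0) = 0" by (intro bcontfun_eqI) simp
qed

lemma Lip0_dual_diff:
  assumes "\<mu> \<in> Lip0_dual M e" "\<nu> \<in> Lip0_dual M e"
  shows "(\<lambda>f. \<mu> f - \<nu> f) \<in> Lip0_dual M e" "emb M e (\<lambda>f. \<mu> f - \<nu> f) = emb M e \<mu> - emb M e \<nu>"
  using Lip0_dual_lincomb[OF assms, of 1 "-1"] by simp_all

lemma Lip0_dual_sum:
  assumes "finite A" "\<And>x. x \<in> A \<Longrightarrow> \<mu> x \<in> Lip0_dual M e"
  shows "(\<lambda>f. \<Sum>x\<in>A. c x * \<mu> x f) \<in> Lip0_dual M e \<and> emb M e (\<lambda>f. \<Sum>x\<in>A. c x * \<mu> x f) = (\<Sum>x\<in>A. c x *\<^sub>R emb M e (\<mu> x))"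
  using assms
proof (induction rule: finite_induct)
  case empty
  then show ?case by (simp add: Lip0_dual_0)
next
  case (insert y A)
  then show ?case using Lip0_dual_lincomb[of "\<mu> y" M e "\<lambda>f. \<Sum>x\<in>A. c x * \<mu> x f" "c y" 1] by simp
qed

lemma emb_inj: "inj_on (emb M e) (Lip0_dual M e)"
proof (rule inj_onI)
  fix \<mu> \<nu> assume *: "\<mu> \<in> Lip0_dual M e" "\<nu> \<in> Lip0_dual M e" "emb M e \<mu> = emb M e \<nu>"
  show "\<mu> = \<nu>"
  proof
    fix f show "\<mu> f = \<nu> f"
      using ev_emb[OF *(1), of f] ev_emb[OF *(2), of f] *(3) bdualD(1)[OF *(1), of f] bdualD(1)[OF *(2), of f]
      by (cases "f \<in> Lip0 M e") simp_all
  qed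
qed

text \<open>A limit \<open>v\<close> of represented functionals is represented by the pointwise limit of
  the functionals, which \<open>ev M f v\<close> recovers.\<close>

lemma closed_emb_dual: "closed (emb M e ` Lip0_dual M e)"
  unfolding closed_sequential_limits
proof (intro allI impI)
  fix X v assume "(\<forall>n. X n \<in> emb M e ` Lip0_dual M e) \<and> X \<longlonglongrightarrow> v"
  then have lim: "X \<longlonglongrightarrow> v" and "\<forall>n. \<exists>\<mu>. \<mu> \<in> Lip0_dual M e \<and> X n = emb M e \<mu>"
    by blast+
  then obtain \<mu> where \<mu>: "\<And>n. \<mu> n \<in> Lip0_dual M e" "\<And>n. X n = emb M e (\<mu> n)"
    by metis
  define \<nu> where "\<nu> f = (if f \<in> Lip0 M e then ev M f v else 0)" for f
  have l: "(\<lambda>n. \<mu> n f) \<longlonglongrightarrow> \<nu> f" if "f \<in> Lip0 M e" for f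
    using bounded_linear.tendsto[OF bounded_linear_ev lim, of M f] that by (simp add: \<mu> ev_emb \<nu>_def)
  have "\<nu> (\<lambda>x. f x + g x) = \<nu> f + \<nu> g" if "f \<in> Lip0 M e" "g \<in> Lip0 M e" for f g
  proof (rule LIMSEQ_unique[OF l[OF Lip0_add[OF that]]])
    show "(\<lambda>n. \<mu> n (\<lambda>x. f x + g x)) \<longlonglongrightarrow> \<nu> f + \<nu> g"
      unfolding bdualD(2)[OF \<mu>(1) that] by (intro tendsto_add l that)
  qed
  moreover have "\<nu> (\<lambda>x. c * f x) = c * \<nu> f" if "f \<in> Lip0 M e" for c f
  proof (rule LIMSEQ_unique[OF l[OF Lip0_scale[OF that]]])
    show "(\<lambda>n. \<mu> n (\<lambda>x. c * f x)) \<longlonglongrightarrow> c * \<nu> f"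
      unfolding bdualD(3)[OF \<mu>(1) that] by (intro tendsto_mult_left l that)
  qed
  moreover have "\<bar>\<nu> f\<bar> \<le> norm v * lip_norm M f" if "f \<in> Lip0 M e" for f
    using abs_ev_le[OF that, of v] that by (simp add: \<nu>_def mult.commute)
  ultimately have \<nu>: "\<nu> \<in> Lip0_dual M e"
    unfolding bdual_def by (intro CollectI conjI exI[of _ "norm v"]) (auto simp: \<nu>_def)
  have "emb M e \<nu> = v"
  proof (rule bcontfun_eqI)
    fix d :: "('a \<Rightarrow> real) discrete"
    have ptw: "(\<lambda>n. apply_bcontfun (X n) d) \<longlonglongrightarrow> apply_bcontfun v d"
    proof (rule metric_LIMSEQ_I)
      fix r :: real assume "r > 0"
      with metric_LIMSEQ_D[OF lim] obtain N where "\<forall>n\<ge>N. dist (X n) v < r" by blast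
      then show "\<exists>N. \<forall>n\<ge>N. dist (apply_bcontfun (X n) d) (apply_bcontfun v d) < r"
        using le_less_trans[OF dist_bounded] by blast
    qed
    have "(\<lambda>n. apply_bcontfun (X n) d) \<longlonglongrightarrow> apply_bcontfun (emb M e \<nu>) d"
      unfolding \<mu>(2) apply_emb[OF \<mu>(1)] apply_emb[OF \<nu>]
      using l[of "of_discrete d"] by (auto intro!: tendsto_intros simp: divide_inverse)
    then show "apply_bcontfun (emb M e \<nu>) d = apply_bcontfun v d" using ptw by (rule LIMSEQ_unique)
  qed
  then show "v \<in> emb M e ` Lip0_dual M e" using \<nu> by blast
qed

lemma evaluation_dual:
  assumes "e \<in> mspace M" "x \<in> mspace M"
  shows "evaluation M e x \<in> Lip0_dual M e"
proof -
  have "\<bar>f x\<bar> \<le> mdist M x e * lip_norm M f" if "f \<in> Lip0 M e" for f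
    using lipschitz_boundD[OF Lip0_lip_norm(2)[OF that] assms(2,1)] that by (simp add: Lip0_iff mult.commute)
  then show ?thesis
    unfolding bdual_def
    by (intro CollectI conjI exI[of _ "mdist M x e"]) (auto simp: evaluation_def Lip0_add Lip0_scale)
qed

definition point :: "'a metric \<Rightarrow> 'a \<Rightarrow> 'a \<Rightarrow> ('a \<Rightarrow> real) discrete \<Rightarrow>\<^sub>C real" where
  "point M e x = emb M e (evaluation M e x)"

text \<open>The free space as a closed subspace of the ambient space; \<open>emb_free_space\<close>
  below identifies the two.\<close>

definition free_image :: "'a metric \<Rightarrow> 'a \<Rightarrow> (('a \<Rightarrow> real) discrete \<Rightarrow>\<^sub>C real) set" where
  "free_image M e = closure (span (point M e ` mspace M))"

lemma subspace_closure:
  fixes S :: "'x::real_normed_vector set"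
  assumes "subspace S" shows "subspace (closure S)"
  unfolding subspace_def
proof (intro conjI ballI allI)
  show "0 \<in> closure S" using subspace_0[OF assms] closure_subset by blast
  fix x y and c :: real assume "x \<in> closure S" "y \<in> closure S"
  then obtain a b where a: "\<And>n. a n \<in> S" "a \<longlonglongrightarrow> x" and b: "\<And>n. b n \<in> S" "b \<longlonglongrightarrow> y"
    unfolding closure_sequential by blast
  have "(\<lambda>n. a n + b n) \<longlonglongrightarrow> x + y" by (intro tendsto_intros a b)
  moreover have "a n + b n \<in> S" for n by (rule subspace_add[OF assms a(1) b(1)])
  ultimately show "x + y \<in> closure S"
    unfolding closure_sequential by (intro exI[of _ "\<lambda>n. a n + b n"]) simp
  have "(\<lambda>n. c *\<^sub>R a n) \<longlonglongrightarrow> c *\<^sub>R x" by (intro tendsto_intros a)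
  moreover have "c *\<^sub>R a n \<in> S" for n by (rule subspace_scale[OF assms a(1)])
  ultimately show "c *\<^sub>R x \<in> closure S"
    unfolding closure_sequential by (intro exI[of _ "\<lambda>n. c *\<^sub>R a n"]) simp
qed

lemma free_image_subspace: "subspace (free_image M e)" "closed (free_image M e)"
  by (simp_all add: free_image_def subspace_closure)

lemma point_in_free_image: "x \<in> mspace M \<Longrightarrow> point M e x \<in> free_image M e"
  unfolding free_image_def by (rule subsetD[OF closure_subset span_base[OF imageI]])

lemma ev_point:
  assumes "e \<in> mspace M" "x \<in> mspace M" "f \<in> Lip0 M e" shows "ev M f (point M e x) = f x"
  unfolding point_def ev_emb[OF evaluation_dual[OF assms(1,2)] assms(3)] using assms(3) by (simp add: evaluation_def)

lemma norm_point_diff: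
  assumes "e \<in> mspace M" "x \<in> mspace M" "y \<in> mspace M"
  shows "norm (point M e x - point M e y) \<le> mdist M x y"
proof -
  note d = evaluation_dual[OF assms(1,2)] evaluation_dual[OF assms(1,3)]
  have "norm (point M e x - point M e y) = free_norm M e (\<lambda>f. evaluation M e x f - evaluation M e y f)"
    unfolding point_def Lip0_dual_diff(2)[OF d, symmetric] by (rule norm_emb[OF Lip0_dual_diff(1)[OF d]])
  also have "\<dots> \<le> mdist M x y"
  proof (rule free_norm_le)
    fix f assume f: "f \<in> Lip0 M e" "lip_norm M f \<le> 1"
    show "\<bar>evaluation M e x f - evaluation M e y f\<bar> \<le> mdist M x y"
      using lipschitz_boundD[OF Lip0_lip_norm(2)[OF f(1)] assms(2,3)] mult_right_mono[OF f(2) mdist_nonneg[of M x y]] f(1)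
      by (simp add: evaluation_def)
  qed
  finally show ?thesis .
qed

lemma evaluation_span_dual:
  assumes "e \<in> mspace M" "finite A" "A \<subseteq> mspace M"
  shows "(\<lambda>f. \<Sum>x\<in>A. c x * evaluation M e x f) \<in> Lip0_dual M e \<and>
    emb M e (\<lambda>f. \<Sum>x\<in>A. c x * evaluation M e x f) = (\<Sum>x\<in>A. c x *\<^sub>R point M e x)"
  unfolding point_def
  by (rule Lip0_dual_sum[OF assms(2)]) (rule evaluation_dual[OF assms(1)], use assms(3) in blast)

lemma emb_evaluation_span:
  assumes "e \<in> mspace M"
  shows "emb M e ` evaluation_span M e = span (point M e ` mspace M)" "evaluation_span M e \<subseteq> Lip0_dual M e"
proof -
  show "evaluation_span M e \<subseteq> Lip0_dual M e"
    using evaluation_span_dual[OF assms] by (auto simp: evaluation_span_def)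
  show "emb M e ` evaluation_span M e = span (point M e ` mspace M)"
  proof (intro equalityI subsetI)
    fix v assume "v \<in> emb M e ` evaluation_span M e"
    then obtain A c where A: "finite A" "A \<subseteq> mspace M" and v: "v = emb M e (\<lambda>f. \<Sum>x\<in>A. c x * evaluation M e x f)"
      unfolding evaluation_span_def by blast
    have "v = (\<Sum>x\<in>A. c x *\<^sub>R point M e x)" using evaluation_span_dual[OF assms A, of c] v by simp
    also have "\<dots> \<in> span (point M e ` mspace M)"
      using A(2) by (intro span_sum span_scale span_base) blast
    finally show "v \<in> span (point M e ` mspace M)" .
  next
    fix v assume "v \<in> span (point M e ` mspace M)"
    then obtain T r where T: "finite T" "T \<subseteq> point M e ` mspace M" "v = (\<Sum>a\<in>T. r a *\<^sub>R a)"
      unfolding span_explicit by blast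
    then obtain A where A: "A \<subseteq> mspace M" "inj_on (point M e) A" "T = point M e ` A"
      using subset_image_inj[of T "point M e" "mspace M"] by auto
    have "finite A" using finite_imageD[OF _ A(2)] T(1) A(3) by simp
    have "v = (\<Sum>x\<in>A. r (point M e x) *\<^sub>R point M e x)" by (simp add: T(3) A(3) sum.reindex[OF A(2)])
    then have "v = emb M e (\<lambda>f. \<Sum>x\<in>A. r (point M e x) * evaluation M e x f)"
      using evaluation_span_dual[OF assms \<open>finite A\<close> A(1), of "\<lambda>x. r (point M e x)"] by simp
    then show "v \<in> emb M e ` evaluation_span M e"
      unfolding evaluation_span_def
      by (intro image_eqI[of v "emb M e" "\<lambda>f. \<Sum>x\<in>A. r (point M e x) * evaluation M e x f"] CollectI exI[of _ A] exI[of _ "\<lambda>x. r (point M e x)"])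
         (use \<open>finite A\<close> A(1) in auto)
  qed
qed

lemma emb_free_space:
  assumes "e \<in> mspace M"
  shows "free_space M e = {\<mu> \<in> Lip0_dual M e. emb M e \<mu> \<in> free_image M e}"
    and "emb M e ` free_space M e = free_image M e"
proof -
  note es = emb_evaluation_span[OF assms]
  show 1: "free_space M e = {\<mu> \<in> Lip0_dual M e. emb M e \<mu> \<in> free_image M e}"
  proof -
    have "(\<forall>\<epsilon>>0. \<exists>\<psi>\<in>evaluation_span M e. free_norm M e (\<lambda>f. \<mu> f - \<psi> f) < \<epsilon>) \<longleftrightarrow> emb M e \<mu> \<in> free_image M e"
      if \<mu>: "\<mu> \<in> Lip0_dual M e" for \<mu>
    proof -
      have d: "free_norm M e (\<lambda>f. \<mu> f - \<psi> f) = dist (emb M e \<psi>) (emb M e \<mu>)" if "\<psi> \<in> evaluation_span M e" for \<psi>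
      proof -
        have \<psi>: "\<psi> \<in> Lip0_dual M e" using es(2) that by blast
        show ?thesis
          using norm_emb[OF Lip0_dual_diff(1)[OF \<mu> \<psi>]] by (simp add: Lip0_dual_diff(2)[OF \<mu> \<psi>] dist_norm norm_minus_commute)
      qed
      show ?thesis
        unfolding free_image_def es(1)[symmetric] closure_approachable by (simp add: d)
    qed
    then show ?thesis by (simp add: free_space_def cong: conj_cong)
  qed
  have "span (point M e ` mspace M) \<subseteq> emb M e ` Lip0_dual M e" using es by blast
  then have "free_image M e \<subseteq> emb M e ` Lip0_dual M e"
    unfolding free_image_def by (rule closure_minimal[OF _ closed_emb_dual])
  then show "emb M e ` free_space M e = free_image M e" unfolding 1 by blast
qed

section \<open>Discrete subsets of full cardinality\<close>

text \<open>Zorn's lemma, in the form that yields maximal separated sets, maximal disjoint families of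
  open sets and maximal independent sets of a directed graph.\<close>

lemma maximal_pairwise_subset:
  obtains C where "C \<subseteq> U" "pairwise R C" "\<And>x. x \<in> U \<Longrightarrow> x \<notin> C \<Longrightarrow> \<exists>y\<in>C. \<not> (R x y \<and> R y x)"
proof -
  let ?A = "{C. C \<subseteq> U \<and> pairwise R C}"
  have "\<exists>M\<in>?A. \<forall>X\<in>?A. M \<subseteq> X \<longrightarrow> X = M"
  proof (rule subset_Zorn')
    fix \<C> assume ch: "subset.chain ?A \<C>"
    have "pairwise R (\<Union>\<C>)"
    proof (rule pairwiseI)
      fix x y assume "x \<in> \<Union>\<C>" "y \<in> \<Union>\<C>" "x \<noteq> y"
      then obtain X Y where X: "X \<in> \<C>" "x \<in> X" and Y: "Y \<in> \<C>" "y \<in> Y" by blast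
      then have "X \<subseteq> Y \<or> Y \<subseteq> X" using ch unfolding subset_chain_def by blast
      then obtain Z where "Z \<in> \<C>" "x \<in> Z" "y \<in> Z" using X Y by blast
      moreover have "pairwise R Z" using ch \<open>Z \<in> \<C>\<close> unfolding subset_chain_def by blast
      ultimately show "R x y" using \<open>x \<noteq> y\<close> by (simp add: pairwiseD)
    qed
    moreover have "\<Union>\<C> \<subseteq> U" using ch unfolding subset_chain_def by blast
    ultimately show "\<Union>\<C> \<in> ?A" by simp
  qed
  then obtain C where "C \<in> ?A" and max: "\<forall>X\<in>?A. C \<subseteq> X \<longrightarrow> X = C" by (rule bexE)
  then have C: "C \<subseteq> U" "pairwise R C" by simp_all
  have "\<exists>y\<in>C. \<not> (R x y \<and> R y x)" if "x \<in> U" "x \<notin> C" for x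
  proof (rule ccontr)
    assume "\<not> (\<exists>y\<in>C. \<not> (R x y \<and> R y x))"
    then have "pairwise R (insert x C)" using C(2) by (simp add: pairwise_insert)
    then have "insert x C = C" using bspec[OF max, of "insert x C"] C(1) \<open>x \<in> U\<close> by auto
    then show False using \<open>x \<notin> C\<close> by auto
  qed
  from that[OF C this] show ?thesis .
qed

definition relatively_discrete :: "'a metric \<Rightarrow> 'a set \<Rightarrow> bool" where
  "relatively_discrete M A \<longleftrightarrow> (\<forall>x\<in>A. \<exists>r>0. \<forall>y\<in>A. y \<noteq> x \<longrightarrow> r \<le> mdist M x y)"

definition separated_by :: "'a metric \<Rightarrow> real \<Rightarrow> 'a set \<Rightarrow> bool" where
  "separated_by M r A \<longleftrightarrow> pairwise (\<lambda>x y. r \<le> mdist M x y) A"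

definition dense_within :: "'a metric \<Rightarrow> 'a set \<Rightarrow> 'a set \<Rightarrow> bool" where
  "dense_within M U D \<longleftrightarrow> D \<subseteq> U \<and> (\<forall>x\<in>U. \<forall>r>0. \<exists>y\<in>D. mdist M x y < r)"

lemma openin_mtopology_of:
  "openin (mtopology_of M) U \<longleftrightarrow> U \<subseteq> mspace M \<and> (\<forall>x\<in>U. \<exists>r>0. \<forall>y\<in>mspace M. mdist M x y < r \<longrightarrow> y \<in> U)"
proof -
  interpret Metric_space "mspace M" "mdist M" by simp
  have *: "mball x r \<subseteq> U \<longleftrightarrow> (\<forall>y\<in>mspace M. mdist M x y < r \<longrightarrow> y \<in> U)" if "x \<in> mspace M" for x r
    using that by (auto simp: subset_iff)
  show ?thesis unfolding mtopology_of_def openin_mtopology using * by blast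
qed

lemma is_dense_iff: "is_dense M D \<longleftrightarrow> dense_within M (mspace M) D"
proof -
  interpret Metric_space "mspace M" "mdist M" by simp
  have "mtopology_of M closure_of D = {x \<in> mspace M. \<forall>r>0. \<exists>y\<in>D. y \<in> mball x r}"
    by (simp add: mtopology_of_def metric_closure_of)
  then have "mtopology_of M closure_of D = mspace M \<longleftrightarrow> (\<forall>x\<in>mspace M. \<forall>r>0. \<exists>y\<in>D. y \<in> mball x r)"
    by (simp only:) blast
  moreover have "(\<exists>y\<in>D. y \<in> mball x r) \<longleftrightarrow> (\<exists>y\<in>D. mdist M x y < r)" if "D \<subseteq> mspace M" "x \<in> mspace M" for x r
    using that by auto
  ultimately show ?thesis unfolding is_dense_def dense_within_def by (metis (no_types, lifting))
qed

lemma openin_ball: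
  assumes "x \<in> mspace M" shows "openin (mtopology_of M) {y \<in> mspace M. mdist M x y < r}"
  unfolding openin_mtopology_of
proof (intro conjI ballI)
  fix y assume y: "y \<in> {y \<in> mspace M. mdist M x y < r}"
  show "\<exists>s>0. \<forall>z\<in>mspace M. mdist M y z < s \<longrightarrow> z \<in> {y \<in> mspace M. mdist M x y < r}"
  proof (intro exI[of _ "r - mdist M x y"] conjI ballI impI)
    fix z assume "z \<in> mspace M" "mdist M y z < r - mdist M x y"
    then show "z \<in> {y \<in> mspace M. mdist M x y < r}" using mdist_triangle[of x M y z] y assms by simp
  qed (use y in simp)
qed simp

lemma maximal_separated:
  assumes "r > 0"
  obtains C where "C \<subseteq> U" "separated_by M r C" "\<And>x. x \<in> U \<Longrightarrow> x \<in> mspace M \<Longrightarrow> \<exists>y\<in>C. mdist M x y < r"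
proof -
  obtain C where C: "C \<subseteq> U" "pairwise (\<lambda>x y. r \<le> mdist M x y) C"
    "\<And>x. x \<in> U \<Longrightarrow> x \<notin> C \<Longrightarrow> \<exists>y\<in>C. \<not> (r \<le> mdist M x y \<and> r \<le> mdist M y x)"
    using maximal_pairwise_subset by metis
  have "\<exists>y\<in>C. mdist M x y < r" if "x \<in> U" "x \<in> mspace M" for x
  proof (cases "x \<in> C")
    case True then show ?thesis using that(2) assms by (intro bexI[of _ x]) simp_all
  next
    case False
    then show ?thesis using C(3)[OF that(1)] by (auto simp: mdist_commute[of M _ x] not_le)
  qed
  then show ?thesis using that C unfolding separated_by_def by blast
qed

lemma finite_separated:
  assumes "finite A" "A \<subseteq> mspace M"
  obtains r where "r > 0" "separated_by M r A"
proof -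
  let ?D = "insert 1 ((\<lambda>(x, y). mdist M x y) ` {(x, y). x \<in> A \<and> y \<in> A \<and> x \<noteq> y})"
  have "finite {(x, y). x \<in> A \<and> y \<in> A \<and> x \<noteq> y}"
    by (rule finite_subset[of _ "A \<times> A"]) (use assms in auto)
  then have fin: "finite ?D" by simp
  have "0 < Min ?D"
    using fin assms(2) by (subst Min_gr_iff) (auto intro!: mdist_pos)
  moreover have "separated_by M (Min ?D) A"
    unfolding separated_by_def
  proof (rule pairwiseI)
    fix x y assume "x \<in> A" "y \<in> A" "x \<noteq> y"
    then have "mdist M x y \<in> ?D" by force
    then show "Min ?D \<le> mdist M x y" using fin by simp
  qed
  ultimately show ?thesis by (rule that)
qed

lemma separated_relatively_discrete:
  assumes "r > 0" "separated_by M r A" shows "relatively_discrete M A"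
  unfolding relatively_discrete_def
proof
  fix x assume "x \<in> A"
  have "\<forall>y\<in>A. y \<noteq> x \<longrightarrow> r \<le> mdist M x y"
    by (intro ballI impI pairwiseD[OF assms(2)[unfolded separated_by_def] \<open>x \<in> A\<close>]) auto
  then show "\<exists>r>0. \<forall>y\<in>A. y \<noteq> x \<longrightarrow> r \<le> mdist M x y" using assms(1) by blast
qed

lemma relatively_discrete_disjoint_Union:
  assumes V: "\<And>i. i \<in> I \<Longrightarrow> openin (mtopology_of M) (V i)" and disj: "\<And>i j. i \<in> I \<Longrightarrow> j \<in> I \<Longrightarrow> i \<noteq> j \<Longrightarrow> V i \<inter> V j = {}"
    and A: "\<And>i. i \<in> I \<Longrightarrow> A i \<subseteq> V i" "\<And>i. i \<in> I \<Longrightarrow> relatively_discrete M (A i)"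
  shows "relatively_discrete M (\<Union>i\<in>I. A i)"
  unfolding relatively_discrete_def
proof
  fix x assume "x \<in> (\<Union>i\<in>I. A i)"
  then obtain i where i: "i \<in> I" "x \<in> A i" by blast
  then have "x \<in> V i" using A(1) by blast
  then obtain r where r: "r > 0" "\<And>y. y \<in> mspace M \<Longrightarrow> mdist M x y < r \<Longrightarrow> y \<in> V i"
    using V[OF i(1)] unfolding openin_mtopology_of by blast
  obtain s where s: "s > 0" "\<And>y. y \<in> A i \<Longrightarrow> y \<noteq> x \<Longrightarrow> s \<le> mdist M x y"
    using A(2)[OF i(1)] i(2) unfolding relatively_discrete_def by blast
  have "min r s \<le> mdist M x y" if y: "y \<in> A j" "j \<in> I" "y \<noteq> x" for y j
  proof (cases "j = i")
    case True
    then show ?thesis using s(2)[of y] y by simp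
  next
    case False
    have "y \<in> V j" using A(1) y by blast
    then have "y \<notin> V i" using disj[OF y(2) i(1) False] by blast
    moreover have "y \<in> mspace M" using V[OF y(2)] \<open>y \<in> V j\<close> unfolding openin_mtopology_of by blast
    ultimately have "r \<le> mdist M x y" using r(2) by (meson not_le)
    then show ?thesis by simp
  qed
  then show "\<exists>t>0. \<forall>y\<in>\<Union>i\<in>I. A i. y \<noteq> x \<longrightarrow> t \<le> mdist M x y"
    using r(1) s(1) by (intro exI[of _ "min r s"]) auto
qed

text \<open>Comparing cardinalities piece by piece avoids all arithmetic of cardinal sums.\<close>

lemma card_of_UN_ordLeq_disjoint_UN:
  assumes le: "\<And>i. i \<in> I \<Longrightarrow> |D i| \<le>o |A i|" and disj: "\<And>i j. i \<in> I \<Longrightarrow> j \<in> I \<Longrightarrow> i \<noteq> j \<Longrightarrow> A i \<inter> A j = {}"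
  shows "|\<Union>i\<in>I. D i| \<le>o |\<Union>i\<in>I. A i|"
proof -
  have "\<forall>i. \<exists>f. i \<in> I \<longrightarrow> inj_on f (D i) \<and> f ` D i \<subseteq> A i" using le unfolding card_of_ordLeq[symmetric] by blast
  then obtain f where f: "\<And>i. i \<in> I \<Longrightarrow> inj_on (f i) (D i) \<and> f i ` D i \<subseteq> A i" by metis
  have "\<forall>x. \<exists>i. x \<in> (\<Union>i\<in>I. D i) \<longrightarrow> i \<in> I \<and> x \<in> D i" by blast
  then obtain k where k: "\<And>x. x \<in> (\<Union>i\<in>I. D i) \<Longrightarrow> k x \<in> I \<and> x \<in> D (k x)" by metis
  show ?thesis
  proof (rule card_of_ordLeqI[of "\<lambda>x. f (k x) x"])
    show "inj_on (\<lambda>x. f (k x) x) (\<Union>i\<in>I. D i)"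
    proof (rule inj_onI)
      fix x y assume x: "x \<in> (\<Union>i\<in>I. D i)" and y: "y \<in> (\<Union>i\<in>I. D i)" and eq: "f (k x) x = f (k y) y"
      have "f (k x) x \<in> A (k x)" "f (k y) y \<in> A (k y)" using k[OF x] k[OF y] f by blast+
      then have "k x = k y" using disj k[OF x] k[OF y] eq by (metis IntI empty_iff)
      then show "x = y" using eq k[OF x] k[OF y] f[of "k x"] by (metis inj_onD)
    qed
    fix x assume "x \<in> (\<Union>i\<in>I. D i)"
    then show "f (k x) x \<in> (\<Union>i\<in>I. A i)" using k f by blast
  qed
qed

definition rich_open :: "'a metric \<Rightarrow> 'a set \<Rightarrow> bool" where
  "rich_open M V \<longleftrightarrow> V \<noteq> {} \<and> openin (mtopology_of M) V \<and>
     (\<exists>A D. A \<subseteq> V \<and> relatively_discrete M A \<and> dense_within M V D \<and> |D| \<le>o |A| )"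

text \<open>Around an accumulation point \<open>v\<close>, points whose distances to \<open>v\<close>
  decrease at least by the factor \<open>4\<close> lie in disjoint annuli.\<close>

lemma disjoint_open_sequence:
  assumes V: "openin (mtopology_of M) V" "v \<in> V"
    and acc: "\<And>r. r > 0 \<Longrightarrow> \<exists>y\<in>mspace M. y \<noteq> v \<and> mdist M v y < r"
  obtains W :: "nat \<Rightarrow> 'a set" where "\<And>n. openin (mtopology_of M) (W n)" "\<And>n. W n \<noteq> {}" "\<And>n. W n \<subseteq> V"
    "\<And>m n. m \<noteq> n \<Longrightarrow> W m \<inter> W n = {}"
proof -
  have v: "v \<in> mspace M" using V unfolding openin_mtopology_of by blast
  obtain r0 where r0: "r0 > 0" "\<And>y. y \<in> mspace M \<Longrightarrow> mdist M v y < r0 \<Longrightarrow> y \<in> V"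
    using V unfolding openin_mtopology_of by blast
  obtain x where x: "\<And>n. x n \<in> mspace M \<and> x n \<noteq> v \<and> mdist M v (x n) < r0 / 2"
    "\<And>n. mdist M v (x (Suc n)) < mdist M v (x n) / 4"
  proof -
    have "\<exists>x. \<forall>n. (x n \<in> mspace M \<and> x n \<noteq> v \<and> mdist M v (x n) < r0 / 2) \<and> mdist M v (x (Suc n)) < mdist M v (x n) / 4"
    proof (rule dependent_nat_choice)
      show "\<exists>y. y \<in> mspace M \<and> y \<noteq> v \<and> mdist M v y < r0 / 2" using acc[of "r0 / 2"] r0(1) by auto
      fix y assume y: "y \<in> mspace M \<and> y \<noteq> v \<and> mdist M v y < r0 / 2"
      then have "0 < mdist M v y" using v by (intro mdist_pos) auto
      then have "0 < min (r0 / 2) (mdist M v y / 4)" using r0(1) by simp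
      from acc[OF this] show "\<exists>z. (z \<in> mspace M \<and> z \<noteq> v \<and> mdist M v z < r0 / 2) \<and> mdist M v z < mdist M v y / 4"
        by auto
    qed
    then show ?thesis using that by blast
  qed
  define \<rho> where "\<rho> n = mdist M v (x n)" for n
  have \<rho>_pos: "0 < \<rho> n" for n unfolding \<rho>_def using x(1)[of n] v by (intro mdist_pos) auto
  have \<rho>_less: "\<rho> n < \<rho> m / 4" if "m < n" for m n
    using that
  proof (induction n)
    case (Suc n)
    show ?case
    proof (cases "m = n")
      case True then show ?thesis using x(2)[of n] by (simp add: \<rho>_def)
    next
      case False
      then have "\<rho> n < \<rho> m / 4" using Suc by simp
      moreover have "\<rho> (Suc n) < \<rho> n / 4" using x(2)[of n] by (simp add: \<rho>_def)
      ultimately show ?thesis using \<rho>_pos[of n] by linarith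
    qed
  qed simp
  define W where "W n = {w \<in> mspace M. \<rho> n / 2 < mdist M v w \<and> mdist M v w < 2 * \<rho> n}" for n
  show ?thesis
  proof (rule that[of W])
    fix n
    show "openin (mtopology_of M) (W n)"
      unfolding openin_mtopology_of
    proof (intro conjI ballI)
      fix w assume w: "w \<in> W n"
      let ?r = "min (mdist M v w - \<rho> n / 2) (2 * \<rho> n - mdist M v w)"
      have "z \<in> W n" if z: "z \<in> mspace M" "mdist M w z < ?r" for z
      proof -
        have "w \<in> mspace M" using w by (simp add: W_def)
        then have "mdist M v z \<le> mdist M v w + mdist M w z" "mdist M v w \<le> mdist M v z + mdist M w z"
          using mdist_triangle[of v M w z] mdist_triangle[of v M z w] v z(1) by (simp_all add: mdist_commute[of M z w])
        then show ?thesis using z w by (simp add: W_def)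
      qed
      moreover have "?r > 0" using w by (simp add: W_def)
      ultimately show "\<exists>r>0. \<forall>z\<in>mspace M. mdist M w z < r \<longrightarrow> z \<in> W n" by blast
    qed (auto simp: W_def)
    have "x n \<in> W n" using x(1)[of n] \<rho>_pos[of n] by (simp add: W_def \<rho>_def)
    then show "W n \<noteq> {}" by blast
    show "W n \<subseteq> V"
    proof
      fix w assume "w \<in> W n"
      then have "w \<in> mspace M" "mdist M v w < 2 * \<rho> n" by (simp_all add: W_def)
      moreover have "\<rho> n < r0 / 2" using x(1)[of n] by (simp add: \<rho>_def)
      ultimately show "w \<in> V" by (intro r0(2)) simp_all
    qed
  next
    have "W m \<inter> W n = {}" if "m < n" for m n
      using \<rho>_less[OF that] \<rho>_pos[of m] by (auto simp: W_def)
    then show "W m \<inter> W n = {}" if "m \<noteq> n" for m n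
      using that by (metis Int_commute nat_neq_iff)
  qed
qed

text \<open>Choose an open subset \<open>V\<close> of \<open>U\<close> of least density. An isolated
  point of \<open>V\<close> settles the claim. Otherwise the union of maximal
  \<open>2\<^sup>-\<^sup>n\<close>-separated sets \<open>C n\<close> is dense in
  \<open>V\<close>. If none of them is as large as the density of \<open>V\<close>, take a
  sequence of disjoint open subsets \<open>W n\<close> of \<open>V\<close>. None of them has a
  smaller density than \<open>V\<close>, so for infinite \<open>C n\<close> the separated
  subsets of \<open>W n\<close> cannot all be smaller than \<open>C n\<close>: a countable
  union of sets of size at most \<open>|C n|\<close> would be dense in \<open>W n\<close>. For
  finite \<open>C n\<close> any \<open>|C n|\<close> points of the infinite set \<open>W
  n\<close> serve. Hence \<open>W n\<close> contains a separated set no smaller than \<open>C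
  n\<close>, and the union of these sets is relatively discrete. The argument covers densities
  that are limits of countably many smaller cardinals, which no single separated set needs to
  attain.\<close>

lemma rich_open_exists:
  assumes U: "openin (mtopology_of M) U" "U \<noteq> {}"
  obtains V where "rich_open M V" "V \<subseteq> U"
proof -
  let ?P = "\<lambda>V D. openin (mtopology_of M) V \<and> V \<noteq> {} \<and> V \<subseteq> U \<and> dense_within M V D"
  let ?R = "{|D| | D V. ?P V D}"
  have self_dense: "dense_within M V V" if "openin (mtopology_of M) V" for V
    unfolding dense_within_def
  proof (intro conjI ballI allI impI)
    fix x and r :: real assume "x \<in> V" "0 < r"
    then show "\<exists>y\<in>V. mdist M x y < r"
      using that unfolding openin_mtopology_of by (intro bexI[of _ x]) auto
  qed simp
  have "?R \<noteq> {}" using U self_dense[OF U(1)] by blast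
  moreover have "\<forall>r\<in>?R. Well_order r" using card_of_Well_order by auto
  ultimately obtain \<rho> where \<rho>: "\<rho> \<in> ?R" "\<forall>r\<in>?R. \<rho> \<le>o r" using exists_minim_Well_order[of ?R] by blast
  then obtain V D where VD: "?P V D" and "\<rho> = |D|" by blast
  then have min: "|D| \<le>o |D'|" if "?P V' D'" for V' D' using \<rho>(2) that by blast
  have V: "openin (mtopology_of M) V" "V \<noteq> {}" "V \<subseteq> U" and D: "dense_within M V D" using VD by blast+
  have VM: "V \<subseteq> mspace M" using V(1) unfolding openin_mtopology_of by blast
  show ?thesis
  proof (cases "\<exists>v\<in>V. \<exists>r>0. \<forall>y\<in>mspace M. mdist M v y < r \<longrightarrow> y = v")
    case True
    then obtain v r where v: "v \<in> V" "r > 0" "\<forall>y\<in>mspace M. mdist M v y < r \<longrightarrow> y = v" by blast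
    have "openin (mtopology_of M) {v}"
      unfolding openin_mtopology_of using v VM by (intro conjI ballI exI[of _ r]) auto
    moreover have "relatively_discrete M {v}" by (auto simp: relatively_discrete_def intro!: exI[of _ 1])
    ultimately have "rich_open M {v}"
      unfolding rich_open_def using self_dense[of "{v}"] ordLeq_refl[OF card_of_Card_order] by blast
    then show ?thesis using that v(1) V(3) by blast
  next
    case False
    have infinite_open: "infinite W" if W: "openin (mtopology_of M) W" "W \<noteq> {}" "W \<subseteq> V" for W
    proof
      assume "finite W"
      have WM: "W \<subseteq> mspace M" using W(3) VM by blast
      obtain w where w: "w \<in> W" using W(2) by blast
      obtain r where r: "r > 0" "separated_by M r W" using finite_separated[OF \<open>finite W\<close> WM] by blast
      obtain s where s: "s > 0" "\<forall>y\<in>mspace M. mdist M w y < s \<longrightarrow> y \<in> W"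
        using W(1) w unfolding openin_mtopology_of by blast
      have "y = w" if "y \<in> mspace M" "mdist M w y < min r s" for y
      proof (rule ccontr)
        assume "y \<noteq> w"
        have "y \<in> W" using s(2) that by simp
        then have "r \<le> mdist M w y" using r(2) w \<open>y \<noteq> w\<close> unfolding separated_by_def pairwise_def by metis
        then show False using that(2) by simp
      qed
      then have "\<exists>v\<in>V. \<exists>r>0. \<forall>y\<in>mspace M. mdist M v y < r \<longrightarrow> y = v"
        using w W(3) r(1) s(1) by (intro bexI[of _ w] exI[of _ "min r s"]) auto
      then show False using False by blast
    qed
    have nets: "\<exists>C. \<forall>n::nat. C n \<subseteq> W \<and> separated_by M ((1 / 2) ^ n) (C n) \<and> (\<forall>x\<in>W. \<exists>y\<in>C n. mdist M x y < (1 / 2) ^ n)"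
      if "W \<subseteq> mspace M" for W
    proof (rule choice, rule allI)
      fix n :: nat
      obtain C where "C \<subseteq> W" "separated_by M ((1 / 2) ^ n) C" "\<And>x. x \<in> W \<Longrightarrow> x \<in> mspace M \<Longrightarrow> \<exists>y\<in>C. mdist M x y < (1 / 2) ^ n"
        using maximal_separated[of "(1 / 2) ^ n" W M] by auto
      then show "\<exists>C. C \<subseteq> W \<and> separated_by M ((1 / 2) ^ n) C \<and> (\<forall>x\<in>W. \<exists>y\<in>C. mdist M x y < (1 / 2) ^ n)"
        using that by (intro exI[of _ C]) auto
    qed
    have nets_dense: "dense_within M W (\<Union>n. C n)"
      if C: "\<forall>n::nat. C n \<subseteq> W \<and> separated_by M ((1 / 2) ^ n) (C n) \<and> (\<forall>x\<in>W. \<exists>y\<in>C n. mdist M x y < (1 / 2) ^ n)" for W C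
      unfolding dense_within_def
    proof (intro conjI ballI allI impI)
      fix x and r :: real assume "x \<in> W" "0 < r"
      obtain n where "(1 / 2) ^ n < r" using real_arch_pow_inv[OF \<open>0 < r\<close>, of "1 / 2"] by auto
      moreover obtain y where "y \<in> C n" "mdist M x y < (1 / 2) ^ n" using C \<open>x \<in> W\<close> by blast
      ultimately show "\<exists>y\<in>\<Union>n. C n. mdist M x y < r" by (intro bexI[of _ y]) auto
    qed (use C in blast)
    obtain C where C: "\<forall>n::nat. C n \<subseteq> V \<and> separated_by M ((1 / 2) ^ n) (C n) \<and> (\<forall>x\<in>V. \<exists>y\<in>C n. mdist M x y < (1 / 2) ^ n)"
      using nets[OF VM] by blast
    show ?thesis
    proof (cases "\<exists>n. |D| \<le>o |C n|")
      case True
      then obtain n where n: "|D| \<le>o |C n|" by blast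
      have "relatively_discrete M (C n)"
        by (rule separated_relatively_discrete[of "(1 / 2) ^ n"]) (use C in auto)
      then have "rich_open M V" unfolding rich_open_def using V D n C by blast
      then show ?thesis using that V(3) by blast
    next
      case small: False
      obtain v where v: "v \<in> V" using V(2) by blast
      have "\<exists>y\<in>mspace M. y \<noteq> v \<and> mdist M v y < r" if "r > 0" for r using False v that by blast
      then obtain W :: "nat \<Rightarrow> 'a set" where W: "\<And>n. openin (mtopology_of M) (W n)" "\<And>n. W n \<noteq> {}" "\<And>n. W n \<subseteq> V"
        "\<And>m n. m \<noteq> n \<Longrightarrow> W m \<inter> W n = {}"
        using disjoint_open_sequence[OF V(1) v] by metis
      have "\<exists>B. B \<subseteq> W n \<and> relatively_discrete M B \<and> |C n| \<le>o |B|" for n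
      proof (cases "finite (C n)")
        case True
        obtain B where B: "finite B" "card B = card (C n)" "B \<subseteq> W n"
          using infinite_arbitrarily_large[OF infinite_open[OF W(1,2,3)]] by blast
        have BM: "B \<subseteq> mspace M" using B(3) W(3) VM by blast
        obtain r where "r > 0" "separated_by M r B" using finite_separated[OF B(1) BM] by blast
        then have "relatively_discrete M B" by (rule separated_relatively_discrete)
        moreover have "|C n| =o |B|"
          using finite_same_card_bij[OF True B(1)] B(2) card_of_ordIso by metis
        ultimately show ?thesis using B(3) ordIso_imp_ordLeq by blast
      next
        case inf: False
        have WnM: "W n \<subseteq> mspace M" using W(3) VM by blast
        obtain E where E: "\<forall>m::nat. E m \<subseteq> W n \<and> separated_by M ((1 / 2) ^ m) (E m) \<and> (\<forall>x\<in>W n. \<exists>y\<in>E m. mdist M x y < (1 / 2) ^ m)"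
          using nets[OF WnM] by blast
        have "|D| \<le>o |\<Union>m. E m|" using min[of "W n" "\<Union>m. E m"] W(1,2,3) V(3) nets_dense[OF E] by blast
        have "\<exists>m. |C n| \<le>o |E m|"
        proof (rule ccontr)
          assume "\<nexists>m. |C n| \<le>o |E m|"
          then have "|E m| \<le>o |C n|" for m using ordLeq_total[OF card_of_Well_order card_of_Well_order] by blast
          then have "|\<Union>m. E m| \<le>o |C n|"
            using card_of_UNION_ordLeq_infinite[OF inf, of "UNIV :: nat set" E] inf infinite_iff_card_of_nat[of "C n"] by blast
          then have "|D| \<le>o |C n|" using \<open>|D| \<le>o |\<Union>m. E m|\<close> ordLeq_transitive by blast
          then show False using small by blast
        qed
        then obtain m where m: "|C n| \<le>o |E m|" by blast
        have "relatively_discrete M (E m)"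
          by (rule separated_relatively_discrete[of "(1 / 2) ^ m"]) (use E in auto)
        then show ?thesis using m E by blast
      qed
      then obtain B where B: "\<And>n. B n \<subseteq> W n" "\<And>n. relatively_discrete M (B n)" "\<And>n. |C n| \<le>o |B n|" by metis
      have "B m \<inter> B n = {}" if "m \<noteq> n" for m n using W(4)[OF that] B(1)[of m] B(1)[of n] by blast
      then have "|\<Union>n. C n| \<le>o |\<Union>n. B n|" using B(3) by (intro card_of_UN_ordLeq_disjoint_UN) auto
      moreover have "relatively_discrete M (\<Union>n. B n)"
        using W B by (intro relatively_discrete_disjoint_Union[where V = W]) auto
      moreover have "(\<Union>n. B n) \<subseteq> V" using B(1) W(3) by blast
      ultimately have "rich_open M V" unfolding rich_open_def using V(1,2) nets_dense[OF C] by blast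
      then show ?thesis using that V(3) by blast
    qed
  qed
qed

text \<open>The union of a maximal disjoint family of rich open sets is dense by
  \<open>rich_open_exists\<close>, and both kinds of subsets can be collected over the family.\<close>

theorem dense_ordLeq_relatively_discrete:
  obtains A D where "A \<subseteq> mspace M" "relatively_discrete M A" "is_dense M D" "|D| \<le>o |A|"
proof -
  obtain \<V> where \<V>: "\<V> \<subseteq> {V. rich_open M V}" "pairwise disjnt \<V>"
    "\<And>V. V \<in> {V. rich_open M V} \<Longrightarrow> V \<notin> \<V> \<Longrightarrow> \<exists>W\<in>\<V>. \<not> (disjnt V W \<and> disjnt W V)"
    using maximal_pairwise_subset by metis
  have "\<forall>V. \<exists>A D. V \<in> \<V> \<longrightarrow> A \<subseteq> V \<and> relatively_discrete M A \<and> dense_within M V D \<and> |D| \<le>o |A|"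
    using \<V>(1) unfolding rich_open_def by blast
  then obtain A D where AD: "\<And>V. V \<in> \<V> \<Longrightarrow> A V \<subseteq> V \<and> relatively_discrete M (A V) \<and> dense_within M V (D V) \<and> |D V| \<le>o |A V|"
    by metis
  have op: "openin (mtopology_of M) V" if "V \<in> \<V>" for V using \<V>(1) that unfolding rich_open_def by blast
  have VM: "V \<subseteq> mspace M" if "V \<in> \<V>" for V using op[OF that] unfolding openin_mtopology_of by blast
  have disj: "V \<inter> W = {}" if "V \<in> \<V>" "W \<in> \<V>" "V \<noteq> W" for V W
    using \<V>(2) that unfolding pairwise_def disjnt_def by blast
  show ?thesis
  proof (rule that[of "\<Union>V\<in>\<V>. A V" "\<Union>V\<in>\<V>. D V"])
    show "(\<Union>V\<in>\<V>. A V) \<subseteq> mspace M" using AD VM by blast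
    show "relatively_discrete M (\<Union>V\<in>\<V>. A V)"
      by (rule relatively_discrete_disjoint_Union[of \<V> M "\<lambda>V. V"]) (use op disj AD in auto)
    show "|\<Union>V\<in>\<V>. D V| \<le>o |\<Union>V\<in>\<V>. A V|"
    proof (rule card_of_UN_ordLeq_disjoint_UN)
      show "A V \<inter> A W = {}" if "V \<in> \<V>" "W \<in> \<V>" "V \<noteq> W" for V W
        using disj[OF that] AD[OF that(1)] AD[OF that(2)] by blast
    qed (use AD in blast)
    show "is_dense M (\<Union>V\<in>\<V>. D V)"
      unfolding is_dense_iff dense_within_def
    proof (intro conjI ballI allI impI)
      show "(\<Union>V\<in>\<V>. D V) \<subseteq> mspace M" using AD VM unfolding dense_within_def by blast
      fix x and r :: real assume x: "x \<in> mspace M" and "0 < r"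
      let ?U = "{y \<in> mspace M. mdist M x y < r}"
      have "?U \<noteq> {}" using x \<open>0 < r\<close> by (auto intro!: exI[of _ x])
      then obtain V where V: "rich_open M V" "V \<subseteq> ?U" using rich_open_exists[OF openin_ball[OF x]] by blast
      have "\<exists>W\<in>\<V>. V \<inter> W \<noteq> {}"
      proof (cases "V \<in> \<V>")
        case True
        then show ?thesis using V(1) unfolding rich_open_def by blast
      next
        case False
        then show ?thesis using \<V>(3)[of V] V(1) unfolding disjnt_def by blast
      qed
      then obtain W w where W: "W \<in> \<V>" "w \<in> W" "w \<in> V" by blast
      have w: "w \<in> mspace M" "mdist M x w < r" using W(3) V(2) by auto
      then obtain y where y: "y \<in> D W" "mdist M w y < r - mdist M x w"
        using AD[OF W(1)] W(2) unfolding dense_within_def by (metis diff_gt_0_iff_gt)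
      have "y \<in> mspace M" using y(1) AD[OF W(1)] VM[OF W(1)] unfolding dense_within_def by blast
      then have "mdist M x y < r" using mdist_triangle[of x M w y] x w y(2) by simp
      then show "\<exists>y\<in>\<Union>V\<in>\<V>. D V. mdist M x y < r" using y(1) W(1) by blast
    qed
  qed
qed

text \<open>For a relatively discrete set \<open>B\<close> let \<open>H b\<close> be the distance of
  \<open>b\<close> to the rest of \<open>B\<close> and \<open>n b\<close> a nearly closest
  point. A subset \<open>X\<close> that contains no \<open>n b\<close> with \<open>b\<close>
  in \<open>X\<close> has the required properties. Such an \<open>X\<close> of full
  cardinality exists: if \<open>I\<close> is a maximal independent set for the graph of
  \<open>n\<close>, then \<open>B\<close> is covered by \<open>I\<close>, its image under
  \<open>n\<close>, and the set \<open>T\<close> of points outside \<open>I\<close> that are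
  mapped into \<open>I\<close>. Both \<open>I\<close> and \<open>T\<close> are independent,
  and one of them is as large as \<open>B\<close>.\<close>

theorem separated_pairs:
  fixes M :: "'a metric" and K :: "'k set"
  assumes inf: "infinite (mspace M)" and K: "|K| =o metric_density M"
  obtains x y :: "'k \<Rightarrow> 'a" and h :: "'k \<Rightarrow> real" where
    "\<And>k. k \<in> K \<Longrightarrow> x k \<in> mspace M" "\<And>k. k \<in> K \<Longrightarrow> y k \<in> mspace M" "\<And>k. k \<in> K \<Longrightarrow> 0 < h k"
    "\<And>k. k \<in> K \<Longrightarrow> mdist M (x k) (y k) \<le> 2 * h k"
    "\<And>j k. j \<in> K \<Longrightarrow> k \<in> K \<Longrightarrow> j \<noteq> k \<Longrightarrow> h j \<le> mdist M (x j) (x k)"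
    "\<And>j k. j \<in> K \<Longrightarrow> k \<in> K \<Longrightarrow> h j \<le> mdist M (x j) (y k)" "infinite K"
proof -
  obtain D0 where D0: "is_dense M D0" "metric_density M = |D0|"
    "\<And>D'. is_dense M D' \<Longrightarrow> metric_density M \<le>o |D'|" using metric_density_minimal[of M] by blast
  have "infinite D0"
  proof
    assume fin: "finite D0"
    have D: "D0 \<subseteq> mspace M" "\<And>x r. x \<in> mspace M \<Longrightarrow> r > 0 \<Longrightarrow> \<exists>y\<in>D0. mdist M x y < r"
      using D0(1) unfolding is_dense_iff dense_within_def by blast+
    obtain x where x: "x \<in> mspace M" "x \<notin> D0" using inf fin D(1) by (metis finite_subset subsetI)
    obtain r where r: "r > 0" "separated_by M r (insert x D0)"
      using finite_separated[of "insert x D0" M] fin x D(1) by auto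
    obtain y where y: "y \<in> D0" "mdist M x y < r" using D(2)[OF x(1) r(1)] by blast
    have "r \<le> mdist M x y"
      by (rule pairwiseD[OF r(2)[unfolded separated_by_def]]) (use y x(2) in auto)
    then show False using y(2) by simp
  qed
  obtain A D where A: "A \<subseteq> mspace M" "relatively_discrete M A" and D: "is_dense M D" "|D| \<le>o |A|"
    using dense_ordLeq_relatively_discrete by metis
  have "|D0| \<le>o |A|" using D0(2) D0(3)[OF D(1)] D(2) ordLeq_transitive by metis
  then obtain f where f: "inj_on f D0" "f ` D0 \<subseteq> A" unfolding card_of_ordLeq[symmetric] by blast
  define B where "B = f ` D0"
  have B_inf: "infinite B" using \<open>infinite D0\<close> f(1) by (simp add: B_def finite_image_iff)
  have "|D0| =o |B|" using f(1) card_of_ordIso inj_on_imp_bij_betw unfolding B_def by blast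
  have BA: "B \<subseteq> A" using f(2) by (simp add: B_def)
  have BM: "B \<subseteq> mspace M" using BA A(1) by blast
  define H where "H b = Inf (mdist M b ` (B - {b}))" for b
  have bdd: "bdd_below (mdist M b ` X)" for b X by (rule bdd_belowI[of _ 0]) auto
  have ne: "mdist M b ` (B - {b}) \<noteq> {}" for b
  proof -
    have "infinite (B - {b})" using B_inf by simp
    then have "B - {b} \<noteq> {}" by (metis finite.emptyI)
    then show ?thesis by simp
  qed
  have H_le: "H b \<le> mdist M b c" if "c \<in> B" "c \<noteq> b" for b c
    unfolding H_def by (rule cInf_lower[OF imageI bdd]) (use that in simp)
  have H_pos: "0 < H b" if "b \<in> B" for b
  proof -
    obtain r where r: "r > 0" "\<forall>c\<in>A. c \<noteq> b \<longrightarrow> r \<le> mdist M b c"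
      using A(2)[unfolded relatively_discrete_def, THEN bspec, OF subsetD[OF BA \<open>b \<in> B\<close>]] by (elim exE conjE)
    have "r \<le> H b" unfolding H_def by (rule cInf_greatest[OF ne]) (use r(2) BA in auto)
    then show ?thesis using r(1) by simp
  qed
  have "\<exists>c. c \<in> B \<and> c \<noteq> b \<and> mdist M b c \<le> 2 * H b" if "b \<in> B" for b
  proof -
    have "Inf (mdist M b ` (B - {b})) < 2 * H b" using H_pos[OF that] by (simp add: H_def)
    then obtain t where "t \<in> mdist M b ` (B - {b})" "t < 2 * H b" using cInf_lessD[OF ne] by blast
    then show ?thesis by auto
  qed
  then obtain n where n: "\<And>b. b \<in> B \<Longrightarrow> n b \<in> B \<and> n b \<noteq> b \<and> mdist M b (n b) \<le> 2 * H b" by metis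
  obtain I where I: "I \<subseteq> B" "pairwise (\<lambda>a b. n a \<noteq> b) I"
    "\<And>b. b \<in> B \<Longrightarrow> b \<notin> I \<Longrightarrow> \<exists>c\<in>I. \<not> (n b \<noteq> c \<and> n c \<noteq> b)"
    using maximal_pairwise_subset[of B "\<lambda>a b. n a \<noteq> b"] by blast
  define T where "T = {b \<in> B - I. n b \<in> I}"
  have cover: "B \<subseteq> (I \<union> T) \<union> n ` I" using I(3) unfolding T_def by auto
  have I_ind: "n a \<notin> I" if "a \<in> I" for a
    using I(2) that n[of a] I(1) unfolding pairwise_def by (metis subsetD)
  have T_ind: "n a \<notin> T" if "a \<in> T" for a using that unfolding T_def by blast
  have "\<not> ( |I| <o |B| \<and> |T| <o |B| )"
  proof
    assume *: "|I| <o |B| \<and> |T| <o |B|"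
    then have "|n ` I| <o |B|" using card_of_image ordLeq_ordLess_trans by blast
    moreover have "|I \<union> T| <o |B|" using card_of_Un_ordLess_infinite[OF B_inf] * by blast
    ultimately have "|(I \<union> T) \<union> n ` I| <o |B|" using card_of_Un_ordLess_infinite[OF B_inf] by blast
    moreover have "|B| \<le>o |(I \<union> T) \<union> n ` I|" by (rule card_of_mono1[OF cover])
    ultimately show False using not_ordLess_ordLeq by blast
  qed
  then have "|B| \<le>o |I| \<or> |B| \<le>o |T|"
    by (auto simp: not_ordLess_iff_ordLeq[OF card_of_Well_order card_of_Well_order])
  then obtain X where X: "X \<subseteq> B" "|B| \<le>o |X|" "\<And>a. a \<in> X \<Longrightarrow> n a \<notin> X"
  proof
    assume "|B| \<le>o |I|" then show ?thesis using that[of I] I(1) I_ind by blast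
  next
    assume "|B| \<le>o |T|" then show ?thesis using that[of T] T_ind unfolding T_def by blast
  qed
  have "|X| =o |B|" using X(1,2) card_of_mono1 ordIso_iff_ordLeq by blast
  then have "|K| =o |X|"
    using K D0(2) \<open>|D0| =o |B|\<close> ordIso_transitive ordIso_symmetric by metis
  then obtain x where x: "bij_betw x K X" unfolding card_of_ordIso[symmetric] by blast
  have xX: "x k \<in> X" if "k \<in> K" for k using x that by (rule bij_betw_apply)
  have xB: "x k \<in> B" if "k \<in> K" for k using xX[OF that] X(1) by blast
  have "infinite K"
    using \<open>|K| =o |X|\<close> \<open>|X| =o |B|\<close> B_inf by (metis card_of_ordIso_finite)
  show ?thesis
  proof (rule that[of x "\<lambda>k. n (x k)" "\<lambda>k. H (x k)"])
    show "x k \<in> mspace M" if "k \<in> K" for k using xB[OF that] BM by blast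
    show "n (x k) \<in> mspace M" if "k \<in> K" for k using n[OF xB[OF that]] BM by blast
    show "0 < H (x k)" if "k \<in> K" for k by (rule H_pos[OF xB[OF that]])
    show "mdist M (x k) (n (x k)) \<le> 2 * H (x k)" if "k \<in> K" for k using n[OF xB[OF that]] by blast
    show "H (x j) \<le> mdist M (x j) (x k)" if "j \<in> K" "k \<in> K" "j \<noteq> k" for j k
    proof (rule H_le[OF xB[OF that(2)]])
      show "x k \<noteq> x j" using bij_betw_imp_inj_on[OF x] that by (metis inj_onD)
    qed
    show "H (x j) \<le> mdist M (x j) (n (x k))" if "j \<in> K" "k \<in> K" for j k
    proof (rule H_le)
      show "n (x k) \<in> B" using n[OF xB[OF that(2)]] by blast
      show "n (x k) \<noteq> x j" using X(3)[OF xX[OF that(2)]] xX[OF that(1)] by metis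
    qed
  qed (rule \<open>infinite K\<close>)
qed

section \<open>Small dense subsets of spans\<close>

text \<open>The linear combinations with rational coefficients are built up one summand at a time, so
  that their number is bounded by products and countable unions.\<close>

lemma small_dense_subset_of_span:
  fixes B :: "'x::real_normed_vector set" and K :: "'k set"
  assumes K: "infinite K" and B: "|B| \<le>o |K|"
  obtains Z where "Z \<subseteq> span B" "|Z| \<le>o |K|" "span B \<subseteq> closure Z"
proof -
  define Z where "Z = rec_nat {0} (\<lambda>n Y. (\<lambda>((z, r), b). z + of_rat r *\<^sub>R b) ` ((Y \<times> (UNIV :: rat set)) \<times> B))"
  have Z0: "Z 0 = {0}" and ZS: "Z (Suc n) = (\<lambda>((z, r), b). z + of_rat r *\<^sub>R b) ` ((Z n \<times> (UNIV :: rat set)) \<times> B)" for n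
    by (simp_all add: Z_def)
  have nat_le: "|UNIV :: nat set| \<le>o |K|" using K infinite_iff_card_of_nat by blast
  have "|UNIV :: rat set| \<le>o |UNIV :: nat set|"
    by (rule card_of_ordLeqI[of to_nat]) auto
  then have rat_le: "|UNIV :: rat set| \<le>o |K|" using nat_le ordLeq_transitive by blast
  have Z_card: "|Z n| \<le>o |K|" for n
  proof (induction n)
    case 0
    have "K \<noteq> {}" using K by auto
    then show ?case unfolding Z0 by (rule card_of_singl_ordLeq)
  next
    case (Suc n)
    have "|(Z n \<times> (UNIV :: rat set)) \<times> B| \<le>o |K|"
      using K Suc rat_le B by (intro card_of_Times_ordLeq_infinite_Field) (simp_all add: Field_card_of card_of_card_order_on)
    then show ?case unfolding ZS using card_of_image ordLeq_transitive by blast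
  qed
  show ?thesis
  proof (rule that[of "\<Union>n. Z n"])
    show "|\<Union>n. Z n| \<le>o |K|" using card_of_UNION_ordLeq_infinite[OF K nat_le] Z_card by blast
    have "Z n \<subseteq> span B" for n
    proof (induction n)
      case 0 then show ?case by (simp add: Z0 span_zero)
    next
      case (Suc n)
      show ?case
      proof
        fix v assume "v \<in> Z (Suc n)"
        then obtain z r b where v: "z \<in> Z n" "b \<in> B" "v = z + of_rat r *\<^sub>R b" unfolding ZS by auto
        then have "z \<in> span B" using Suc by blast
        then show "v \<in> span B" unfolding v(3) by (rule span_add[OF _ span_scale[OF span_base[OF v(2)]]])
      qed
    qed
    then show "(\<Union>n. Z n) \<subseteq> span B" by blast
    show "span B \<subseteq> closure (\<Union>n. Z n)"
    proof
      fix v assume "v \<in> span B"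
      then show "v \<in> closure (\<Union>n. Z n)"
      proof (induction rule: span_induct_alt)
        case base
        have "0 \<in> (\<Union>n. Z n)" using Z0 by blast
        then show ?case by (rule subsetD[OF closure_subset])
      next
        case (step c b v)
        show ?case
          unfolding closure_approachable
        proof (intro allI impI)
          fix e :: real assume "e > 0"
          then have "0 < e / 2" by simp
          from step.IH[unfolded closure_approachable, rule_format, OF this]
          obtain w where w: "w \<in> (\<Union>n. Z n)" "dist w v < e / 2" by (elim bexE)
          then obtain n where n: "w \<in> Z n" by blast
          have "0 < e / (2 * (norm b + 1))"
            using \<open>e > 0\<close> by (intro divide_pos_pos mult_pos_pos add_nonneg_pos) auto
          then obtain q where "c - e / (2 * (norm b + 1)) < of_rat q" "of_rat q < c + e / (2 * (norm b + 1))"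
            using of_rat_dense[of "c - e / (2 * (norm b + 1))" "c + e / (2 * (norm b + 1))"] by auto
          then have "\<bar>of_rat q - c\<bar> \<le> e / (2 * (norm b + 1))" by linarith
          from mult_right_mono[OF this, of "norm b"]
          have "\<bar>of_rat q - c\<bar> * norm b \<le> e / (2 * (norm b + 1)) * norm b" by simp
          also have "\<dots> \<le> e / (2 * (norm b + 1)) * (norm b + 1)"
            using \<open>0 < e / (2 * (norm b + 1))\<close> by (intro mult_left_mono) auto
          also have "\<dots> = e / 2" using norm_ge_zero[of b] by (simp add: field_simps add_nonneg_eq_0_iff)
          finally have q: "norm ((of_rat q - c) *\<^sub>R b) \<le> e / 2" by simp
          have "norm (w + of_rat q *\<^sub>R b - (c *\<^sub>R b + v)) = norm ((w - v) + (of_rat q - c) *\<^sub>R b)"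
            by (simp add: algebra_simps)
          also have "\<dots> < e" using norm_triangle_ineq[of "w - v" "(of_rat q - c) *\<^sub>R b"] q w(2) by (simp add: dist_norm)
          finally have "dist (w + of_rat q *\<^sub>R b) (c *\<^sub>R b + v) < e" by (simp add: dist_norm)
          moreover have "w + of_rat q *\<^sub>R b \<in> Z (Suc n)"
            unfolding ZS by (rule image_eqI[of _ _ "((w, q), b)"]) (use n step.hyps in auto)
          ultimately show "\<exists>y\<in>\<Union>n. Z n. dist y (c *\<^sub>R b + v) < e" by blast
        qed
      qed
    qed
  qed
qed

section \<open>Free spaces are homeomorphic to absolutely summable families\<close>

instance bcontfun :: (metric_space, banach) banach ..

text \<open>At two given points at most two of the functions are nonzero.\<close>

lemma lipschitz_bound_disjoint_sum:
  fixes \<beta> :: "'k \<Rightarrow> 'a \<Rightarrow> real"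
  assumes G: "finite G" and L: "0 \<le> L" and lip: "\<And>k. k \<in> G \<Longrightarrow> lipschitz_bound M L (\<beta> k)"
    and c: "\<And>k. k \<in> G \<Longrightarrow> \<bar>c k\<bar> \<le> 1"
    and disj: "\<And>j k w. j \<in> G \<Longrightarrow> k \<in> G \<Longrightarrow> w \<in> mspace M \<Longrightarrow> \<beta> j w \<noteq> 0 \<Longrightarrow> \<beta> k w \<noteq> 0 \<Longrightarrow> j = k"
  shows "lipschitz_bound M (2 * L) (\<lambda>w. \<Sum>k\<in>G. c k * \<beta> k w)"
  unfolding lipschitz_bound_def
proof (intro ballI)
  fix v w assume vw: "v \<in> mspace M" "w \<in> mspace M"
  let ?A = "\<lambda>w. {k \<in> G. \<beta> k w \<noteq> 0}"
  have card: "card (?A w) \<le> 1" if "w \<in> mspace M" for w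
  proof -
    have "card (?A w) \<le> Suc 0"
      by (subst card_le_Suc0_iff_eq) (use G disj[OF _ _ that] in auto)
    then show ?thesis by simp
  qed
  have "(\<Sum>k\<in>G. c k * \<beta> k v) - (\<Sum>k\<in>G. c k * \<beta> k w) = (\<Sum>k\<in>G. c k * (\<beta> k v - \<beta> k w))"
    by (simp add: sum_subtractf right_diff_distrib)
  also have "\<dots> = (\<Sum>k\<in>?A v \<union> ?A w. c k * (\<beta> k v - \<beta> k w))"
    by (rule sum.mono_neutral_right) (use G in auto)
  finally have "\<bar>(\<Sum>k\<in>G. c k * \<beta> k v) - (\<Sum>k\<in>G. c k * \<beta> k w)\<bar> \<le> (\<Sum>k\<in>?A v \<union> ?A w. \<bar>c k * (\<beta> k v - \<beta> k w)\<bar>)"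
    by (simp only: sum_abs)
  also have "\<dots> \<le> (\<Sum>k\<in>?A v \<union> ?A w. L * mdist M v w)"
  proof (rule sum_mono)
    fix k assume "k \<in> ?A v \<union> ?A w"
    then have k: "k \<in> G" by auto
    have "\<bar>c k\<bar> * \<bar>\<beta> k v - \<beta> k w\<bar> \<le> 1 * (L * mdist M v w)"
      by (rule mult_mono[OF c[OF k] lipschitz_boundD[OF lip[OF k] vw]]) auto
    then show "\<bar>c k * (\<beta> k v - \<beta> k w)\<bar> \<le> L * mdist M v w" by (simp add: abs_mult)
  qed
  also have "\<dots> = card (?A v \<union> ?A w) * (L * mdist M v w)" by simp
  also have "\<dots> \<le> 2 * (L * mdist M v w)"
  proof (rule mult_right_mono)
    have "card (?A v \<union> ?A w) \<le> 2" using card_Un_le[of "?A v" "?A w"] card[OF vw(1)] card[OF vw(2)] by linarith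
    then show "real (card (?A v \<union> ?A w)) \<le> 2" by linarith
  qed (use L in simp)
  finally show "\<bar>(\<Sum>k\<in>G. c k * \<beta> k v) - (\<Sum>k\<in>G. c k * \<beta> k w)\<bar> \<le> 2 * L * mdist M v w" by simp
qed

lemma Lip0_dual_sum_arg:
  assumes "\<mu> \<in> Lip0_dual M e" "finite G" "\<And>k. k \<in> G \<Longrightarrow> f k \<in> Lip0 M e"
  shows "(\<lambda>x. \<Sum>k\<in>G. c k * f k x) \<in> Lip0 M e \<and> \<mu> (\<lambda>x. \<Sum>k\<in>G. c k * f k x) = (\<Sum>k\<in>G. c k * \<mu> (f k))"
  using assms(2,3)
proof (induction rule: finite_induct)
  case empty
  have "\<mu> (\<lambda>x. 0 * 0) = 0 * \<mu> (\<lambda>x. 0)" by (rule bdualD(3)[OF assms(1) Lip0_0])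
  then show ?case by (simp add: Lip0_0)
next
  case (insert j G)
  have j: "f j \<in> Lip0 M e" and IH: "(\<lambda>x. \<Sum>k\<in>G. c k * f k x) \<in> Lip0 M e"
    "\<mu> (\<lambda>x. \<Sum>k\<in>G. c k * f k x) = (\<Sum>k\<in>G. c k * \<mu> (f k))"
    using insert by auto
  have "\<mu> (\<lambda>x. c j * f j x + (\<Sum>k\<in>G. c k * f k x)) = c j * \<mu> (f j) + (\<Sum>k\<in>G. c k * \<mu> (f k))"
    using bdualD(2)[OF assms(1) Lip0_scale[OF j] IH(1)] bdualD(3)[OF assms(1) j] IH(2) by simp
  then show ?case using insert.hyps Lip0_add[OF Lip0_scale[OF j] IH(1)] by simp
qed

lemma lipschitz_bound_bump:
  assumes "x \<in> mspace M" shows "lipschitz_bound M 1 (\<lambda>w. max 0 (r - mdist M x w))"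
  unfolding lipschitz_bound_def
proof (intro ballI)
  fix v w assume "v \<in> mspace M" "w \<in> mspace M"
  then have "mdist M x v \<le> mdist M x w + mdist M v w" "mdist M x w \<le> mdist M x v + mdist M v w"
    using mdist_triangle[of x M w v] mdist_triangle[of x M v w] assms by (simp_all add: mdist_commute[of M w v])
  then show "\<bar>max 0 (r - mdist M x v) - max 0 (r - mdist M x w)\<bar> \<le> 1 * mdist M v w" by linarith
qed

lemma free_image_subset_closure_dense:
  assumes e: "e \<in> mspace M" and D: "is_dense M D"
  shows "free_image M e \<subseteq> closure (span (point M e ` D))"
proof -
  have DM: "D \<subseteq> mspace M" using D by (simp add: is_dense_def)
  have "point M e x \<in> closure (span (point M e ` D))" if x: "x \<in> mspace M" for x
    unfolding closure_approachable
  proof (intro allI impI)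
    fix r :: real assume "r > 0"
    then obtain y where y: "y \<in> D" "mdist M x y < r"
      using D[unfolded is_dense_iff dense_within_def] x by meson
    have "norm (point M e x - point M e y) \<le> mdist M x y" by (rule norm_point_diff[OF e x]) (use y DM in blast)
    then have "dist (point M e y) (point M e x) < r" using y(2) by (simp add: dist_norm norm_minus_commute)
    then show "\<exists>w\<in>span (point M e ` D). dist w (point M e x) < r"
      using span_base[OF imageI[OF y(1), of "point M e"]] by (intro bexI)
  qed
  then have "span (point M e ` mspace M) \<subseteq> closure (span (point M e ` D))"
    by (rule span_minimal[OF image_subsetI subspace_closure[OF subspace_span]])
  then show ?thesis unfolding free_image_def by (rule closure_minimal) simp
qed

text \<open>The pairs \<open>x k\<close>, \<open>y k\<close> of \<open>separated_pairs\<close> give the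
  biorthogonal system that \<open>homeomorphic_ell1_on\<close> asks for: \<open>g k\<close>
  evaluates at a bump of height \<open>h k / 2\<close> around \<open>x k\<close>, and \<open>u
  k\<close> is the difference of the evaluations at \<open>x k\<close> and \<open>y k\<close>,
  scaled by \<open>2 / h k\<close>. Its norm is bounded since \<open>y k\<close> is no farther
  from \<open>x k\<close> than \<open>2 * h k\<close>. The bumps have disjoint supports, so
  every combination of them with coefficients of modulus at most \<open>1\<close> is Lipschitz
  with constant \<open>2\<close>, and this bounds the sums of the \<open>|g k v|\<close>.\<close>

theorem free_image_homeomorphic_ell1:
  fixes M :: "'a metric" and K :: "'k set"
  assumes inf: "infinite (mspace M)" and e: "e \<in> mspace M" and K: "|K| =o metric_density M"
  shows "free_image M e homeomorphic ell1_on K"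
proof -
  obtain x y :: "'k \<Rightarrow> 'a" and h :: "'k \<Rightarrow> real" where
    x: "\<And>k. k \<in> K \<Longrightarrow> x k \<in> mspace M" and y: "\<And>k. k \<in> K \<Longrightarrow> y k \<in> mspace M" and h: "\<And>k. k \<in> K \<Longrightarrow> 0 < h k"
    and xy: "\<And>k. k \<in> K \<Longrightarrow> mdist M (x k) (y k) \<le> 2 * h k"
    and xx: "\<And>j k. j \<in> K \<Longrightarrow> k \<in> K \<Longrightarrow> j \<noteq> k \<Longrightarrow> h j \<le> mdist M (x j) (x k)"
    and xy': "\<And>j k. j \<in> K \<Longrightarrow> k \<in> K \<Longrightarrow> h j \<le> mdist M (x j) (y k)" and K_inf: "infinite K"
    by (rule separated_pairs[OF inf K]) (rule that)
  let ?F = "free_image M e"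
  note F = free_image_subspace[of M e]
  obtain D where D: "is_dense M D" "metric_density M = |D|"
    by (rule metric_density_minimal[of M]) (rule that)
  have "|point M e ` D| \<le>o |K|"
    using card_of_image[of "point M e" D] K D(2) by (metis ordIso_symmetric ordLeq_ordIso_trans)
  then obtain Z where Z: "Z \<subseteq> span (point M e ` D)" "|Z| \<le>o |K|" "span (point M e ` D) \<subseteq> closure Z"
    using small_dense_subset_of_span[OF K_inf] by metis
  have FZ: "?F \<subseteq> closure Z"
    using free_image_subset_closure_dense[OF e D(1)] closure_minimal[OF Z(3) closed_closure] by (rule subset_trans)
  have DM: "D \<subseteq> mspace M" using D(1) by (simp add: is_dense_def)
  have ZF: "Z \<subseteq> ?F"
    using Z(1) span_mono[OF image_mono[OF DM, of "point M e"]] closure_subset unfolding free_image_def by (meson subset_trans)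
  have "0 \<in> closure Z" using FZ subspace_0[OF F(1)] by auto
  then have "Z \<noteq> {}" by auto
  then obtain \<zeta> where \<zeta>: "\<zeta> ` K = Z" using Z(2) card_of_ordLeq2 by metis
  define z where "z k = (if k \<in> K then sgn (\<zeta> k) else 0)" for k
  define u where "u k = (if k \<in> K then (2 / h k) *\<^sub>R (point M e (x k) - point M e (y k)) else 0)" for k
  define \<beta> where "\<beta> k w = max 0 (h k / 2 - mdist M (x k) w)" for k w
  define b where "b k = based_at M e (\<beta> k)" for k
  define g where "g k v = (if k \<in> K then ev M (b k) v else 0)" for k v
  have \<beta>_lip: "lipschitz_bound M 1 (\<beta> k)" if "k \<in> K" for k
    unfolding \<beta>_def by (rule lipschitz_bound_bump[OF x[OF that]])
  have b_Lip0: "b k \<in> Lip0 M e" if "k \<in> K" for k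
    unfolding b_def by (rule based_at_Lip0(1)[OF \<beta>_lip[OF that] e])
  have \<beta>_disj: "j = k" if "j \<in> K" "k \<in> K" "w \<in> mspace M" "\<beta> j w \<noteq> 0" "\<beta> k w \<noteq> 0" for j k w
  proof (rule ccontr)
    assume "j \<noteq> k"
    have "mdist M (x j) w < h j / 2" "mdist M (x k) w < h k / 2"
      using that(4,5) by (auto simp: \<beta>_def max_def split: if_splits)
    moreover have "mdist M (x j) (x k) \<le> mdist M (x j) w + mdist M (x k) w"
      using mdist_triangle[OF x[OF that(1)] that(3) x[OF that(2)]] by (simp add: mdist_commute[of M w])
    moreover have "h j \<le> mdist M (x j) (x k)" "h k \<le> mdist M (x j) (x k)"
      using xx[OF that(1,2) \<open>j \<noteq> k\<close>] xx[OF that(2,1)] \<open>j \<noteq> k\<close> by (auto simp: mdist_commute[of M "x k"])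
    ultimately show False by linarith
  qed
  show ?thesis
  proof (rule homeomorphic_ell1_on[where z = z and u = u and g = g and C = 4 and C' = 2, OF K_inf F])
    show "z k \<in> ?F" for k
      using ZF \<zeta> subspace_scale[OF F(1)] subspace_0[OF F(1)] by (auto simp: z_def sgn_div_norm)
    show "norm (z k) \<le> 1" for k by (simp add: z_def norm_sgn)
    show "\<exists>k\<in>K. \<exists>t. \<bar>t\<bar> \<le> 2 \<and> norm (v - t *\<^sub>R z k) \<le> 1 / 2" if v: "v \<in> ?F" "norm v = 1" for v
    proof -
      have "v \<in> closure Z" using FZ v(1) by (rule subsetD)
      then have "\<exists>w\<in>Z. dist w v < 1 / 2"
        unfolding closure_approachable by (elim allE[of _ "1 / 2"]) simp
      then obtain w where w: "w \<in> Z" "norm (w - v) < 1 / 2" unfolding dist_norm by (elim bexE)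
      obtain k where k: "k \<in> K" "\<zeta> k = w" using w(1) \<zeta> by auto
      have "norm w \<le> 2" using norm_triangle_ineq2[of w v] w(2) v(2) by linarith
      moreover have "norm w *\<^sub>R z k = w"
        using k by (cases "w = 0") (simp_all add: z_def sgn_div_norm)
      ultimately show ?thesis using w(2) k(1) by (intro bexI[of _ k] exI[of _ "norm w"]) (auto simp: norm_minus_commute)
    qed
    show "u k \<in> ?F" for k
      using subspace_scale[OF F(1) subspace_diff[OF F(1) point_in_free_image point_in_free_image]] x y subspace_0[OF F(1)]
      by (simp add: u_def)
    show "norm (u k) \<le> 4" for k
    proof (cases "k \<in> K")
      case True
      have "norm (point M e (x k) - point M e (y k)) \<le> 2 * h k"
        using norm_point_diff[OF e x[OF True] y[OF True]] xy[OF True] by linarith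
      from mult_left_mono[OF this, of "2 / h k"] show ?thesis using True h[OF True] by (simp add: u_def)
    qed (simp add: u_def)
    show "bounded_linear (g k)" for k
      by (cases "k \<in> K") (simp_all add: g_def[abs_def] bounded_linear_ev)
    show "g k v = 0" if "k \<notin> K" for k v using that by (simp add: g_def)
    show "g j (u k) = (if j = k then 1 else 0)" if j: "j \<in> K" and k: "k \<in> K" for j k
    proof -
      note l = bounded_linear.linear[OF bounded_linear_ev[of M "b j"]]
      have "g j (u k) = (2 / h k) * (b j (x k) - b j (y k))"
        using j k by (simp add: g_def u_def linear_cmul[OF l] linear_diff[OF l] ev_point[OF e] x y b_Lip0)
      also have "\<dots> = (2 / h k) * (\<beta> j (x k) - \<beta> j (y k))" using x[OF k] y[OF k] by (simp add: b_def based_at_def)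
      also have "\<beta> j (y k) = 0" using xy'[OF j k] h[OF j] by (simp add: \<beta>_def)
      also have "\<beta> j (x k) = (if j = k then h k / 2 else 0)"
      proof (cases "j = k")
        case True
        then show ?thesis using h[OF k] x[OF k] by (simp add: \<beta>_def max_def)
      next
        case False
        then show ?thesis using xx[OF j k False] h[OF j] by (simp add: \<beta>_def max_def)
      qed
      finally show ?thesis using h[OF k] by simp
    qed
    show "(\<Sum>k\<in>G. \<bar>g k v\<bar>) \<le> 2 * norm v" if G: "finite G" and v: "v \<in> ?F" for G v
    proof -
      obtain \<mu> where \<mu>: "\<mu> \<in> Lip0_dual M e" "v = emb M e \<mu>"
        using v emb_free_space[OF e] by (metis (no_types, lifting) imageE mem_Collect_eq)
      let ?G = "G \<inter> K"
      have fin: "finite ?G" using G by simp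
      define c where "c k = sgn (\<mu> (b k))" for k
      have bG: "b k \<in> Lip0 M e" if "k \<in> ?G" for k using b_Lip0 that by simp
      have gk: "g k v = (if k \<in> K then \<mu> (b k) else 0)" for k
        using ev_emb[OF \<mu>(1) b_Lip0] by (simp add: g_def \<mu>(2))
      define f where "f = based_at M e (\<lambda>w. \<Sum>k\<in>?G. c k * \<beta> k w)"
      have f_eq: "f = (\<lambda>w. \<Sum>k\<in>?G. c k * b k w)"
        by (rule ext) (simp add: f_def b_def based_at_def sum_subtractf right_diff_distrib)
      have f: "f \<in> Lip0 M e" "lip_norm M f \<le> 2"
      proof -
        have "lipschitz_bound M (2 * 1) (\<lambda>w. \<Sum>k\<in>?G. c k * \<beta> k w)"
        proof (rule lipschitz_bound_disjoint_sum[OF fin])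
          show "lipschitz_bound M 1 (\<beta> k)" if "k \<in> ?G" for k using that \<beta>_lip by simp
          show "\<bar>c k\<bar> \<le> 1" for k by (simp add: c_def abs_sgn_eq)
          show "j = k" if "j \<in> ?G" "k \<in> ?G" "w \<in> mspace M" "\<beta> j w \<noteq> 0" "\<beta> k w \<noteq> 0" for j k w
            using \<beta>_disj[OF _ _ that(3,4,5)] that(1,2) by simp
        qed simp
        from based_at_Lip0[OF this e] show "f \<in> Lip0 M e" "lip_norm M f \<le> 2" by (simp_all add: f_def)
      qed
      have "(\<Sum>k\<in>G. \<bar>g k v\<bar>) = (\<Sum>k\<in>?G. \<bar>\<mu> (b k)\<bar>)"
        unfolding gk by (rule sum.mono_neutral_cong_right[OF G]) auto
      also have "\<dots> = (\<Sum>k\<in>?G. c k * \<mu> (b k))"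
        by (intro sum.cong refl) (simp add: c_def abs_sgn mult.commute)
      also have "\<dots> = \<mu> f" using Lip0_dual_sum_arg[OF \<mu>(1) fin bG, where c = c] by (simp add: f_eq)
      also have "\<dots> \<le> free_norm M e \<mu> * lip_norm M f" using le_free_norm[OF \<mu>(1) f(1)] by simp
      also have "\<dots> \<le> free_norm M e \<mu> * 2"
        using norm_ge_zero[of v] norm_emb[OF \<mu>(1)] by (intro mult_left_mono f(2)) (simp add: \<mu>(2))
      finally show ?thesis using norm_emb[OF \<mu>(1)] \<mu>(2) by simp
    qed
  qed
qed

section \<open>Relative distances and multipliers\<close>

text \<open>Measuring distances to \<open>E\<close> in proportion to the distance from the base point
  makes truncation work on unbounded spaces: a function in \<^const>\<open>Lip0\<close> is as
  large as the distance to \<open>e\<close>, and this is exactly compensated in products with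
  functions of the relative distance. At \<open>e\<close> itself the value is \<open>0\<close>
  by the convention on division.\<close>

definition relative_distance :: "'a metric \<Rightarrow> 'a \<Rightarrow> 'a set \<Rightarrow> 'a \<Rightarrow> real" where
  "relative_distance M e E x = Inf (mdist M x ` E) / mdist M x e"

lemma Inf_mdist:
  assumes "E \<subseteq> mspace M"
  shows "y \<in> E \<Longrightarrow> Inf (mdist M x ` E) \<le> mdist M x y"
    and "E \<noteq> {} \<Longrightarrow> 0 \<le> Inf (mdist M x ` E)"
    and "E \<noteq> {} \<Longrightarrow> finite E \<Longrightarrow> \<exists>y\<in>E. Inf (mdist M x ` E) = mdist M x y"
    and "E \<noteq> {} \<Longrightarrow> x \<in> mspace M \<Longrightarrow> w \<in> mspace M \<Longrightarrow> Inf (mdist M x ` E) \<le> Inf (mdist M w ` E) + mdist M x w"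
proof -
  have bdd: "bdd_below (mdist M v ` E)" for v by (rule bdd_belowI[of _ 0]) auto
  show 1: "Inf (mdist M x ` E) \<le> mdist M x y" if "y \<in> E" for y x
    by (rule cInf_lower[OF imageI[OF that] bdd])
  show "0 \<le> Inf (mdist M x ` E)" if "E \<noteq> {}" by (rule cInf_greatest) (use that in auto)
  show "\<exists>y\<in>E. Inf (mdist M x ` E) = mdist M x y" if "E \<noteq> {}" "finite E"
  proof -
    have "Inf (mdist M x ` E) = Min (mdist M x ` E)" using that by (intro cInf_eq_Min) auto
    moreover have "Min (mdist M x ` E) \<in> mdist M x ` E" using that by (intro Min_in) auto
    ultimately show ?thesis by auto
  qed
  show "Inf (mdist M x ` E) \<le> Inf (mdist M w ` E) + mdist M x w"
    if "E \<noteq> {}" "x \<in> mspace M" "w \<in> mspace M"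
  proof -
    have "Inf (mdist M x ` E) - mdist M x w \<le> Inf (mdist M w ` E)"
    proof (rule cInf_greatest)
      fix t assume "t \<in> mdist M w ` E"
      then obtain y where y: "y \<in> E" "t = mdist M w y" by auto
      have "mdist M x y \<le> mdist M x w + mdist M w y" by (rule mdist_triangle) (use that y assms in auto)
      then show "Inf (mdist M x ` E) - mdist M x w \<le> t" using 1[OF y(1), of x] y(2) by linarith
    qed (use that in simp)
    then show ?thesis by linarith
  qed
qed

lemma relative_distance_0:
  assumes "E \<subseteq> mspace M" "x \<in> E" shows "relative_distance M e E x = 0"
proof -
  have "Inf (mdist M x ` E) = 0"
    using Inf_mdist(1)[OF assms(1) assms(2), of x] Inf_mdist(2)[OF assms(1), of x] assms by (auto intro!: antisym)
  then show ?thesis by (simp add: relative_distance_def)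
qed

lemma relative_distance_attained:
  assumes "E \<subseteq> mspace M" "finite E" "e \<in> E" "x \<in> mspace M" "x \<noteq> e"
  obtains y where "y \<in> E" "mdist M x y = relative_distance M e E x * mdist M x e"
proof -
  obtain y where "y \<in> E" "Inf (mdist M x ` E) = mdist M x y" using Inf_mdist(3)[OF assms(1) _ assms(2), of x] assms(3) by blast
  moreover have "0 < mdist M x e" using assms by (intro mdist_pos) auto
  ultimately show ?thesis using that[of y] by (simp add: relative_distance_def)
qed

text \<open>With \<open>a\<close>, \<open>b\<close> the distances of \<open>x\<close>, \<open>y\<close>
  to \<open>e\<close> and \<open>p\<close>, \<open>q\<close> their distances to
  \<open>E\<close>, the point is the estimate \<open>a \<bar>p / a - q / b\<bar> \<le> 2 d(x,
  y)\<close>, which holds because \<open>q \<le> b\<close>.\<close>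

lemma lipschitz_bound_multiplier:
  assumes E: "E \<subseteq> mspace M" "e \<in> E" and f: "lipschitz_bound M L f" "f e = 0" and L: "0 \<le> L"
    and \<theta>: "\<And>t. \<bar>\<theta> t\<bar> \<le> 1" "\<And>s t. \<bar>\<theta> s - \<theta> t\<bar> \<le> \<kappa> * \<bar>s - t\<bar>" and \<kappa>: "0 \<le> \<kappa>"
  shows "lipschitz_bound M (L * (1 + 2 * \<kappa>)) (\<lambda>x. f x * \<theta> (relative_distance M e E x))"
  unfolding lipschitz_bound_def
proof (intro ballI)
  fix x y assume xy: "x \<in> mspace M" "y \<in> mspace M"
  have e: "e \<in> mspace M" using E by blast
  let ?r = "relative_distance M e E"
  define a b p q d where "a = mdist M x e" and "b = mdist M y e" and "p = Inf (mdist M x ` E)" and "q = Inf (mdist M y ` E)"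
    and "d = mdist M x y"
  have ne: "E \<noteq> {}" using E by blast
  have pq: "\<bar>p - q\<bar> \<le> d" using Inf_mdist(4)[OF E(1) ne xy] Inf_mdist(4)[OF E(1) ne xy(2,1)]
    by (simp add: p_def q_def d_def mdist_commute[of M y x])
  have ab: "\<bar>a - b\<bar> \<le> d"
    using mdist_triangle[OF xy e] mdist_triangle[OF xy(2,1) e] by (simp add: a_def b_def d_def mdist_commute[of M y x])
  have pa: "0 \<le> p" "p \<le> a" and qb: "0 \<le> q" "q \<le> b" and d0: "0 \<le> d" and a0: "0 \<le> a" and b0: "0 \<le> b"
    using Inf_mdist(1)[OF E(1) E(2), of x] Inf_mdist(2)[OF E(1) ne, of x] Inf_mdist(1)[OF E(1) E(2), of y] Inf_mdist(2)[OF E(1) ne, of y]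
    by (simp_all add: a_def b_def p_def q_def d_def)
  have key: "a * \<bar>p / a - q / b\<bar> \<le> 2 * d"
  proof (cases "a = 0 \<or> b = 0")
    case True
    then show ?thesis
    proof
      assume "b = 0"
      then show ?thesis using pa ab d0 by (cases "a = 0") (auto simp: abs_mult)
    qed (use d0 in simp)
  next
    case False
    then have ab0: "0 < a" "0 < b" using a0 b0 by auto
    have "a * (p / a - q / b) = (p - q) + (q / b) * (b - a)" using ab0 by (simp add: field_simps)
    moreover have "\<bar>(q / b) * (b - a)\<bar> \<le> 1 * d"
      unfolding abs_mult by (rule mult_mono) (use qb ab0 ab in auto)
    ultimately have "\<bar>a * (p / a - q / b)\<bar> \<le> \<bar>p - q\<bar> + 1 * d"
      using order_trans[OF abs_triangle_ineq[of "p - q" "(q / b) * (b - a)"] add_left_mono]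
      by (simp only:)
    then have "\<bar>a * (p / a - q / b)\<bar> \<le> 2 * d" using pq by linarith
    then show ?thesis using ab0 by (simp add: abs_mult)
  qed
  have fx: "\<bar>f x\<bar> \<le> L * a" using lipschitz_boundD[OF f(1) xy(1) e] f(2) by (simp add: a_def)
  have "\<bar>f x\<bar> * \<bar>\<theta> (?r x) - \<theta> (?r y)\<bar> \<le> (L * a) * (\<kappa> * \<bar>?r x - ?r y\<bar>)"
    by (rule mult_mono[OF fx \<theta>(2)]) (use L a0 in auto)
  also have "\<dots> = (L * \<kappa>) * (a * \<bar>p / a - q / b\<bar>)"
    by (simp add: relative_distance_def a_def b_def p_def q_def)
  also have "\<dots> \<le> (L * \<kappa>) * (2 * d)" using L \<kappa> by (intro mult_left_mono key) auto
  finally have 1: "\<bar>f x * (\<theta> (?r x) - \<theta> (?r y))\<bar> \<le> (L * \<kappa>) * (2 * d)" by (simp add: abs_mult)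
  have "\<bar>f x - f y\<bar> * \<bar>\<theta> (?r y)\<bar> \<le> (L * d) * 1"
    by (rule mult_mono) (use lipschitz_boundD[OF f(1) xy] \<theta>(1) L d0 in \<open>auto simp: d_def\<close>)
  then have 2: "\<bar>(f x - f y) * \<theta> (?r y)\<bar> \<le> L * d" by (simp add: abs_mult)
  have "f x * \<theta> (?r x) - f y * \<theta> (?r y) = (f x - f y) * \<theta> (?r y) + f x * (\<theta> (?r x) - \<theta> (?r y))"
    by (simp add: algebra_simps)
  then have "\<bar>f x * \<theta> (?r x) - f y * \<theta> (?r y)\<bar> \<le> L * d + (L * \<kappa>) * (2 * d)" using 1 2 by linarith
  then show "\<bar>f x * \<theta> (?r x) - f y * \<theta> (?r y)\<bar> \<le> L * (1 + 2 * \<kappa>) * mdist M x y"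
    by (simp add: d_def algebra_simps)
qed

definition cutoff :: "real \<Rightarrow> real \<Rightarrow> real" where
  "cutoff a t = max 0 (min 1 (a - t))"

lemma cutoff_props:
  "\<bar>cutoff a t\<bar> \<le> 1" "\<bar>1 - cutoff a t\<bar> \<le> 1" "\<bar>cutoff a s - cutoff a t\<bar> \<le> \<bar>s - t\<bar>" "t \<le> a - 1 \<Longrightarrow> cutoff a t = 1" "a \<le> t \<Longrightarrow> cutoff a t = 0"
  unfolding cutoff_def by (auto simp: max_def min_def)

lemma cutoff_scaled:
  assumes "0 < \<delta>" shows "\<bar>cutoff a (s / \<delta>) - cutoff a (t / \<delta>)\<bar> \<le> (1 / \<delta>) * \<bar>s - t\<bar>"
proof -
  have "\<bar>s / \<delta> - t / \<delta>\<bar> = (1 / \<delta>) * \<bar>s - t\<bar>" using assms by (simp add: abs_mult flip: diff_divide_distrib)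
  then show ?thesis using cutoff_props(3)[of a "s / \<delta>" "t / \<delta>"] by simp
qed

lemma Lip0_multiplier:
  assumes E: "E \<subseteq> mspace M" "e \<in> E" and f: "f \<in> Lip0 M e" "lipschitz_bound M L f" and L: "0 \<le> L"
    and \<theta>: "\<And>t. \<bar>\<theta> t\<bar> \<le> 1" "\<And>s t. \<bar>\<theta> s - \<theta> t\<bar> \<le> \<kappa> * \<bar>s - t\<bar>" and \<kappa>: "0 \<le> \<kappa>"
  shows "(\<lambda>x. f x * \<theta> (relative_distance M e E x)) \<in> Lip0 M e"
    "lipschitz_bound M (L * (1 + 2 * \<kappa>)) (\<lambda>x. f x * \<theta> (relative_distance M e E x))"
proof -
  have f0: "f e = 0" "\<And>x. x \<notin> mspace M \<Longrightarrow> f x = 0" using f(1) by (auto simp: Lip0_iff)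
  show l: "lipschitz_bound M (L * (1 + 2 * \<kappa>)) (\<lambda>x. f x * \<theta> (relative_distance M e E x))"
    by (rule lipschitz_bound_multiplier[OF E f(2) f0(1) L \<theta> \<kappa>])
  then show "(\<lambda>x. f x * \<theta> (relative_distance M e E x)) \<in> Lip0 M e" unfolding Lip0_iff using f0 by auto
qed

section \<open>Weakly null sequences over complete discrete spaces\<close>

text \<open>A gliding hump. If the claim fails, there are, for larger and larger finite sets \<open>EN
  N\<close> that contain the supports of the first elements, functions \<open>\<phi> N\<close>
  vanishing near \<open>EN N\<close> on which some later element \<open>\<nu> N\<close> is
  large. Only the values on the support of that element matter, so \<open>\<phi> N\<close> can
  be cut off to a function \<open>g N\<close> supported close to it. For \<open>\<nu> N <
  N'\<close> the supports of \<open>g N\<close> and \<open>g N'\<close> are disjoint. The sum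
  \<open>G\<close> of a sparse sequence of these functions is Lipschitz, and it contradicts
  weak convergence to \<open>0\<close>.\<close>

lemma weakly_null_tight:
  fixes A :: "nat \<Rightarrow> 'a set" and c :: "nat \<Rightarrow> 'a \<Rightarrow> real"
  assumes e: "e \<in> mspace M" and A: "\<And>n. finite (A n)" "\<And>n. A n \<subseteq> mspace M"
    and null: "\<And>f. f \<in> Lip0 M e \<Longrightarrow> (\<lambda>n. \<Sum>x\<in>A n. c n x * f x) \<longlonglongrightarrow> 0"
    and \<delta>: "0 < \<delta>" "\<delta> \<le> 1" and \<epsilon>: "0 < \<epsilon>"
  shows "\<exists>E. finite E \<and> e \<in> E \<and> E \<subseteq> mspace M \<and>
    (\<forall>n. \<forall>f\<in>Lip0 M e. lipschitz_bound M 1 f \<longrightarrow> (\<forall>x\<in>mspace M. relative_distance M e E x \<le> \<delta> \<longrightarrow> f x = 0) \<longrightarrow>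
      (\<Sum>x\<in>A n. c n x * f x) \<le> \<epsilon>)"
proof (rule ccontr)
  assume contra: "\<not> ?thesis"
  define pair where "pair n f = (\<Sum>x\<in>A n. c n x * f x)" for n f
  let ?r = "relative_distance M e"
  define EN where "EN N = insert e (\<Union>m<N. A m)" for N
  have EN: "finite (EN N)" "e \<in> EN N" "EN N \<subseteq> mspace M" for N using A e by (auto simp: EN_def)
  have A_EN: "A m \<subseteq> EN N" if "m < N" for m N using that by (auto simp: EN_def)
  have "\<exists>n f. f \<in> Lip0 M e \<and> lipschitz_bound M 1 f \<and> (\<forall>x\<in>mspace M. ?r (EN N) x \<le> \<delta> \<longrightarrow> f x = 0) \<and> \<epsilon> < pair n f" for N
  proof (rule ccontr)
    assume "\<nexists>n f. f \<in> Lip0 M e \<and> lipschitz_bound M 1 f \<and> (\<forall>x\<in>mspace M. ?r (EN N) x \<le> \<delta> \<longrightarrow> f x = 0) \<and> \<epsilon> < pair n f"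
    then have "\<forall>n. \<forall>f\<in>Lip0 M e. lipschitz_bound M 1 f \<longrightarrow> (\<forall>x\<in>mspace M. ?r (EN N) x \<le> \<delta> \<longrightarrow> f x = 0) \<longrightarrow> pair n f \<le> \<epsilon>"
      by (meson not_less)
    then show False using contra EN[of N] unfolding pair_def by blast
  qed
  then obtain \<nu> \<phi> where \<phi>: "\<And>N. \<phi> N \<in> Lip0 M e" "\<And>N. lipschitz_bound M 1 (\<phi> N)"
    "\<And>N x. x \<in> mspace M \<Longrightarrow> ?r (EN N) x \<le> \<delta> \<Longrightarrow> \<phi> N x = 0" "\<And>N. \<epsilon> < pair (\<nu> N) (\<phi> N)"
    by metis
  have \<phi>_EN: "\<phi> N x = 0" if "x \<in> EN N" for N x
    using \<phi>(3)[of x N] relative_distance_0[OF EN(3) that, of e] EN(3) that \<delta> by auto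
  have \<nu>_ge: "N \<le> \<nu> N" for N
  proof (rule ccontr)
    assume "\<not> N \<le> \<nu> N"
    then have "pair (\<nu> N) (\<phi> N) = 0"
      unfolding pair_def using A_EN[of "\<nu> N" N] \<phi>_EN by (intro sum.neutral) auto
    then show False using \<phi>(4)[of N] \<epsilon> by simp
  qed
  define S where "S N = {x \<in> A (\<nu> N). \<delta> < ?r (EN N) x}" for N
  \<comment> \<open>The cutoff radius has to be small against \<open>\<delta>\<close> so that the supports
    of two humps stay apart.\<close>
  define \<eta> where "\<eta> = \<delta> / 4"
  have \<eta>: "0 < \<eta>" "\<eta> < 1" using \<delta> by (auto simp: \<eta>_def)
  define S' where "S' N = insert e (S N)" for N
  have S': "S' N \<subseteq> mspace M" "e \<in> S' N" "finite (S' N)" for N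
    using A[of "\<nu> N"] e by (auto simp: S_def S'_def)
  define g where "g N x = \<phi> N x * cutoff 1 (?r (S' N) x / \<eta>)" for N x
  define L where "L = 1 * (1 + 2 * (1 / \<eta>))"
  have g: "g N \<in> Lip0 M e" "lipschitz_bound M L (g N)" for N
    unfolding g_def[abs_def] L_def
    by (rule Lip0_multiplier[OF S'(1,2) \<phi>(1,2) zero_le_one cutoff_props(1) cutoff_scaled[OF \<eta>(1)]], use \<eta> in simp)+
  have g_EN: "g N x = 0" if "x \<in> EN N" for N x using \<phi>_EN[OF that] by (simp add: g_def)
  have pair_g: "pair (\<nu> N) (g N) = pair (\<nu> N) (\<phi> N)" for N
    unfolding pair_def
  proof (rule sum.cong[OF refl])
    fix x assume x: "x \<in> A (\<nu> N)"
    show "c (\<nu> N) x * g N x = c (\<nu> N) x * \<phi> N x"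
    proof (cases "x \<in> S N")
      case True
      then have "?r (S' N) x = 0" using relative_distance_0[OF S'(1), of x N e] by (simp add: S'_def)
      then show ?thesis by (simp add: g_def cutoff_props(4))
    next
      case False
      then have "\<phi> N x = 0" using x A(2)[of "\<nu> N"] by (intro \<phi>(3)) (auto simp: S_def)
      then show ?thesis by (simp add: g_def)
    qed
  qed
  have g_supp: "\<exists>y\<in>S N. mdist M x y < \<eta> * mdist M x e" if x: "x \<in> mspace M" "g N x \<noteq> 0" for N x
  proof -
    have xe: "x \<noteq> e" using x(2) g_EN[OF EN(2)] by blast
    obtain y where y: "y \<in> S' N" "mdist M x y = ?r (S' N) x * mdist M x e"
      by (rule relative_distance_attained[OF S'(1,3,2) x(1) xe])
    have pos: "0 < mdist M x e" by (rule mdist_pos[OF x(1) e xe])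
    have "?r (S' N) x < \<eta>"
    proof (rule ccontr)
      assume "\<not> ?r (S' N) x < \<eta>"
      then have "1 \<le> ?r (S' N) x / \<eta>" using \<eta> by simp
      then show False using x(2) by (simp add: g_def cutoff_props(5))
    qed
    then have less: "mdist M x y < \<eta> * mdist M x e" unfolding y(2) by (rule mult_strict_right_mono[OF _ pos])
    have "y \<noteq> e"
    proof
      assume "y = e"
      then have "1 * mdist M x e < \<eta> * mdist M x e" using less by simp
      then show False using \<eta>(2) pos by simp
    qed
    then show ?thesis using y(1) less by (auto simp: S'_def)
  qed
  have g_disj: False if N: "\<nu> N < N'" and x: "x \<in> mspace M" "g N x \<noteq> 0" "g N' x \<noteq> 0" for N N' x
  proof -
    obtain y where y: "y \<in> S N" "mdist M x y < \<eta> * mdist M x e" using g_supp[OF x(1,2)] by blast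
    obtain y' where y': "y' \<in> S N'" "mdist M x y' < \<eta> * mdist M x e" using g_supp[OF x(1,3)] by blast
    have yE: "y \<in> EN N'" using y(1) A_EN[OF N] by (auto simp: S_def)
    have yM: "y \<in> mspace M" "y' \<in> mspace M" using yE EN(3) y'(1) A(2)[of "\<nu> N'"] by (auto simp: S_def)
    have "y' \<noteq> e"
    proof
      assume "y' = e"
      then show False using y'(1) relative_distance_0[OF EN(3) EN(2), of e N'] \<delta> by (simp add: S_def)
    qed
    then obtain w where w: "w \<in> EN N'" "mdist M y' w = ?r (EN N') y' * mdist M y' e"
      using relative_distance_attained[OF EN(3,1,2) yM(2)] by metis
    have pos: "0 < mdist M y' e" using \<open>y' \<noteq> e\<close> by (intro mdist_pos yM e)
    have "Inf (mdist M y' ` EN N') \<le> mdist M y' y" by (rule Inf_mdist(1)[OF EN(3) yE])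
    moreover have "Inf (mdist M y' ` EN N') = ?r (EN N') y' * mdist M y' e" using pos by (simp add: relative_distance_def)
    moreover have "\<delta> * mdist M y' e < ?r (EN N') y' * mdist M y' e"
      using y'(1) pos by (intro mult_strict_right_mono) (auto simp: S_def)
    ultimately have 1: "\<delta> * mdist M y' e < mdist M y' y" by linarith
    have 2: "mdist M y' y \<le> mdist M x y' + mdist M x y"
      using mdist_triangle[OF yM(2) x(1) yM(1)] by (simp add: mdist_commute[of M y' x])
    have "mdist M x e \<le> mdist M x y' + mdist M y' e" by (rule mdist_triangle[OF x(1) yM(2) e])
    then have "(1 - \<eta>) * mdist M x e \<le> mdist M y' e" using y'(2) by (simp add: algebra_simps)
    then have "\<delta> * ((1 - \<eta>) * mdist M x e) \<le> \<delta> * mdist M y' e" using \<delta> by (intro mult_left_mono) auto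
    then have "\<delta> * ((1 - \<eta>) * mdist M x e) < 2 * (\<eta> * mdist M x e)" using 1 2 y(2) y'(2) by linarith
    then have 3: "(\<delta> * (1 - \<eta>) - 2 * \<eta>) * mdist M x e < 0" by (simp add: algebra_simps)
    have "\<delta> * (1 / 2) \<le> \<delta> * (1 - \<eta>)" using \<delta> by (intro mult_left_mono) (auto simp: \<eta>_def)
    then have "0 \<le> \<delta> * (1 - \<eta>) - 2 * \<eta>" by (simp add: \<eta>_def)
    then have "0 \<le> (\<delta> * (1 - \<eta>) - 2 * \<eta>) * mdist M x e" by (intro mult_nonneg_nonneg) auto
    then show False using 3 by linarith
  qed
  \<comment> \<open>Beyond \<open>H N\<close> the elements of the sequence hardly see the humps up to
    \<open>N\<close>; iterating \<open>H\<close> selects the sparse sequence.\<close>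
  have "\<exists>H>\<nu> N. \<forall>m\<ge>H. (\<Sum>P\<le>N. \<bar>pair m (g P)\<bar>) < \<epsilon> / 2" for N
  proof -
    have "(\<lambda>m. \<Sum>P\<le>N. \<bar>pair m (g P)\<bar>) \<longlonglongrightarrow> (\<Sum>P\<le>N. \<bar>0\<bar>)"
      unfolding pair_def by (intro tendsto_sum tendsto_rabs null g)
    then have "(\<lambda>m. \<Sum>P\<le>N. \<bar>pair m (g P)\<bar>) \<longlonglongrightarrow> 0" by simp
    from order_tendstoD(2)[OF this, of "\<epsilon> / 2"] \<epsilon>
    obtain H where "\<And>m. m \<ge> H \<Longrightarrow> (\<Sum>P\<le>N. \<bar>pair m (g P)\<bar>) < \<epsilon> / 2" by (auto simp: eventually_sequentially)
    then show ?thesis by (intro exI[of _ "max H (Suc (\<nu> N))"]) auto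
  qed
  then obtain H where H: "\<And>N. \<nu> N < H N" "\<And>N m. H N \<le> m \<Longrightarrow> (\<Sum>P\<le>N. \<bar>pair m (g P)\<bar>) < \<epsilon> / 2" by metis
  define s where "s k = (H ^^ k) 0" for k
  have s_Suc: "s (Suc k) = H (s k)" for k by (simp add: s_def)
  have s_step: "\<nu> (s k) < s (Suc k)" for k unfolding s_Suc by (rule H(1))
  have s_mono: "strict_mono s"
    unfolding strict_mono_Suc_iff using s_step \<nu>_ge le_less_trans by blast
  have s_less: "\<nu> (s i) < s j" if "i < j" for i j
  proof -
    have "s (Suc i) \<le> s j" using that strict_mono_less_eq[OF s_mono] by (metis Suc_leI)
    then show ?thesis using s_step[of i] by linarith
  qed
  have disj: "i = j" if "x \<in> mspace M" "g (s i) x \<noteq> 0" "g (s j) x \<noteq> 0" for i j x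
    using g_disj[OF s_less, of i j x] g_disj[OF s_less, of j i x] that by (metis linorder_neqE_nat)
  have g0: "g N x = 0" if "x \<notin> mspace M" for N x using g(1)[of N] that by (simp add: Lip0_iff)
  have "\<exists>m. \<forall>i\<ge>m. g (s i) x = 0" for x
  proof (cases "\<exists>i. g (s i) x \<noteq> 0")
    case True
    then obtain i where i: "g (s i) x \<noteq> 0" by blast
    then have "x \<in> mspace M" using g0 by blast
    then have "g (s j) x = 0" if "j \<ge> Suc i" for j using disj[OF _ i, of j] that by fastforce
    then show ?thesis by blast
  qed auto
  then obtain m where m: "\<And>x i. m x \<le> i \<Longrightarrow> g (s i) x = 0" by metis
  define G where "G x = (\<Sum>i<m x. g (s i) x)" for x
  have G_eq: "G x = (\<Sum>i<k. g (s i) x)" if "\<And>i. k \<le> i \<Longrightarrow> g (s i) x = 0" for x k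
  proof -
    have "(\<Sum>i<m x. g (s i) x) = (\<Sum>i<max k (m x). g (s i) x)"
      by (rule sum.mono_neutral_left) (use m in auto)
    also have "\<dots> = (\<Sum>i<k. g (s i) x)" by (rule sum.mono_neutral_right) (use that in auto)
    finally show ?thesis by (simp add: G_def)
  qed
  have L0: "0 \<le> L" using \<eta> by (simp add: L_def)
  have "lipschitz_bound M (2 * L) G"
    unfolding lipschitz_bound_def
  proof (intro ballI)
    fix v w assume vw: "v \<in> mspace M" "w \<in> mspace M"
    let ?k = "max (m v) (m w)"
    have "lipschitz_bound M (2 * L) (\<lambda>w. \<Sum>i<?k. 1 * g (s i) w)"
      by (rule lipschitz_bound_disjoint_sum[OF _ L0]) (use g disj in auto)
    from lipschitz_boundD[OF this vw] show "\<bar>G v - G w\<bar> \<le> 2 * L * mdist M v w"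
      using G_eq[of ?k v] G_eq[of ?k w] m by simp
  qed
  moreover have "G e = 0" using g_EN[OF EN(2)] by (simp add: G_def)
  moreover have "G x = 0" if "x \<notin> mspace M" for x using g0[OF that] by (simp add: G_def)
  ultimately have G: "G \<in> Lip0 M e" unfolding Lip0_iff by blast
  have lower: "\<epsilon> / 2 \<le> pair (\<nu> (s j)) G" for j
  proof -
    have "G x = (\<Sum>i<Suc j. g (s i) x)" if "x \<in> A (\<nu> (s j))" for x
    proof (rule G_eq)
      fix i assume "Suc j \<le> i"
      then have "x \<in> EN (s i)" using A_EN[OF s_less, of j i] that by auto
      then show "g (s i) x = 0" by (rule g_EN)
    qed
    then have "pair (\<nu> (s j)) G = (\<Sum>x\<in>A (\<nu> (s j)). \<Sum>i<Suc j. c (\<nu> (s j)) x * g (s i) x)"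
      unfolding pair_def by (intro sum.cong refl) (simp add: sum_distrib_left distrib_left)
    also have "\<dots> = (\<Sum>i<Suc j. pair (\<nu> (s j)) (g (s i)))" unfolding pair_def by (rule sum.swap)
    also have "\<dots> = (\<Sum>i<j. pair (\<nu> (s j)) (g (s i))) + pair (\<nu> (s j)) (g (s j))" by simp
    finally have eq: "pair (\<nu> (s j)) G = (\<Sum>i<j. pair (\<nu> (s j)) (g (s i))) + pair (\<nu> (s j)) (g (s j))" .
    have "\<bar>\<Sum>i<j. pair (\<nu> (s j)) (g (s i))\<bar> \<le> \<epsilon> / 2"
    proof (cases j)
      case (Suc i')
      have "\<bar>\<Sum>i<j. pair (\<nu> (s j)) (g (s i))\<bar> \<le> (\<Sum>i<j. \<bar>pair (\<nu> (s j)) (g (s i))\<bar>)" by (rule sum_abs)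
      also have "\<dots> = (\<Sum>P\<in>s ` {..<j}. \<bar>pair (\<nu> (s j)) (g P)\<bar>)"
        by (subst sum.reindex) (use strict_mono_imp_inj_on[OF s_mono] in \<open>auto intro: inj_on_subset\<close>)
      also have "\<dots> \<le> (\<Sum>P\<le>s i'. \<bar>pair (\<nu> (s j)) (g P)\<bar>)"
        by (rule sum_mono2) (use strict_mono_less_eq[OF s_mono] Suc in auto)
      also have "\<dots> < \<epsilon> / 2" using H(2)[of "s i'" "\<nu> (s j)"] \<nu>_ge[of "s j"] s_Suc[of i'] Suc by simp
      finally show ?thesis by simp
    qed (use \<epsilon> in simp)
    then show ?thesis using eq pair_g[of "s j"] \<phi>(4)[of "s j"] by linarith
  qed
  have "\<forall>\<^sub>F n in sequentially. pair n G < \<epsilon> / 2"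
    using order_tendstoD(2)[OF null[OF G], of "\<epsilon> / 2"] \<epsilon> by (simp add: pair_def)
  then obtain n0 where n0: "\<And>n. n \<ge> n0 \<Longrightarrow> pair n G < \<epsilon> / 2" by (auto simp: eventually_sequentially)
  have "n0 \<le> \<nu> (s n0)" using strict_mono_imp_increasing[OF s_mono, of n0] \<nu>_ge[of "s n0"] by linarith
  then show False using n0[of "\<nu> (s n0)"] lower[of n0] by linarith
qed

text \<open>The neighbourhood with index \<open>0\<close> is bounded, the later ones then have finite
  nets of small radius, so the intersection is totally bounded. In a complete space its
  closure is compact, and compact sets in a discrete topology are finite.\<close>

lemma finite_thin_neighbourhoods:
  assumes M: "complete_discrete M" and e: "e \<in> mspace M"
    and E: "\<And>k. finite (E k)" "\<And>k. e \<in> E k" "\<And>k. E k \<subseteq> mspace M"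
  shows "finite {x \<in> mspace M. \<forall>k. relative_distance M e (E k) x < (1 / 2) ^ Suc k}"
proof -
  let ?K = "{x \<in> mspace M. \<forall>k. relative_distance M e (E k) x < (1 / 2) ^ Suc k}"
  interpret Metric_space "mspace M" "mdist M" by simp
  have near: "\<exists>y\<in>E k. mdist M x y \<le> (1 / 2) ^ Suc k * mdist M x e" if x: "x \<in> ?K" for x k
  proof (cases "x = e")
    case True
    then show ?thesis using E(2)[of k] e by (intro bexI[of _ e]) auto
  next
    case False
    obtain y where y: "y \<in> E k" "mdist M x y = relative_distance M e (E k) x * mdist M x e"
      by (rule relative_distance_attained[OF E(3,1,2) _ False]) (use x in auto)
    have "relative_distance M e (E k) x \<le> (1 / 2) ^ Suc k" using x by (auto intro: less_imp_le)
    from mult_right_mono[OF this mdist_nonneg[of M x e]] show ?thesis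
      unfolding y(2)[symmetric] using y(1) by (rule bexI)
  qed
  define R where "R = Max ((\<lambda>y. mdist M y e) ` E 0)"
  have R: "mdist M y e \<le> R" if "y \<in> E 0" for y unfolding R_def using that E(1)[of 0] by (intro Max_ge) auto
  have R0: "0 \<le> R" using R[OF E(2)] mdist_nonneg[of M e e] by linarith
  have bound: "mdist M x e \<le> 2 * R" if x: "x \<in> ?K" for x
  proof -
    obtain y where y: "y \<in> E 0" "mdist M x y \<le> (1 / 2) ^ Suc 0 * mdist M x e" using near[OF x, of 0] by blast
    have "y \<in> mspace M" using y(1) E(3) by blast
    then have "mdist M x e \<le> mdist M x y + mdist M y e" using x e by (intro mdist_triangle) auto
    then show ?thesis using y(2) R[OF y(1)] by simp
  qed
  have "mtotally_bounded ?K"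
    unfolding mtotally_bounded_def
  proof (intro allI impI)
    fix r :: real assume r: "0 < r"
    then have "0 < r / (2 * (2 * R + 1))" using R0 by (intro divide_pos_pos) auto
    then obtain k where k: "(1 / 2 :: real) ^ k < r / (2 * (2 * R + 1))" using real_arch_pow_inv[of _ "1 / 2"] by auto
    have close: "\<exists>y\<in>E k. mdist M x y < r / 2" if x: "x \<in> ?K" for x
    proof -
      obtain y where y: "y \<in> E k" "mdist M x y \<le> (1 / 2) ^ Suc k * mdist M x e" using near[OF x, of k] by blast
      have "(1 / 2) ^ Suc k * mdist M x e \<le> (1 / 2) ^ k * (2 * R)"
        by (intro mult_mono bound[OF x]) (use R0 in \<open>auto simp: power_Suc_le_self\<close>)
      also have "\<dots> \<le> (1 / 2) ^ k * (2 * R + 1)" by (intro mult_left_mono) auto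
      also have "\<dots> < r / (2 * (2 * R + 1)) * (2 * R + 1)" using k R0 by (intro mult_strict_right_mono) auto
      also have "\<dots> = r / 2" using R0 by (simp add: field_simps)
      finally show ?thesis using y by (intro bexI[of _ y]) auto
    qed
    define p where "p y = (SOME x. x \<in> ?K \<and> mdist M x y < r / 2)" for y
    have p: "p y \<in> ?K \<and> mdist M (p y) y < r / 2" if "\<exists>x\<in>?K. mdist M x y < r / 2" for y
      unfolding p_def using that[unfolded Bex_def] by (rule someI_ex)
    let ?C = "p ` {y \<in> E k. \<exists>x\<in>?K. mdist M x y < r / 2}"
    have "?K \<subseteq> (\<Union>c\<in>?C. mball c r)"
    proof
      fix x assume x: "x \<in> ?K"
      then obtain y where y: "y \<in> E k" "mdist M x y < r / 2" using close by blast
      then have py: "p y \<in> ?K" "mdist M (p y) y < r / 2" using p x by blast+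
      have "p y \<in> mspace M" "x \<in> mspace M" "y \<in> mspace M" using py(1) x y(1) E(3) by auto
      moreover then have "mdist M (p y) x \<le> mdist M (p y) y + mdist M x y"
        using mdist_triangle[of "p y" M y x] by (simp add: mdist_commute[of M y x])
      ultimately have "x \<in> mball (p y) r" using py(2) y(2) by simp
      moreover have "p y \<in> ?C" using x y by blast
      ultimately show "x \<in> (\<Union>c\<in>?C. mball c r)" by blast
    qed
    moreover have "?C \<subseteq> ?K" using p by blast
    moreover have "finite ?C" using E(1) by simp
    ultimately show "\<exists>C. finite C \<and> C \<subseteq> ?K \<and> ?K \<subseteq> (\<Union>c\<in>C. mball c r)" by (intro exI[of _ ?C] conjI)
  qed
  moreover have mc: mcomplete and top: "mtopology = discrete_topology (mspace M)"
    using M by (simp_all add: complete_discrete_def mcomplete_of_def mtopology_of_def)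
  ultimately have "compactin mtopology (mtopology closure_of ?K)"
    using mtotally_bounded_eq_compact_closure_of[OF mc] by blast
  then have "compactin (discrete_topology (mspace M)) (mspace M \<inter> ?K)"
    unfolding top discrete_topology_closure_of .
  then show ?thesis unfolding compactin_discrete_topology by (auto elim: rev_finite_subset)
qed

text \<open>The sequence is multiplied by cutoff functions of relative neighbourhoods of finite sets
  \<open>E k\<close>, one after the other. Each \<open>E k\<close> comes from
  \<open>weakly_null_tight\<close>, applied to the sequence as multiplied so far, so that the
  \<open>k\<close>-th multiplication changes it by no more than \<open>\<tau> k\<close>; these
  errors add up to less than \<open>\<epsilon>\<close>. A point outside the finite set
  \<open>F\<close> is removed after finitely many steps. Since the elements are finitely
  supported, a function that vanishes on \<open>F\<close> finally pairs to \<open>0\<close>.\<close>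

lemma weakly_null_finite_tight:
  fixes A :: "nat \<Rightarrow> 'a set" and c :: "nat \<Rightarrow> 'a \<Rightarrow> real"
  assumes M: "complete_discrete M" and e: "e \<in> mspace M" and A: "\<And>n. finite (A n)" "\<And>n. A n \<subseteq> mspace M"
    and null: "\<And>f. f \<in> Lip0 M e \<Longrightarrow> (\<lambda>n. \<Sum>x\<in>A n. c n x * f x) \<longlonglongrightarrow> 0"
    and \<epsilon>: "0 < \<epsilon>"
  obtains F where "finite F" "e \<in> F" "F \<subseteq> mspace M"
    "\<And>n f. f \<in> Lip0 M e \<Longrightarrow> lipschitz_bound M 1 f \<Longrightarrow> (\<And>x. x \<in> F \<Longrightarrow> f x = 0) \<Longrightarrow> (\<Sum>x\<in>A n. c n x * f x) \<le> \<epsilon>"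
proof -
  let ?r = "relative_distance M e"
  define pair where "pair n f = (\<Sum>x\<in>A n. c n x * f x)" for n f
  define \<delta> :: "nat \<Rightarrow> real" where "\<delta> k = (1 / 2) ^ (k + 2)" for k
  define \<tau> where "\<tau> k = \<epsilon> * (1 / 2) ^ Suc k" for k
  have \<delta>: "0 < \<delta> k" "\<delta> k \<le> 1" for k unfolding \<delta>_def by (simp, rule power_le_one) simp_all
  define L where "L k = 1 * (1 + 2 * (1 / \<delta> k))" for k
  have L: "1 \<le> L k" for k using \<delta>(1)[of k] by (simp add: L_def)
  define \<theta> where "\<theta> k t = cutoff 2 (t / \<delta> k)" for k t
  \<comment> \<open>\<open>W\<close> is the product of the cutoff functions used so far.\<close>
  define admissible where "admissible W \<longleftrightarrow> (\<forall>f\<in>Lip0 M e. (\<lambda>x. W x * f x) \<in> Lip0 M e)" for W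
  define step where "step k W W' E \<longleftrightarrow> finite E \<and> e \<in> E \<and> E \<subseteq> mspace M \<and> W' = (\<lambda>x. W x * \<theta> k (?r E x)) \<and>
      (\<forall>n. \<forall>f\<in>Lip0 M e. lipschitz_bound M 1 f \<longrightarrow> (\<forall>x\<in>mspace M. ?r E x \<le> \<delta> k \<longrightarrow> f x = 0) \<longrightarrow> pair n (\<lambda>x. W x * f x) \<le> \<tau> k / L k)"
    for k W W' E
  have "\<exists>W. \<forall>k. admissible (W k) \<and> (\<exists>E. step k (W k) (W (Suc k)) E) \<and> (k = 0 \<longrightarrow> W k = (\<lambda>x. 1))"
  proof -
    have "\<exists>W. \<forall>k. (admissible (W k) \<and> (k = 0 \<longrightarrow> W k = (\<lambda>x. 1))) \<and> (\<exists>E. step k (W k) (W (Suc k)) E)"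
    proof (rule dependent_nat_choice)
      show "\<exists>W. admissible W \<and> ((0::nat) = 0 \<longrightarrow> W = (\<lambda>x. 1))"
        by (intro exI[of _ "\<lambda>x. 1"]) (simp add: admissible_def)
      fix W and k :: nat assume "admissible W \<and> (k = 0 \<longrightarrow> W = (\<lambda>x. 1))"
      then have W: "admissible W" ..
      have nullW: "(\<lambda>n. \<Sum>x\<in>A n. (c n x * W x) * f x) \<longlonglongrightarrow> 0" if "f \<in> Lip0 M e" for f
        using null[of "\<lambda>x. W x * f x"] W that by (simp add: admissible_def mult.assoc)
      have "0 < \<tau> k / L k" using \<epsilon> L[of k] by (simp add: \<tau>_def)
      from weakly_null_tight[OF e A, of "\<lambda>n x. c n x * W x", OF nullW \<delta>[of k] this]
      obtain E where E: "finite E" "e \<in> E" "E \<subseteq> mspace M"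
        "\<forall>n. \<forall>f\<in>Lip0 M e. lipschitz_bound M 1 f \<longrightarrow> (\<forall>x\<in>mspace M. ?r E x \<le> \<delta> k \<longrightarrow> f x = 0) \<longrightarrow>
          (\<Sum>x\<in>A n. (c n x * W x) * f x) \<le> \<tau> k / L k" by blast
      have "step k W (\<lambda>x. W x * \<theta> k (?r E x)) E"
        unfolding step_def pair_def using E by (simp add: mult.assoc)
      moreover have "admissible (\<lambda>x. W x * \<theta> k (?r E x))"
        unfolding admissible_def
      proof
        fix f assume f: "f \<in> Lip0 M e"
        have "(\<lambda>x. f x * \<theta> k (?r E x)) \<in> Lip0 M e"
          unfolding \<theta>_def
          by (rule Lip0_multiplier(1)[OF E(3,2) f Lip0_lip_norm(2)[OF f] Lip0_lip_norm(1)[OF f] cutoff_props(1) cutoff_scaled[OF \<delta>(1)]])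
             (use \<delta>(1)[of k] in simp)
        then have "(\<lambda>x. W x * (f x * \<theta> k (?r E x))) \<in> Lip0 M e" by (rule bspec[OF W[unfolded admissible_def]])
        then show "(\<lambda>x. W x * \<theta> k (?r E x) * f x) \<in> Lip0 M e" by (simp add: mult_ac)
      qed
      ultimately show "\<exists>W'. (admissible W' \<and> (Suc k = 0 \<longrightarrow> W' = (\<lambda>x. 1))) \<and> (\<exists>E. step k W W' E)" by blast
    qed
    then show ?thesis by blast
  qed
  then obtain W where W: "\<And>k. admissible (W k)" "\<And>k. \<exists>E. step k (W k) (W (Suc k)) E" "W 0 = (\<lambda>x. 1)" by blast
  then obtain E where E': "\<And>k. step k (W k) (W (Suc k)) (E k)" by metis
  have E: "finite (E k)" "e \<in> E k" "E k \<subseteq> mspace M" and W_Suc: "W (Suc k) = (\<lambda>x. W k x * \<theta> k (?r (E k) x))"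
    and E_small: "\<And>n f. f \<in> Lip0 M e \<Longrightarrow> lipschitz_bound M 1 f \<Longrightarrow> (\<And>x. x \<in> mspace M \<Longrightarrow> ?r (E k) x \<le> \<delta> k \<Longrightarrow> f x = 0) \<Longrightarrow>
      pair n (\<lambda>x. W k x * f x) \<le> \<tau> k / L k" for k
    using E'[of k] unfolding step_def by blast+
  define F where "F = insert e {x \<in> mspace M. \<forall>k. ?r (E k) x < (1 / 2) ^ Suc k}"
  have F: "finite F" "e \<in> F" "F \<subseteq> mspace M"
    using finite_thin_neighbourhoods[OF M e E] e by (auto simp: F_def)
  show ?thesis
  proof (rule that[OF F])
    fix n f assume f: "f \<in> Lip0 M e" "lipschitz_bound M 1 f" and f0: "\<And>x. x \<in> F \<Longrightarrow> f x = 0"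
    have diff: "pair n (\<lambda>x. W k x * f x) \<le> pair n (\<lambda>x. W (Suc k) x * f x) + \<tau> k" for k
    proof -
      define u where "u x = f x * (1 - \<theta> k (?r (E k) x))" for x
      have \<kappa>: "\<bar>(1 - \<theta> k s) - (1 - \<theta> k t)\<bar> \<le> (1 / \<delta> k) * \<bar>s - t\<bar>" for s t
        using cutoff_scaled[OF \<delta>(1), of 2 s k t] by (simp add: \<theta>_def)
      have u: "u \<in> Lip0 M e" "lipschitz_bound M (L k) u"
        unfolding u_def[abs_def] L_def
        by (rule Lip0_multiplier[OF E(3,2) f zero_le_one _ \<kappa>], simp add: \<theta>_def cutoff_props, use \<delta>(1)[of k] in simp)+
      have L0: "0 < L k" using L[of k] by linarith
      define u' where "u' x = (1 / L k) * u x" for x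
      have u': "u' \<in> Lip0 M e" unfolding u'_def[abs_def] by (rule Lip0_scale[OF u(1)])
      have l': "lipschitz_bound M 1 u'"
        unfolding lipschitz_bound_def
      proof (intro ballI)
        fix x y assume "x \<in> mspace M" "y \<in> mspace M"
        from lipschitz_boundD[OF u(2) this] have "\<bar>u x - u y\<bar> / L k \<le> mdist M x y" using L0 by (simp add: divide_le_eq mult.commute)
        moreover have "\<bar>u' x - u' y\<bar> = \<bar>u x - u y\<bar> / L k" using L0 by (simp add: u'_def flip: diff_divide_distrib)
        ultimately show "\<bar>u' x - u' y\<bar> \<le> 1 * mdist M x y" by simp
      qed
      have "u' x = 0" if "?r (E k) x \<le> \<delta> k" for x
      proof -
        have "?r (E k) x / \<delta> k \<le> 1" using that \<delta>(1)[of k] by simp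
        then show ?thesis by (simp add: u'_def u_def \<theta>_def cutoff_props(4))
      qed
      then have "pair n (\<lambda>x. W k x * u' x) \<le> \<tau> k / L k" by (intro E_small u' l')
      moreover have "pair n (\<lambda>x. W k x * u' x) = pair n (\<lambda>x. W k x * u x) / L k"
        by (simp add: pair_def u'_def sum_divide_distrib)
      ultimately have "pair n (\<lambda>x. W k x * u x) \<le> \<tau> k" using L0 by (simp add: divide_le_cancel)
      moreover have "pair n (\<lambda>x. W k x * f x) = pair n (\<lambda>x. W (Suc k) x * f x) + pair n (\<lambda>x. W k x * u x)"
        unfolding pair_def sum.distrib[symmetric] by (intro sum.cong refl) (simp add: W_Suc u_def algebra_simps)
      ultimately show ?thesis by linarith
    qed
    have tele: "pair n f \<le> pair n (\<lambda>x. W k x * f x) + (\<epsilon> - \<epsilon> * (1 / 2) ^ k)" for k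
    proof (induction k)
      case 0
      then show ?case by (simp add: W(3))
    next
      case (Suc k)
      then show ?case using diff[of k] by (simp add: \<tau>_def)
    qed
    have "\<exists>k. \<forall>j\<ge>k. W j x * f x = 0" if x: "x \<in> A n" for x
    proof (cases "x \<in> F")
      case True
      then show ?thesis using f0 by simp
    next
      case False
      have "x \<in> mspace M" using x A(2) by blast
      then obtain k where "(1 / 2) ^ Suc k \<le> ?r (E k) x" using False by (auto simp: F_def not_less)
      then have "2 * \<delta> k \<le> ?r (E k) x" by (simp add: \<delta>_def)
      then have "2 \<le> ?r (E k) x / \<delta> k" using \<delta>(1)[of k] by (simp add: pos_le_divide_eq)
      then have "\<theta> k (?r (E k) x) = 0" unfolding \<theta>_def by (rule cutoff_props(5))
      then have W0: "W (Suc k) x = 0" by (simp add: W_Suc)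
      have "W j x = 0" if "Suc k \<le> j" for j
        using that by (induction j rule: dec_induct) (simp add: W0, simp add: W_Suc)
      then show ?thesis by (intro exI[of _ "Suc k"]) simp
    qed
    then obtain \<kappa> where \<kappa>: "\<And>x j. x \<in> A n \<Longrightarrow> \<kappa> x \<le> j \<Longrightarrow> W j x * f x = 0" by metis
    define k where "k = Max (insert 0 (\<kappa> ` A n))"
    have "\<kappa> x \<le> k" if "x \<in> A n" for x unfolding k_def using A(1) that by (intro Max_ge) auto
    then have "pair n (\<lambda>x. W k x * f x) = 0" unfolding pair_def using \<kappa> by (intro sum.neutral) simp
    moreover have "0 \<le> \<epsilon> * (1 / 2) ^ k" using \<epsilon> by simp
    ultimately show "(\<Sum>x\<in>A n. c n x * f x) \<le> \<epsilon>" using tele[of k] unfolding pair_def by linarith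
  qed
qed

text \<open>Restricted to the finite set \<open>F\<close> of \<open>weakly_null_finite_tight\<close>,
  the 1-Lipschitz functions form a totally bounded set. Each \<open>f\<close> is therefore
  close on \<open>F\<close> to one of finitely many \<open>f0\<close>. Then \<open>f -
  f0\<close> is the sum of a small combination \<open>r\<close> of bumps at the points of
  \<open>F\<close> and a function that vanishes on \<open>F\<close>. The latter is
  3-Lipschitz, a constant that does not depend on \<open>F\<close>, so that \<open>F\<close>
  may be chosen according to \<open>\<epsilon>\<close> beforehand.\<close>

lemma weakly_null_imp_norm_null:
  fixes A :: "nat \<Rightarrow> 'a set" and c :: "nat \<Rightarrow> 'a \<Rightarrow> real"
  assumes M: "complete_discrete M" and e: "e \<in> mspace M" and A: "\<And>n. finite (A n)" "\<And>n. A n \<subseteq> mspace M"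
    and null: "\<And>f. f \<in> Lip0 M e \<Longrightarrow> (\<lambda>n. \<Sum>x\<in>A n. c n x * f x) \<longlonglongrightarrow> 0"
    and \<epsilon>: "0 < \<epsilon>"
  shows "\<forall>\<^sub>F n in sequentially. \<forall>f\<in>Lip0 M e. lipschitz_bound M 1 f \<longrightarrow> (\<Sum>x\<in>A n. c n x * f x) \<le> \<epsilon>"
proof -
  define pair where "pair n f = (\<Sum>x\<in>A n. c n x * f x)" for n f
  have \<epsilon>6: "0 < \<epsilon> / 6" using \<epsilon> by simp
  obtain F where F: "finite F" "e \<in> F" "F \<subseteq> mspace M"
    and small': "\<And>n f. f \<in> Lip0 M e \<Longrightarrow> lipschitz_bound M 1 f \<Longrightarrow> (\<And>x. x \<in> F \<Longrightarrow> f x = 0) \<Longrightarrow>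
      (\<Sum>x\<in>A n. c n x * f x) \<le> \<epsilon> / 6"
    by (rule weakly_null_finite_tight[OF M e A null \<epsilon>6]) (assumption, rule that, assumption+, blast)
  have small: "pair n f \<le> \<epsilon> / 6" if "f \<in> Lip0 M e" "lipschitz_bound M 1 f" "\<And>x. x \<in> F \<Longrightarrow> f x = 0" for n f
    unfolding pair_def by (rule small'[OF that])
  obtain \<rho> where \<rho>: "0 < \<rho>" "separated_by M \<rho> F" by (rule finite_separated[OF F(1,3)]) (rule that)
  define b where "b p = based_at M e (\<lambda>w. max 0 (\<rho> - mdist M p w))" for p
  have b: "b p \<in> Lip0 M e" "lipschitz_bound M 1 (b p)" if "p \<in> F" for p
  proof -
    have p: "p \<in> mspace M" using that F(3) by blast
    note l = lipschitz_bound_bump[OF p, of \<rho>]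
    show "b p \<in> Lip0 M e" unfolding b_def by (rule based_at_Lip0(1)[OF l e])
    have "lip_norm M (b p) \<le> 1" unfolding b_def by (rule based_at_Lip0(2)[OF l e zero_le_one])
    then show "lipschitz_bound M 1 (b p)"
      unfolding lipschitz_bound_def
      using lipschitz_boundD[OF Lip0_lip_norm(2)[OF \<open>b p \<in> Lip0 M e\<close>]] mult_right_mono[of "lip_norm M (b p)" 1]
      by (meson mdist_nonneg order_trans)
  qed
  have b_val: "b p q = (if q = p then \<rho> else 0)" if "p \<in> F - {e}" "q \<in> F" for p q
  proof -
    have *: "max 0 (\<rho> - mdist M p x) = (if x = p then \<rho> else 0)" if "x \<in> F" for x
    proof (cases "x = p")
      case True then show ?thesis using \<rho>(1) F(3) that by auto
    next
      case False
      have "\<rho> \<le> mdist M p x"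
        by (rule pairwiseD[OF \<rho>(2)[unfolded separated_by_def]]) (use that False \<open>p \<in> F - {e}\<close> in auto)
      then show ?thesis using False by simp
    qed
    have "q \<in> mspace M" "e \<noteq> p" using that F(3) by auto
    then show ?thesis unfolding b_def based_at_def *[OF that(2)] *[OF F(2)] by simp
  qed
  define n1 where "n1 = real (card F) + 1"
  have n1: "1 \<le> n1" by (simp add: n1_def)
  define t where "t = \<rho> / n1"
  have t: "0 < t" using \<rho>(1) n1 by (simp add: t_def)
  define B where "B = {f \<in> Lip0 M e. lipschitz_bound M 1 f}"
  \<comment> \<open>Functions with the same cell differ by at most \<open>t\<close> on \<open>F\<close>; the
    size of \<open>t\<close> makes the combination \<open>r\<close> 1-Lipschitz.\<close>
  define cell where "cell f = (\<lambda>p\<in>F. \<lfloor>f p / t\<rfloor>)" for f :: "'a \<Rightarrow> real"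
  have "finite (cell ` B)"
  proof (rule finite_subset)
    define m where "m p = \<lceil>mdist M p e / t\<rceil> + 1" for p
    show "cell ` B \<subseteq> PiE F (\<lambda>p. {- m p..m p})"
    proof
      fix \<phi> assume "\<phi> \<in> cell ` B"
      then obtain f where f: "f \<in> B" "\<phi> = cell f" by blast
      have "\<lfloor>f p / t\<rfloor> \<in> {- m p..m p}" if "p \<in> F" for p
      proof -
        have "\<bar>f p\<bar> \<le> mdist M p e"
          using lipschitz_boundD[of M 1 f p e] f(1) that F(3) e by (auto simp: B_def Lip0_iff)
        then have "\<bar>f p / t\<bar> \<le> mdist M p e / t" using t by (simp add: divide_right_mono)
        then have "f p / t \<le> mdist M p e / t" "- (mdist M p e / t) \<le> f p / t" by linarith+
        then show ?thesis unfolding m_def atLeastAtMost_iff by linarith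
      qed
      then show "\<phi> \<in> PiE F (\<lambda>p. {- m p..m p})" unfolding f(2) cell_def by auto
    qed
    show "finite (PiE F (\<lambda>p. {- m p..m p}))" by (intro finite_PiE F(1)) simp
  qed
  define rep where "rep \<phi> = inv_into B cell \<phi>" for \<phi>
  have rep: "rep (cell f) \<in> B" "cell (rep (cell f)) = cell f" if "f \<in> B" for f
    using that by (auto simp: rep_def inv_into_into f_inv_into_f)
  have "\<forall>\<^sub>F n in sequentially. \<forall>\<phi>\<in>cell ` B. pair n (rep \<phi>) < \<epsilon> / 4"
  proof (rule eventually_ball_finite[OF \<open>finite (cell ` B)\<close>], rule ballI)
    fix \<phi> assume "\<phi> \<in> cell ` B"
    then have "rep \<phi> \<in> Lip0 M e" using rep(1) by (auto simp: B_def)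
    then show "\<forall>\<^sub>F n in sequentially. pair n (rep \<phi>) < \<epsilon> / 4"
      using order_tendstoD(2)[OF null, of "rep \<phi>" "\<epsilon> / 4"] \<epsilon> by (simp add: pair_def)
  qed
  moreover have "\<forall>\<^sub>F n in sequentially. (\<Sum>p\<in>F. \<bar>pair n (b p)\<bar>) < \<epsilon> / 4"
  proof -
    have "(\<lambda>n. \<Sum>p\<in>F. \<bar>pair n (b p)\<bar>) \<longlonglongrightarrow> (\<Sum>p\<in>F. \<bar>0\<bar>)"
      unfolding pair_def by (intro tendsto_sum tendsto_rabs null b)
    then have "(\<lambda>n. \<Sum>p\<in>F. \<bar>pair n (b p)\<bar>) \<longlonglongrightarrow> 0" by simp
    from order_tendstoD(2)[OF this, of "\<epsilon> / 4"] \<epsilon> show ?thesis by simp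
  qed
  ultimately have "\<forall>\<^sub>F n in sequentially. \<forall>f\<in>B. pair n f \<le> \<epsilon>"
  proof eventually_elim
    fix n assume 1: "\<forall>\<phi>\<in>cell ` B. pair n (rep \<phi>) < \<epsilon> / 4" and 2: "(\<Sum>p\<in>F. \<bar>pair n (b p)\<bar>) < \<epsilon> / 4"
    show "\<forall>f\<in>B. pair n f \<le> \<epsilon>"
    proof
      fix f assume f: "f \<in> B"
      define f0 where "f0 = rep (cell f)"
      have f0: "f0 \<in> B" "cell f0 = cell f" using rep[OF f] by (simp_all add: f0_def)
      define a where "a p = (f p - f0 p) / \<rho>" for p
      have a: "\<bar>a p\<bar> \<le> 1 / n1" if "p \<in> F" for p
      proof -
        have "\<lfloor>f p / t\<rfloor> = \<lfloor>f0 p / t\<rfloor>" using fun_cong[OF f0(2), of p] that by (simp add: cell_def)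
        then have "\<bar>f p / t - f0 p / t\<bar> \<le> 1" by linarith
        then have "\<bar>f p - f0 p\<bar> \<le> t" using t by (simp add: divide_le_eq flip: diff_divide_distrib)
        then have "\<bar>f p - f0 p\<bar> / \<rho> \<le> t / \<rho>" using \<rho>(1) by (simp add: divide_right_mono)
        then show ?thesis using \<rho>(1) by (simp add: a_def t_def)
      qed
      define r where "r x = (\<Sum>p\<in>F - {e}. a p * b p x)" for x
      have fin: "finite (F - {e})" using F(1) by simp
      have r_Lip0: "r \<in> Lip0 M e"
        unfolding r_def[abs_def]
        using Lip0_dual_sum_arg[OF Lip0_dual_0(1) fin, where f = b and c = a] b(1) by simp
      have r_lip: "lipschitz_bound M 1 r"
        unfolding lipschitz_bound_def
      proof (intro ballI)
        fix x y assume xy: "x \<in> mspace M" "y \<in> mspace M"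
        have "\<bar>r x - r y\<bar> = \<bar>\<Sum>p\<in>F - {e}. a p * (b p x - b p y)\<bar>"
          by (simp add: r_def sum_subtractf right_diff_distrib)
        also have "\<dots> \<le> (\<Sum>p\<in>F - {e}. \<bar>a p * (b p x - b p y)\<bar>)" by (rule sum_abs)
        also have "\<dots> \<le> (\<Sum>p\<in>F - {e}. (1 / n1) * mdist M x y)"
        proof (rule sum_mono)
          fix p assume p: "p \<in> F - {e}"
          then show "\<bar>a p * (b p x - b p y)\<bar> \<le> (1 / n1) * mdist M x y"
            using lipschitz_boundD[OF b(2) xy, of p] a[of p] n1 unfolding abs_mult by (intro mult_mono) auto
        qed
        also have "\<dots> = (real (card (F - {e})) * (1 / n1)) * mdist M x y" by simp
        also have "\<dots> \<le> 1 * mdist M x y"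
        proof (rule mult_right_mono)
          have "card (F - {e}) \<le> card F" by (rule card_mono[OF F(1)]) auto
          then show "real (card (F - {e})) * (1 / n1) \<le> 1" using n1 by (simp add: n1_def)
        qed simp
        finally show "\<bar>r x - r y\<bar> \<le> 1 * mdist M x y" .
      qed
      have r_val: "r q = f q - f0 q" if "q \<in> F" for q
      proof (cases "q = e")
        case True
        have "r e = 0" "f e = 0" "f0 e = 0" using r_Lip0 f f0(1) by (auto simp: B_def Lip0_iff)
        then show ?thesis using True by simp
      next
        case False
        have "r q = (\<Sum>p\<in>F - {e}. if p = q then a q * \<rho> else 0)"
          unfolding r_def by (rule sum.cong[OF refl]) (use b_val that in auto)
        also have "\<dots> = a q * \<rho>" using fin that False by simp
        finally show ?thesis using \<rho>(1) by (simp add: a_def)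
      qed
      define h where "h x = (1 / 3) * ((f x - f0 x) - r x)" for x
      have h_Lip0: "h \<in> Lip0 M e"
        unfolding h_def[abs_def] using f f0(1) by (intro Lip0_scale Lip0_diff r_Lip0) (auto simp: B_def)
      have h_lip: "lipschitz_bound M 1 h"
        unfolding lipschitz_bound_def
      proof (intro ballI)
        fix x y assume xy: "x \<in> mspace M" "y \<in> mspace M"
        have "\<bar>f x - f y\<bar> \<le> 1 * mdist M x y" "\<bar>f0 x - f0 y\<bar> \<le> 1 * mdist M x y" "\<bar>r x - r y\<bar> \<le> 1 * mdist M x y"
          using lipschitz_boundD[OF _ xy, of 1 f] lipschitz_boundD[OF _ xy, of 1 f0] lipschitz_boundD[OF r_lip xy] f f0(1)
          by (simp_all add: B_def)
        then have "\<bar>(f x - f y) - (f0 x - f0 y) - (r x - r y)\<bar> \<le> 3 * mdist M x y" by linarith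
        moreover have "h x - h y = (1 / 3) * ((f x - f y) - (f0 x - f0 y) - (r x - r y))"
          by (simp add: h_def field_simps)
        ultimately show "\<bar>h x - h y\<bar> \<le> 1 * mdist M x y" by (simp add: abs_mult)
      qed
      have "pair n h \<le> \<epsilon> / 6" by (rule small[OF h_Lip0 h_lip]) (simp add: h_def r_val)
      moreover have "pair n f = 3 * pair n h + pair n f0 + pair n r"
        unfolding pair_def sum_distrib_left sum.distrib[symmetric] by (intro sum.cong refl) (simp add: h_def algebra_simps)
      moreover have "pair n f0 < \<epsilon> / 4" using 1 f by (simp add: f0_def)
      moreover have "pair n r \<le> \<epsilon> / 4"
      proof -
        have "pair n r = (\<Sum>x\<in>A n. \<Sum>p\<in>F - {e}. c n x * (a p * b p x))" by (simp add: pair_def r_def sum_distrib_left)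
        also have "\<dots> = (\<Sum>p\<in>F - {e}. \<Sum>x\<in>A n. c n x * (a p * b p x))" by (rule sum.swap)
        also have "\<dots> = (\<Sum>p\<in>F - {e}. a p * pair n (b p))" by (simp add: pair_def sum_distrib_left mult_ac)
        also have "\<dots> \<le> (\<Sum>p\<in>F - {e}. \<bar>pair n (b p)\<bar>)"
        proof (rule sum_mono)
          fix p assume "p \<in> F - {e}"
          then have "\<bar>a p\<bar> \<le> 1 / n1" by (intro a) simp
          also have "\<dots> \<le> 1" using n1 by simp
          finally have "\<bar>a p\<bar> * \<bar>pair n (b p)\<bar> \<le> 1 * \<bar>pair n (b p)\<bar>" by (intro mult_right_mono) auto
          then show "a p * pair n (b p) \<le> \<bar>pair n (b p)\<bar>" by (simp add: abs_mult[symmetric])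
        qed
        also have "\<dots> \<le> (\<Sum>p\<in>F. \<bar>pair n (b p)\<bar>)" by (rule sum_mono2[OF F(1)]) auto
        finally show ?thesis using 2 by simp
      qed
      ultimately show "pair n f \<le> \<epsilon>" by linarith
    qed
  qed
  then show ?thesis unfolding B_def pair_def by eventually_elim blast
qed

section \<open>Weak convergence in free spaces\<close>

text \<open>Convergence in a generated topology can be tested on the generating sets.\<close>

lemma limitin_weak_topology_iff:
  assumes "range \<sigma> \<subseteq> V"
  shows "limitin (weak_topology V nrm) \<sigma> l sequentially \<longleftrightarrow>
    l \<in> V \<and> (\<forall>\<phi>\<in>bdual V nrm. (\<lambda>n. \<phi> (\<sigma> n)) \<longlonglongrightarrow> \<phi> l)"
proof -
  let ?S = "{{f \<in> V. \<phi> f \<in> U} | \<phi> U. \<phi> \<in> bdual V nrm \<and> open U}"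
  have \<sigma>: "\<sigma> n \<in> V" for n using assms by blast
  show ?thesis
  proof (intro iffI conjI ballI)
    assume lim: "limitin (weak_topology V nrm) \<sigma> l sequentially"
    then show "l \<in> V" by (simp add: limitin_def)
    fix \<phi> assume \<phi>: "\<phi> \<in> bdual V nrm"
    show "(\<lambda>n. \<phi> (\<sigma> n)) \<longlonglongrightarrow> \<phi> l"
    proof (rule topological_tendstoI)
      fix U :: "real set" assume U: "open U" "\<phi> l \<in> U"
      have "{f \<in> V. \<phi> f \<in> U} \<in> ?S" using \<phi> U(1) by blast
      then have "openin (weak_topology V nrm) {f \<in> V. \<phi> f \<in> U}"
        unfolding weak_topology_def by (rule topology_generated_by_Basis)
      moreover have "l \<in> {f \<in> V. \<phi> f \<in> U}" using \<open>l \<in> V\<close> U(2) by simp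
      ultimately have "\<forall>\<^sub>F n in sequentially. \<sigma> n \<in> {f \<in> V. \<phi> f \<in> U}"
        using lim unfolding limitin_def by blast
      then show "\<forall>\<^sub>F n in sequentially. \<phi> (\<sigma> n) \<in> U" by (rule eventually_mono) simp
    qed
  next
    assume l: "l \<in> V \<and> (\<forall>\<phi>\<in>bdual V nrm. (\<lambda>n. \<phi> (\<sigma> n)) \<longlonglongrightarrow> \<phi> l)"
    have "l \<in> U \<longrightarrow> (\<forall>\<^sub>F n in sequentially. \<sigma> n \<in> U)" if "generate_topology_on ?S U" for U
      using that
    proof (induction rule: generate_topology_on.induct)
      case (Int a b)
      then show ?case by (auto intro: eventually_conj)
    next
      case (UN K)
      show ?case
      proof
        assume "l \<in> \<Union>K"
        then obtain k where k: "k \<in> K" "l \<in> k" by blast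
        then have "\<forall>\<^sub>F n in sequentially. \<sigma> n \<in> k" using UN.IH by blast
        then show "\<forall>\<^sub>F n in sequentially. \<sigma> n \<in> \<Union>K" by (rule eventually_mono) (use k in blast)
      qed
    next
      case (Basis s)
      then obtain \<phi> W where s: "s = {f \<in> V. \<phi> f \<in> W}" "\<phi> \<in> bdual V nrm" "open W" by blast
      show ?case
      proof
        assume "l \<in> s"
        then have "\<phi> l \<in> W" by (simp add: s(1))
        then have "\<forall>\<^sub>F n in sequentially. \<phi> (\<sigma> n) \<in> W" using topological_tendstoD[OF _ s(3)] l s(2) by blast
        then show "\<forall>\<^sub>F n in sequentially. \<sigma> n \<in> s" by (rule eventually_mono) (simp add: s(1) \<sigma>)
      qed
    qed simp
    then show "limitin (weak_topology V nrm) \<sigma> l sequentially"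
      using l unfolding limitin_def topspace_weak_topology
      by (simp add: weak_topology_def openin_topology_generated_by_iff)
  qed
qed

context
  fixes M :: "'a metric" and e :: 'a
  assumes e: "e \<in> mspace M"
begin

lemma free_space_dual: "\<mu> \<in> free_space M e \<Longrightarrow> \<mu> \<in> Lip0_dual M e"
  by (simp add: free_space_def)

lemma free_space_lincomb:
  assumes "\<mu> \<in> free_space M e" "\<nu> \<in> free_space M e"
  shows "(\<lambda>f. a * \<mu> f + b * \<nu> f) \<in> free_space M e"
  using assms Lip0_dual_lincomb[of \<mu> M e \<nu> a b] free_image_subspace(1)[of M e]
  by (simp add: emb_free_space(1)[OF e] subspace_add subspace_scale)

lemma free_space_0: "(\<lambda>f. 0) \<in> free_space M e"
  using Lip0_dual_0[of M e] free_image_subspace(1)[of M e] by (simp add: emb_free_space(1)[OF e] subspace_0)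

lemma free_norm_diff:
  assumes "\<mu> \<in> free_space M e" "\<nu> \<in> free_space M e"
  shows "free_norm M e (\<lambda>f. \<mu> f - \<nu> f) = norm (emb M e \<mu> - emb M e \<nu>)"
  using norm_emb[OF Lip0_dual_diff(1)[OF assms[THEN free_space_dual]]]
  by (simp add: Lip0_dual_diff(2)[OF assms[THEN free_space_dual]])

lemma evaluation_functional_bdual:
  assumes f: "f \<in> Lip0 M e"
  shows "(\<lambda>\<mu>. if \<mu> \<in> free_space M e then \<mu> f else 0) \<in> bdual (free_space M e) (free_norm M e)"
proof -
  have add: "(\<lambda>g. \<mu> g + \<nu> g) \<in> free_space M e" if "\<mu> \<in> free_space M e" "\<nu> \<in> free_space M e" for \<mu> \<nu>
    using free_space_lincomb[OF that, of 1 1] by simp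
  have scale: "(\<lambda>g. c * \<mu> g) \<in> free_space M e" if "\<mu> \<in> free_space M e" for c \<mu>
    using free_space_lincomb[OF that that, of c 0] by simp
  have "\<bar>\<mu> f\<bar> \<le> lip_norm M f * free_norm M e \<mu>" if "\<mu> \<in> free_space M e" for \<mu>
    using le_free_norm[OF free_space_dual[OF that] f] by (simp add: mult.commute)
  then show ?thesis
    unfolding bdual_def by (intro CollectI conjI exI[of _ "lip_norm M f"]) (simp_all add: add scale)
qed

lemma weak_limit_eval:
  assumes "range \<sigma> \<subseteq> free_space M e" "limitin (free_space_weak M e) \<sigma> l sequentially" "f \<in> Lip0 M e"
  shows "(\<lambda>n. \<sigma> n f) \<longlonglongrightarrow> l f"
proof -
  have l: "l \<in> free_space M e" and \<sigma>: "\<sigma> n \<in> free_space M e" for n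
    using assms(1,2) limitin_weak_topology_iff[OF assms(1)] by auto
  show ?thesis
    using assms(2) limitin_weak_topology_iff[OF assms(1)] evaluation_functional_bdual[OF assms(3)] l \<sigma> by fastforce
qed

lemma norm_limit_imp_weak_limit:
  assumes \<sigma>: "range \<sigma> \<subseteq> free_space M e" and l: "l \<in> free_space M e"
    and lim: "(\<lambda>n. free_norm M e (\<lambda>f. \<sigma> n f - l f)) \<longlonglongrightarrow> 0"
  shows "limitin (free_space_weak M e) \<sigma> l sequentially"
  unfolding limitin_weak_topology_iff[OF \<sigma>]
proof (intro conjI ballI l)
  fix \<phi> assume \<phi>: "\<phi> \<in> bdual (free_space M e) (free_norm M e)"
  then obtain C where C: "\<And>\<mu>. \<mu> \<in> free_space M e \<Longrightarrow> \<bar>\<phi> \<mu>\<bar> \<le> C * free_norm M e \<mu>" unfolding bdual_def by blast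
  have \<sigma>': "\<sigma> n \<in> free_space M e" for n using \<sigma> by blast
  have d: "(\<lambda>f. \<sigma> n f - l f) \<in> free_space M e" for n
    using free_space_lincomb[OF \<sigma>'[of n] l, of 1 "-1"] by simp
  have eq: "\<phi> (\<lambda>f. \<sigma> n f - l f) = \<phi> (\<sigma> n) - \<phi> l" for n
  proof -
    have "\<phi> (\<lambda>f. (\<sigma> n f - l f) + l f) = \<phi> (\<lambda>f. \<sigma> n f - l f) + \<phi> l" by (rule bdualD(2)[OF \<phi> d l])
    then show ?thesis by simp
  qed
  have "(\<lambda>n. \<phi> (\<sigma> n) - \<phi> l) \<longlonglongrightarrow> 0"
  proof (rule Lim_null_comparison)
    show "\<forall>\<^sub>F n in sequentially. norm (\<phi> (\<sigma> n) - \<phi> l) \<le> C * free_norm M e (\<lambda>f. \<sigma> n f - l f)"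
      using C[OF d] by (simp add: eq)
    show "(\<lambda>n. C * free_norm M e (\<lambda>f. \<sigma> n f - l f)) \<longlonglongrightarrow> 0" by (rule tendsto_mult_right_zero[OF lim])
  qed
  then show "(\<lambda>n. \<phi> (\<sigma> n)) \<longlonglongrightarrow> \<phi> l" by (rule Lim_null[THEN iffD2])
qed

text \<open>Weak convergence is translation and scaling invariant; this supplies the rows of the
  diagonal argument below.\<close>

lemma weak_limit_scaled_diff:
  assumes \<sigma>: "range \<sigma> \<subseteq> free_space M e" and lim: "limitin (free_space_weak M e) \<sigma> l sequentially"
  shows "limitin (free_space_weak M e) (\<lambda>n f. a * (\<sigma> n f - l f)) (\<lambda>f. 0) sequentially"
proof -
  have l: "l \<in> free_space M e" and \<sigma>': "\<sigma> n \<in> free_space M e" for n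
    using \<sigma> lim limitin_weak_topology_iff[OF \<sigma>] by auto
  have d: "(\<lambda>f. a * (\<sigma> n f - l f)) \<in> free_space M e" for n
    using free_space_lincomb[OF \<sigma>'[of n] l, of a "- a"] by (simp add: algebra_simps)
  then have r: "range (\<lambda>n f. a * (\<sigma> n f - l f)) \<subseteq> free_space M e" by blast
  show ?thesis
    unfolding limitin_weak_topology_iff[OF r]
  proof (intro conjI ballI free_space_0)
    fix \<phi> assume \<phi>: "\<phi> \<in> bdual (free_space M e) (free_norm M e)"
    have d1: "(\<lambda>f. \<sigma> n f - l f) \<in> free_space M e" for n
    using free_space_lincomb[OF \<sigma>'[of n] l, of 1 "-1"] by simp
    have eq: "\<phi> (\<lambda>f. a * (\<sigma> n f - l f)) = a * (\<phi> (\<sigma> n) - \<phi> l)" for n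
    proof -
      have "\<phi> (\<lambda>f. (\<sigma> n f - l f) + l f) = \<phi> (\<lambda>f. \<sigma> n f - l f) + \<phi> l" by (rule bdualD(2)[OF \<phi> d1 l])
      then show ?thesis using bdualD(3)[OF \<phi> d1[of n], of a] by simp
    qed
    have "\<phi> (\<lambda>f. 0 * l f) = 0 * \<phi> l" by (rule bdualD(3)[OF \<phi> l])
    then have z: "\<phi> (\<lambda>f. 0) = 0" by simp
    have "(\<lambda>n. \<phi> (\<sigma> n)) \<longlonglongrightarrow> \<phi> l" using lim limitin_weak_topology_iff[OF \<sigma>] \<phi> by blast
    then have "(\<lambda>n. a * (\<phi> (\<sigma> n) - \<phi> l)) \<longlonglongrightarrow> a * (\<phi> l - \<phi> l)" by (intro tendsto_intros)
    then show "(\<lambda>n. \<phi> (\<lambda>f. a * (\<sigma> n f - l f))) \<longlonglongrightarrow> \<phi> (\<lambda>f. 0)" by (simp add: eq z)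
  qed
qed

end

section \<open>The Schur property of complete discrete spaces\<close>

text \<open>Replacing the elements of the sequence by finitely supported ones at distance less than
  \<open>1 / (n + 1)\<close> changes neither the hypothesis nor the conclusion.\<close>

theorem Schur_complete_discrete:
  assumes M: "complete_discrete M" and e: "e \<in> mspace M"
  shows "Schur_property (free_space M e) (free_norm M e)"
  unfolding Schur_property_def
proof (intro allI impI)
  fix \<sigma> l assume as: "range \<sigma> \<subseteq> free_space M e \<and> limitin (free_space_weak M e) \<sigma> l sequentially"
  then have \<sigma>r: "range \<sigma> \<subseteq> free_space M e" and lim: "limitin (free_space_weak M e) \<sigma> l sequentially" by blast+
  have l: "l \<in> free_space M e" and \<sigma>: "\<sigma> n \<in> free_space M e" for n
    using as limitin_weak_topology_iff[OF \<sigma>r] by auto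
  define \<tau> where "\<tau> n = (\<lambda>f. \<sigma> n f - l f)" for n
  have \<tau>: "\<tau> n \<in> free_space M e" for n
    unfolding \<tau>_def using free_space_lincomb[OF e \<sigma>[of n] l, of 1 "-1"] by simp
  define approx where "approx n A c \<longleftrightarrow> finite A \<and> A \<subseteq> mspace M \<and>
      free_norm M e (\<lambda>f. \<tau> n f - (\<Sum>x\<in>A. c x * evaluation M e x f)) < 1 / real (Suc n)" for n A c
  have "\<exists>A c. approx n A c" for n
  proof -
    have "\<exists>\<psi>\<in>evaluation_span M e. free_norm M e (\<lambda>f. \<tau> n f - \<psi> f) < 1 / real (Suc n)"
      using \<tau>[of n] unfolding free_space_def by simp
    then show ?thesis unfolding evaluation_span_def approx_def by blast
  qed
  then obtain A c where Ac: "\<And>n. approx n (A n) (c n)" by metis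
  have A: "finite (A n)" "A n \<subseteq> mspace M"
    and close: "free_norm M e (\<lambda>f. \<tau> n f - (\<Sum>x\<in>A n. c n x * evaluation M e x f)) < 1 / real (Suc n)" for n
    using Ac[of n] unfolding approx_def by simp_all
  define \<psi> where "\<psi> n = (\<lambda>f. \<Sum>x\<in>A n. c n x * evaluation M e x f)" for n
  have \<psi>: "\<psi> n \<in> Lip0_dual M e" for n
    unfolding \<psi>_def using evaluation_span_dual[OF e A(1)[of n] A(2)[of n]] by blast
  have \<psi>_val: "\<psi> n f = (\<Sum>x\<in>A n. c n x * f x)" if "f \<in> Lip0 M e" for n f
    using that by (simp add: \<psi>_def evaluation_def)
  have diff: "\<bar>\<tau> n f - \<psi> n f\<bar> \<le> 1 / real (Suc n) * lip_norm M f" if f: "f \<in> Lip0 M e" for n f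
  proof -
    have "\<bar>\<tau> n f - \<psi> n f\<bar> \<le> free_norm M e (\<lambda>f. \<tau> n f - \<psi> n f) * lip_norm M f"
      by (rule le_free_norm[OF Lip0_dual_diff(1)[OF free_space_dual[OF e \<tau>] \<psi>] f])
    also have "\<dots> \<le> 1 / real (Suc n) * lip_norm M f"
      using close[of n] Lip0_lip_norm(1)[OF f] by (intro mult_right_mono) (auto simp: \<psi>_def)
    finally show ?thesis .
  qed
  have null: "(\<lambda>n. \<Sum>x\<in>A n. c n x * f x) \<longlonglongrightarrow> 0" if f: "f \<in> Lip0 M e" for f
  proof -
    have "(\<lambda>n. \<tau> n f - \<psi> n f) \<longlonglongrightarrow> 0"
    proof (rule Lim_null_comparison)
      show "\<forall>\<^sub>F n in sequentially. norm (\<tau> n f - \<psi> n f) \<le> 1 / real (Suc n) * lip_norm M f" using diff[OF f] by simp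
      show "(\<lambda>n. 1 / real (Suc n) * lip_norm M f) \<longlonglongrightarrow> 0"
        by (rule tendsto_mult_left_zero[OF LIMSEQ_Suc[OF lim_1_over_n]])
    qed
    moreover have "(\<lambda>n. \<tau> n f) \<longlonglongrightarrow> 0"
      using weak_limit_eval[OF e \<sigma>r lim f] unfolding \<tau>_def by (rule Lim_null[THEN iffD1])
    ultimately have "(\<lambda>n. \<tau> n f - (\<tau> n f - \<psi> n f)) \<longlonglongrightarrow> 0 - 0" by (intro tendsto_diff)
    then show ?thesis by (simp add: \<psi>_val[OF f])
  qed
  show "(\<lambda>n. free_norm M e (\<lambda>x. \<sigma> n x - l x)) \<longlonglongrightarrow> 0"
  proof (rule LIMSEQ_I)
    fix r :: real assume r: "0 < r"
    have "\<forall>\<^sub>F n in sequentially. \<forall>f\<in>Lip0 M e. lipschitz_bound M 1 f \<longrightarrow> (\<Sum>x\<in>A n. c n x * f x) \<le> r / 4"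
      by (rule weakly_null_imp_norm_null[OF M e A null]) (use r in auto)
    moreover have "\<forall>\<^sub>F n in sequentially. 1 / real (Suc n) < r / 4"
      using order_tendstoD(2)[OF LIMSEQ_Suc[OF lim_1_over_n], of "r / 4"] r by simp
    ultimately have "\<forall>\<^sub>F n in sequentially. norm (free_norm M e (\<lambda>x. \<sigma> n x - l x) - 0) < r"
    proof eventually_elim
      fix n assume 1: "\<forall>f\<in>Lip0 M e. lipschitz_bound M 1 f \<longrightarrow> (\<Sum>x\<in>A n. c n x * f x) \<le> r / 4" and 2: "1 / real (Suc n) < r / 4"
      have "\<bar>\<tau> n f\<bar> \<le> r / 2" if f: "f \<in> Lip0 M e" "lip_norm M f \<le> 1" for f
      proof -
        have l1: "lipschitz_bound M 1 f"
          unfolding lipschitz_bound_def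
        proof (intro ballI)
          fix x y assume xy: "x \<in> mspace M" "y \<in> mspace M"
          show "\<bar>f x - f y\<bar> \<le> 1 * mdist M x y"
            using lipschitz_boundD[OF Lip0_lip_norm(2)[OF f(1)] xy] mult_right_mono[OF f(2) mdist_nonneg[of M x y]] by linarith
        qed
        have l2: "lipschitz_bound M 1 (\<lambda>x. - 1 * f x)"
          using l1 by (simp add: lipschitz_bound_def abs_minus_commute)
        have "(\<Sum>x\<in>A n. c n x * f x) \<le> r / 4" using 1 f(1) l1 by blast
        moreover have "(\<Sum>x\<in>A n. c n x * (- 1 * f x)) \<le> r / 4" using 1 Lip0_scale[OF f(1), of "- 1"] l2 by blast
        ultimately have "\<bar>\<psi> n f\<bar> \<le> r / 4" by (simp add: \<psi>_val[OF f(1)] sum_negf abs_le_iff)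
        moreover have "\<bar>\<tau> n f - \<psi> n f\<bar> \<le> r / 4"
        proof -
          have "1 / real (Suc n) * lip_norm M f \<le> 1 / real (Suc n) * 1" by (intro mult_left_mono f(2)) simp
          then show ?thesis using diff[OF f(1), of n] 2 by linarith
        qed
        ultimately show ?thesis by linarith
      qed
      then have "free_norm M e (\<tau> n) \<le> r / 2" by (rule free_norm_le)
      moreover have "0 \<le> free_norm M e (\<tau> n)" using norm_emb[OF free_space_dual[OF e \<tau>[of n]]] norm_ge_zero by metis
      ultimately show "norm (free_norm M e (\<lambda>x. \<sigma> n x - l x) - 0) < r" using r by (simp add: \<tau>_def)
    qed
    then show "\<exists>n0. \<forall>n\<ge>n0. norm (free_norm M e (\<lambda>x. \<sigma> n x - l x) - 0) < r" by (simp add: eventually_sequentially)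
  qed
qed

section \<open>Transfer of the Schur property\<close>

text \<open>Uniform boundedness by an elementary construction: partial sums of a series with weights
  \<open>9\<^sup>-\<^sup>k\<close> are chosen so that \<open>u k\<close> is at least
  \<open>9\<^sup>-\<^sup>k U k / 4\<close> in modulus on the \<open>k\<close>-th of them,
  where \<open>U k\<close> is the norm of \<open>u k\<close>. This can be reached by adding
  the new term or leaving it out. The later terms change the value by at most
  \<open>9\<^sup>-\<^sup>k U k / 8\<close>, since the remaining weights sum to
  \<open>9\<^sup>-\<^sup>k / 8\<close>. The sum of the series is again in
  \<^const>\<open>Lip0\<close>, and \<open>u k\<close> stays away from \<open>0\<close> on it
  because \<open>U k\<close> is at least \<open>C 9\<^sup>k\<close>.\<close>

lemma unbounded_not_weakly_null:
  assumes e: "e \<in> mspace M" and u: "\<And>k. u k \<in> Lip0_dual M e" and big: "\<And>k. C * 9 ^ k \<le> free_norm M e (u k)"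
    and C: "0 < C" and null: "\<And>f. f \<in> Lip0 M e \<Longrightarrow> (\<lambda>k. u k f) \<longlonglongrightarrow> 0"
  shows False
proof -
  define U where "U k = free_norm M e (u k)" for k
  have U0: "0 < U k" for k
  proof -
    have "0 < C * 9 ^ k" using C by simp
    then show ?thesis using big[of k] unfolding U_def by linarith
  qed
  have "\<exists>f. f \<in> Lip0 M e \<and> lip_norm M f \<le> 1 \<and> U k / 2 < \<bar>u k f\<bar>" for k
  proof (rule ccontr)
    assume "\<nexists>f. f \<in> Lip0 M e \<and> lip_norm M f \<le> 1 \<and> U k / 2 < \<bar>u k f\<bar>"
    then have "U k \<le> U k / 2" unfolding U_def by (intro free_norm_le) (auto simp: not_less)
    then show False using U0[of k] by simp
  qed
  then obtain f where f: "\<And>k. f k \<in> Lip0 M e" "\<And>k. lip_norm M (f k) \<le> 1" "\<And>k. U k / 2 < \<bar>u k (f k)\<bar>" by metis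
  define w where "w k = (1 / 9 :: real) ^ k" for k :: nat
  have w0: "0 < w k" for k by (simp add: w_def)
  define next_s where "next_s k g = (if \<bar>u k g\<bar> < w k * U k / 4 then 1 else 0 :: real)" for k g
  define g where "g = rec_nat (\<lambda>x. 0) (\<lambda>k h x. h x + next_s k h * w k * f k x)"
  define s where "s k = next_s k (g k)" for k
  have g0: "g 0 = (\<lambda>x. 0)" and g_Suc: "g (Suc k) = (\<lambda>x. g k x + s k * w k * f k x)" for k
    by (simp_all add: g_def s_def)
  have s: "0 \<le> s k" "s k \<le> 1" for k by (auto simp: s_def next_s_def)
  have g: "g k \<in> Lip0 M e" for k
  proof (induction k)
    case 0 then show ?case by (simp add: g0 Lip0_0)
  next
    case (Suc k) then show ?case unfolding g_Suc by (intro Lip0_add Lip0_scale f(1))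
  qed
  have val: "u k (g (Suc k)) = u k (g k) + s k * w k * u k (f k)" for k
    unfolding g_Suc using bdualD(2)[OF u g Lip0_scale[OF f(1)], of k k "s k * w k" k] bdualD(3)[OF u f(1), of k "s k * w k" k] by simp
  have large: "w k * U k / 4 \<le> \<bar>u k (g (Suc k))\<bar>" for k
  proof (cases "\<bar>u k (g k)\<bar> < w k * U k / 4")
    case True
    have "w k * (U k / 2) \<le> w k * \<bar>u k (f k)\<bar>" using f(3)[of k] w0[of k] by (intro mult_left_mono) auto
    moreover have "\<bar>w k * u k (f k)\<bar> = w k * \<bar>u k (f k)\<bar>" using w0[of k] by (simp add: abs_mult)
    moreover have "\<bar>w k * u k (f k)\<bar> \<le> \<bar>u k (g k) + w k * u k (f k)\<bar> + \<bar>u k (g k)\<bar>" by linarith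
    ultimately show ?thesis unfolding val using True by (simp add: s_def next_s_def)
  next
    case False
    then show ?thesis unfolding val by (simp add: s_def next_s_def)
  qed
  have f1: "\<bar>f k x - f k y\<bar> \<le> mdist M x y" if "x \<in> mspace M" "y \<in> mspace M" for k x y
    using lipschitz_boundD[OF Lip0_lip_norm(2)[OF f(1)] that, of k] mult_right_mono[OF f(2)[of k] mdist_nonneg[of M x y]] by linarith
  have lip: "lipschitz_bound M (9 / 8 * (w k - w m)) (\<lambda>x. g m x - g k x)" if "k \<le> m" for k m
    using that
  proof (induction m rule: dec_induct)
    case base
    then show ?case by (simp add: lipschitz_bound_def)
  next
    case (step m)
    show ?case
      unfolding lipschitz_bound_def
    proof (intro ballI)
      fix x y assume xy: "x \<in> mspace M" "y \<in> mspace M"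
      have "\<bar>s m * w m * (f m x - f m y)\<bar> \<le> 1 * w m * mdist M x y"
        unfolding abs_mult using s[of m] w0[of m] f1[OF xy, of m] by (intro mult_mono) auto
      moreover have "g (Suc m) x - g k x - (g (Suc m) y - g k y) = (g m x - g k x - (g m y - g k y)) + s m * w m * (f m x - f m y)"
        by (simp add: g_Suc algebra_simps)
      ultimately have "\<bar>g (Suc m) x - g k x - (g (Suc m) y - g k y)\<bar> \<le> 9 / 8 * (w k - w m) * mdist M x y + w m * mdist M x y"
        using lipschitz_boundD[OF step.IH xy] by linarith
      also have "\<dots> = 9 / 8 * (w k - w (Suc m)) * mdist M x y" by (simp add: w_def algebra_simps)
      finally show "\<bar>g (Suc m) x - g k x - (g (Suc m) y - g k y)\<bar> \<le> 9 / 8 * (w k - w (Suc m)) * mdist M x y" .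
    qed
  qed
  have g_sum: "g m x = (\<Sum>j<m. s j * w j * f j x)" for m x by (induction m) (simp_all add: g0 g_Suc)
  have summ: "summable (\<lambda>j. s j * w j * f j x)" for x
  proof (rule summable_comparison_test')
    show "summable (\<lambda>j. w j * \<bar>mdist M x e\<bar>)"
      unfolding w_def by (intro summable_mult2 summable_geometric) simp
    show "norm (s j * w j * f j x) \<le> w j * \<bar>mdist M x e\<bar>" if "0 \<le> j" for j
    proof (cases "x \<in> mspace M")
      case True
      have "\<bar>f j x\<bar> \<le> mdist M x e" using f1[OF True e, of j] f(1)[of j] by (simp add: Lip0_iff)
      then have "\<bar>s j * w j\<bar> * \<bar>f j x\<bar> \<le> (1 * w j) * mdist M x e"
        unfolding abs_mult using s[of j] w0[of j] by (intro mult_mono) auto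
      then show ?thesis by (simp add: abs_mult)
    next
      case False
      then show ?thesis using f(1)[of j] w0[of j] by (simp add: Lip0_iff)
    qed
  qed
  define G where "G x = (\<Sum>j. s j * w j * f j x)" for x
  have lim: "(\<lambda>m. g m x) \<longlonglongrightarrow> G x" for x unfolding g_sum G_def by (rule summable_LIMSEQ[OF summ])
  have tail: "lipschitz_bound M (9 / 8 * w k) (\<lambda>x. G x - g k x)" for k
    unfolding lipschitz_bound_def
  proof (intro ballI)
    fix x y assume xy: "x \<in> mspace M" "y \<in> mspace M"
    have "(\<lambda>m. \<bar>g m x - g k x - (g m y - g k y)\<bar>) \<longlonglongrightarrow> \<bar>G x - g k x - (G y - g k y)\<bar>" by (intro tendsto_intros lim)
    moreover have "\<forall>\<^sub>F m in sequentially. \<bar>g m x - g k x - (g m y - g k y)\<bar> \<le> 9 / 8 * w k * mdist M x y"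
    proof (rule eventually_sequentiallyI[of k])
      fix m assume "k \<le> m"
      have "9 / 8 * (w k - w m) * mdist M x y \<le> 9 / 8 * w k * mdist M x y" using w0[of m] by (intro mult_right_mono) auto
      then show "\<bar>g m x - g k x - (g m y - g k y)\<bar> \<le> 9 / 8 * w k * mdist M x y"
        using lipschitz_boundD[OF lip[OF \<open>k \<le> m\<close>] xy] by linarith
    qed
    ultimately show "\<bar>G x - g k x - (G y - g k y)\<bar> \<le> 9 / 8 * w k * mdist M x y" by (rule tendsto_upperbound) simp
  qed
  have zero: "f j x = 0" if "x = e \<or> x \<notin> mspace M" for j x using f(1)[of j] that by (auto simp: Lip0_iff)
  have "lipschitz_bound M (9 / 8 * w 0) G" using tail[of 0] by (simp add: g0)
  moreover have "G x = 0" if "x = e \<or> x \<notin> mspace M" for x using zero[OF that] by (simp add: G_def)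
  ultimately have G: "G \<in> Lip0 M e" unfolding Lip0_iff by auto
  have lower: "C / 8 \<le> \<bar>u k G\<bar>" for k
  proof -
    have d: "(\<lambda>x. G x - g (Suc k) x) \<in> Lip0 M e" by (rule Lip0_diff[OF G g])
    have "u k (\<lambda>x. g (Suc k) x + (G x - g (Suc k) x)) = u k (g (Suc k)) + u k (\<lambda>x. G x - g (Suc k) x)"
      by (rule bdualD(2)[OF u g d])
    then have 1: "u k G = u k (g (Suc k)) + u k (\<lambda>x. G x - g (Suc k) x)" by simp
    have "\<bar>u k (\<lambda>x. G x - g (Suc k) x)\<bar> \<le> U k * lip_norm M (\<lambda>x. G x - g (Suc k) x)"
      unfolding U_def by (rule le_free_norm[OF u d])
    also have "\<dots> \<le> U k * (9 / 8 * w (Suc k))"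
      using U0[of k] w0[of "Suc k"] by (intro mult_left_mono lip_norm_le tail) auto
    also have "\<dots> = w k * U k / 8" by (simp add: w_def)
    finally have 2: "\<bar>u k (\<lambda>x. G x - g (Suc k) x)\<bar> \<le> w k * U k / 8" .
    have "w k * (C * 9 ^ k) \<le> w k * U k" using big[of k] w0[of k] unfolding U_def by (intro mult_left_mono) auto
    moreover have "w k * (C * 9 ^ k) = C" by (simp add: w_def power_one_over)
    ultimately show ?thesis using large[of k] 1 2 by linarith
  qed
  have "\<forall>\<^sub>F k in sequentially. \<bar>u k G\<bar> < C / 8"
    using order_tendstoD(2)[OF tendsto_rabs_zero[OF null[OF G]], of "C / 8"] C by simp
  then obtain k where "\<bar>u k G\<bar> < C / 8" by (auto simp: eventually_sequentially)
  then show False using lower[of k] by linarith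
qed

text \<open>For every \<open>k\<close> the images of \<open>9\<^sup>k (\<sigma> n - l)\<close> converge
  in norm to the image of \<open>0\<close>. Picking from the \<open>k\<close>-th row a term
  whose image is within \<open>1 / (k + 1)\<close> of that limit gives a sequence whose image
  converges, and the inverse map turns it into a weakly null sequence with norms at least
  \<open>C 9\<^sup>k\<close>.\<close>

lemma Schur_of_sequentially_homeomorphic:
  fixes M :: "'a metric" and N :: "'b metric"
  assumes e: "e \<in> mspace M" and e': "e' \<in> mspace N"
    and N: "Schur_property (free_space N e') (free_norm N e')"
    and sh: "sequentially_homeomorphic (free_space_weak M e) (free_space_weak N e')"
  shows "Schur_property (free_space M e) (free_norm M e)"
  unfolding Schur_property_def
proof (intro allI impI)
  fix \<sigma> l assume as: "range \<sigma> \<subseteq> free_space M e \<and> limitin (free_space_weak M e) \<sigma> l sequentially"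
  then have \<sigma>r: "range \<sigma> \<subseteq> free_space M e" and lim: "limitin (free_space_weak M e) \<sigma> l sequentially" by blast+
  have l: "l \<in> free_space M e" and \<sigma>: "\<sigma> n \<in> free_space M e" for n
    using as limitin_weak_topology_iff[OF \<sigma>r] by auto
  obtain H where H: "bij_betw H (free_space M e) (free_space N e')"
    "sequentially_continuous_map (free_space_weak M e) (free_space_weak N e') H"
    "sequentially_continuous_map (free_space_weak N e') (free_space_weak M e) (inv_into (free_space M e) H)"
    using sh unfolding sequentially_homeomorphic_def topspace_weak_topology by blast
  define \<tau> where "\<tau> k n = (\<lambda>f. 9 ^ k * (\<sigma> n f - l f))" for k n :: nat
  have \<tau>: "\<tau> k n \<in> free_space M e" for k n
    unfolding \<tau>_def using free_space_lincomb[OF e \<sigma>[of n] l, of "9 ^ k" "- (9 ^ k)"] by (simp add: algebra_simps)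
  have \<tau>_lim: "limitin (free_space_weak M e) (\<tau> k) (\<lambda>f. 0) sequentially" for k
    unfolding \<tau>_def by (rule weak_limit_scaled_diff[OF e \<sigma>r lim])
  have H_in: "H \<mu> \<in> free_space N e'" if "\<mu> \<in> free_space M e" for \<mu> using H(1) that by (rule bij_betw_apply)
  have H_lim: "(\<lambda>n. free_norm N e' (\<lambda>f. H (\<tau> k n) f - H (\<lambda>f. 0) f)) \<longlonglongrightarrow> 0" for k
  proof -
    have "range (\<tau> k) \<subseteq> free_space M e" using \<tau> by blast
    then have "limitin (free_space_weak N e') (H \<circ> \<tau> k) (H (\<lambda>f. 0)) sequentially"
      using H(2) \<tau>_lim[of k] unfolding sequentially_continuous_map_def topspace_weak_topology by blast
    moreover have "range (H \<circ> \<tau> k) \<subseteq> free_space N e'" using H_in \<tau> by auto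
    ultimately have "(\<lambda>n. free_norm N e' (\<lambda>f. (H \<circ> \<tau> k) n f - H (\<lambda>f. 0) f)) \<longlonglongrightarrow> 0"
      using N unfolding Schur_property_def by blast
    then show ?thesis by simp
  qed
  show "(\<lambda>n. free_norm M e (\<lambda>x. \<sigma> n x - l x)) \<longlonglongrightarrow> 0"
  proof (rule ccontr)
    assume not: "\<not> ?thesis"
    have nonneg: "0 \<le> free_norm M e (\<lambda>x. \<sigma> n x - l x)" for n
      using free_norm_diff[OF e \<sigma>[of n] l] by simp
    obtain C where C: "0 < C" "\<And>n0. \<exists>n\<ge>n0. C \<le> free_norm M e (\<lambda>x. \<sigma> n x - l x)"
      using not nonneg unfolding lim_sequentially dist_real_def by (auto simp: not_less)
    define good where "good k n \<longleftrightarrow> C \<le> free_norm M e (\<lambda>x. \<sigma> n x - l x) \<and>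
        free_norm N e' (\<lambda>f. H (\<tau> k n) f - H (\<lambda>f. 0) f) < 1 / real (Suc k)" for k n
    have "\<exists>n. good k n" for k
    proof -
      have "\<forall>\<^sub>F n in sequentially. free_norm N e' (\<lambda>f. H (\<tau> k n) f - H (\<lambda>f. 0) f) < 1 / real (Suc k)"
        by (rule order_tendstoD(2)[OF H_lim]) simp
      then obtain n0 where "\<And>n. n \<ge> n0 \<Longrightarrow> free_norm N e' (\<lambda>f. H (\<tau> k n) f - H (\<lambda>f. 0) f) < 1 / real (Suc k)"
        by (auto simp: eventually_sequentially)
      then show ?thesis using C(2)[of n0] unfolding good_def by blast
    qed
    then obtain n where good: "\<And>k. good k (n k)" by metis
    have n: "C \<le> free_norm M e (\<lambda>x. \<sigma> (n k) x - l x)"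
      "free_norm N e' (\<lambda>f. H (\<tau> k (n k)) f - H (\<lambda>f. 0) f) < 1 / real (Suc k)" for k
      using good[of k] unfolding good_def by simp_all
    define u where "u k = \<tau> k (n k)" for k
    have u: "u k \<in> free_space M e" for k by (simp add: u_def \<tau>)
    have ur: "range u \<subseteq> free_space M e" and Hur: "range (H \<circ> u) \<subseteq> free_space N e'" using u H_in by auto
    have z: "(\<lambda>f. 0) \<in> free_space M e" by (rule free_space_0[OF e])
    have "(\<lambda>k. free_norm N e' (\<lambda>f. (H \<circ> u) k f - H (\<lambda>f. 0) f)) \<longlonglongrightarrow> 0"
    proof (rule Lim_null_comparison)
      show "\<forall>\<^sub>F k in sequentially. norm (free_norm N e' (\<lambda>f. (H \<circ> u) k f - H (\<lambda>f. 0) f)) \<le> 1 / real (Suc k)"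
      proof (intro always_eventually allI)
        fix k
        have "0 \<le> free_norm N e' (\<lambda>f. (H \<circ> u) k f - H (\<lambda>f. 0) f)"
          using free_norm_diff[OF e' H_in[OF u[of k]] H_in[OF z]] by simp
        then show "norm (free_norm N e' (\<lambda>f. (H \<circ> u) k f - H (\<lambda>f. 0) f)) \<le> 1 / real (Suc k)"
          using n(2)[of k] by (simp add: u_def)
      qed
      show "(\<lambda>k. 1 / real (Suc k)) \<longlonglongrightarrow> 0" by (rule LIMSEQ_Suc[OF lim_1_over_n])
    qed
    then have "limitin (free_space_weak N e') (H \<circ> u) (H (\<lambda>f. 0)) sequentially"
      by (rule norm_limit_imp_weak_limit[OF e' Hur H_in[OF z]])
    then have "limitin (free_space_weak M e) (inv_into (free_space M e) H \<circ> (H \<circ> u)) (inv_into (free_space M e) H (H (\<lambda>f. 0))) sequentially"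
      using H(3) Hur unfolding sequentially_continuous_map_def topspace_weak_topology by blast
    moreover have "inv_into (free_space M e) H (H \<mu>) = \<mu>" if "\<mu> \<in> free_space M e" for \<mu>
      by (rule bij_betw_inv_into_left[OF H(1) that])
    ultimately have lim_u: "limitin (free_space_weak M e) u (\<lambda>f. 0) sequentially" using u z by (simp add: o_def)
    show False
    proof (rule unbounded_not_weakly_null[OF e free_space_dual[OF e u] _ C(1) weak_limit_eval[OF e ur lim_u]])
      fix k
      have d: "(\<lambda>f. \<sigma> (n k) f - l f) \<in> Lip0_dual M e"
        by (rule Lip0_dual_diff(1)[OF free_space_dual[OF e \<sigma>] free_space_dual[OF e l]])
      have "free_norm M e (u k) = norm (9 ^ k *\<^sub>R emb M e (\<lambda>f. \<sigma> (n k) f - l f))"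
        using Lip0_dual_lincomb[OF d d, of "9 ^ k" 0] norm_emb[of "u k" M e] free_space_dual[OF e u[of k]]
        by (simp add: u_def \<tau>_def)
      also have "\<dots> = 9 ^ k * free_norm M e (\<lambda>f. \<sigma> (n k) f - l f)" by (simp add: norm_emb[OF d])
      finally show "C * 9 ^ k \<le> free_norm M e (u k)" using n(1)[of k] by (simp add: mult.commute)
    qed
  qed
qed

lemma homeomorphism_sequentially_continuous:
  fixes M :: "'a metric" and N :: "'b metric"
  assumes e: "e \<in> mspace M" and e': "e' \<in> mspace N"
    and M: "Schur_property (free_space M e) (free_norm M e)"
    and f: "continuous_on (free_image M e) f" and F: "F \<in> free_space M e \<rightarrow> free_space N e'"
    and fF: "\<And>\<mu>. \<mu> \<in> free_space M e \<Longrightarrow> emb N e' (F \<mu>) = f (emb M e \<mu>)"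
  shows "sequentially_continuous_map (free_space_weak M e) (free_space_weak N e') F"
  unfolding sequentially_continuous_map_def topspace_weak_topology
proof (intro conjI F allI impI)
  fix \<sigma> l assume as: "range \<sigma> \<subseteq> free_space M e \<and> limitin (free_space_weak M e) \<sigma> l sequentially"
  then have \<sigma>r: "range \<sigma> \<subseteq> free_space M e" and lim: "limitin (free_space_weak M e) \<sigma> l sequentially" by blast+
  have l: "l \<in> free_space M e" and \<sigma>: "\<sigma> n \<in> free_space M e" for n
    using as limitin_weak_topology_iff[OF \<sigma>r] by auto
  have F_in: "F \<mu> \<in> free_space N e'" if "\<mu> \<in> free_space M e" for \<mu> using F that by blast
  have img: "emb M e \<mu> \<in> free_image M e" if "\<mu> \<in> free_space M e" for \<mu> using that emb_free_space(1)[OF e] by blast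
  have "(\<lambda>n. free_norm M e (\<lambda>f. \<sigma> n f - l f)) \<longlonglongrightarrow> 0"
    using M[unfolded Schur_property_def, rule_format, OF as] .
  then have "(\<lambda>n. norm (emb M e (\<sigma> n) - emb M e l)) \<longlonglongrightarrow> 0"
    by (simp add: free_norm_diff[OF e \<sigma> l])
  then have "(\<lambda>n. emb M e (\<sigma> n)) \<longlonglongrightarrow> emb M e l"
    by (rule Lim_null[THEN iffD2, OF tendsto_norm_zero_cancel])
  then have "(\<lambda>n. f (emb M e (\<sigma> n))) \<longlonglongrightarrow> f (emb M e l)"
    by (rule continuous_on_tendsto_compose[OF f _ img[OF l]]) (simp add: img[OF \<sigma>])
  then have "(\<lambda>n. norm (emb N e' (F (\<sigma> n)) - emb N e' (F l))) \<longlonglongrightarrow> 0"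
    unfolding fF[OF \<sigma>] fF[OF l] by (intro tendsto_norm_zero) (rule Lim_null[THEN iffD1])
  then have "(\<lambda>n. free_norm N e' (\<lambda>g. (F \<circ> \<sigma>) n g - F l g)) \<longlonglongrightarrow> 0"
    by (simp add: free_norm_diff[OF e' F_in[OF \<sigma>] F_in[OF l]])
  then show "limitin (free_space_weak N e') (F \<circ> \<sigma>) (F l) sequentially"
    by (intro norm_limit_imp_weak_limit[OF e' _ F_in[OF l]]) (use F_in \<sigma> in auto)
qed

lemma sequentially_homeomorphic_of_Schur:
  fixes M :: "'a metric" and N :: "'b metric"
  assumes e: "e \<in> mspace M" and e': "e' \<in> mspace N"
    and M: "Schur_property (free_space M e) (free_norm M e)" and N: "Schur_property (free_space N e') (free_norm N e')"
    and hom: "free_image M e homeomorphic free_image N e'"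
  shows "sequentially_homeomorphic (free_space_weak M e) (free_space_weak N e')"
proof -
  obtain f f' where f: "homeomorphism (free_image M e) (free_image N e') f f'"
    using hom unfolding homeomorphic_def by blast
  define iM where "iM = inv_into (free_space M e) (emb M e)"
  define iN where "iN = inv_into (free_space N e') (emb N e')"
  have bM: "bij_betw (emb M e) (free_space M e) (free_image M e)"
    using emb_free_space(2)[OF e] emb_inj[of M e] unfolding bij_betw_def
    by (metis free_space_dual[OF e] inj_on_subset subsetI)
  have bN: "bij_betw (emb N e') (free_space N e') (free_image N e')"
    using emb_free_space(2)[OF e'] emb_inj[of N e'] unfolding bij_betw_def
    by (metis free_space_dual[OF e'] inj_on_subset subsetI)
  have iN: "bij_betw iN (free_image N e') (free_space N e')" and iM: "bij_betw iM (free_image M e) (free_space M e)"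
    unfolding iN_def iM_def by (rule bij_betw_inv_into[OF bN] bij_betw_inv_into[OF bM])+
  have emb_iN: "emb N e' (iN v) = v" if "v \<in> free_image N e'" for v
    unfolding iN_def by (rule bij_betw_inv_into_right[OF bN that])
  have emb_iM: "emb M e (iM v) = v" if "v \<in> free_image M e" for v
    unfolding iM_def by (rule bij_betw_inv_into_right[OF bM that])
  have bf: "bij_betw f (free_image M e) (free_image N e')"
    by (rule bij_betw_byWitness[where f' = f'])
       (use f in \<open>auto simp: homeomorphism_def\<close>)
  define F where "F \<mu> = iN (f (emb M e \<mu>))" for \<mu>
  have bF: "bij_betw F (free_space M e) (free_space N e')"
    using bij_betw_trans[OF bij_betw_trans[OF bM bf] iN] by (simp add: F_def[abs_def] o_def)
  have f_in: "f (emb M e \<mu>) \<in> free_image N e'" if "\<mu> \<in> free_space M e" for \<mu>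
    by (rule bij_betw_apply[OF bf bij_betw_apply[OF bM that]])
  have embF: "emb N e' (F \<mu>) = f (emb M e \<mu>)" if "\<mu> \<in> free_space M e" for \<mu>
    unfolding F_def by (rule emb_iN[OF f_in[OF that]])
  let ?F' = "inv_into (free_space M e) F"
  have F'_in: "?F' \<nu> \<in> free_space M e" if "\<nu> \<in> free_space N e'" for \<nu>
    by (rule bij_betw_apply[OF bij_betw_inv_into[OF bF] that])
  have embF': "emb M e (?F' \<nu>) = f' (emb N e' \<nu>)" if "\<nu> \<in> free_space N e'" for \<nu>
  proof -
    have "f (emb M e (?F' \<nu>)) = emb N e' \<nu>"
      using embF[OF F'_in[OF that]] bij_betw_inv_into_right[OF bF that] by simp
    then show ?thesis using homeomorphism_apply1[OF f bij_betw_apply[OF bM F'_in[OF that]]] by simp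
  qed
  have "sequentially_continuous_map (free_space_weak M e) (free_space_weak N e') F"
    by (rule homeomorphism_sequentially_continuous[OF e e' M homeomorphism_cont1[OF f] _ embF])
       (use bij_betw_apply[OF bF] in blast)
  moreover have "sequentially_continuous_map (free_space_weak N e') (free_space_weak M e) ?F'"
    by (rule homeomorphism_sequentially_continuous[OF e' e N homeomorphism_cont2[OF f] _ embF'])
       (use F'_in in blast)
  ultimately show ?thesis
    unfolding sequentially_homeomorphic_def topspace_weak_topology using bF by blast
qed

lemma metric_density_complete_discrete:
  assumes "complete_discrete N" shows "metric_density N = |mspace N|"
proof -
  obtain D where D: "is_dense N D" "metric_density N = |D|"
    by (rule metric_density_minimal[of N]) (rule that)
  have "D = mspace N"
    using D(1) assms unfolding is_dense_def complete_discrete_def by (auto simp: discrete_topology_closure_of)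
  then show ?thesis using D(2) by simp
qed

text \<open>The metric with values \<open>0\<close> and \<open>1\<close>.\<close>

lemma complete_discrete_exists: "\<exists>N :: 'b metric. mspace N = B \<and> complete_discrete N"
proof -
  interpret discrete_metric B .
  have "mspace (metric (B, dd)) = B" by simp
  moreover have "complete_discrete (metric (B, dd))"
    unfolding complete_discrete_def
    using mcomplete_discrete_metric mtopology_discrete_metric by simp
  ultimately show ?thesis by blast
qed

theorem theorem4p14:
  fixes M :: "'a metric" and e :: 'a
  assumes "infinite (mspace M)" and "e \<in> mspace M"
    and type_large_enough: "\<exists>B::'b set. |B| =o metric_density M"
  shows
    "(Schur_property (free_space M e) (free_norm M e) \<longleftrightarrow>
       (\<forall>N :: 'b metric. \<forall>e' \<in> mspace N.
          complete_discrete N \<and> |mspace N| =o metric_density M \<longrightarrow>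
          sequentially_homeomorphic (free_space_weak M e) (free_space_weak N e'))) \<and>
     (Schur_property (free_space M e) (free_norm M e) \<longleftrightarrow>
       (\<exists>N :: 'b metric. \<exists>e' \<in> mspace N.
          complete_discrete N \<and> |mspace N| =o metric_density M \<and>
          sequentially_homeomorphic (free_space_weak M e) (free_space_weak N e')))"
proof -
  let ?Schur = "Schur_property (free_space M e) (free_norm M e)"
  obtain D where D: "metric_density M = |D|" by (rule metric_density_minimal[of M]) (rule that)
  then have DM: "|D| =o metric_density M" by (simp add: card_of_refl)
  obtain x y :: "'a \<Rightarrow> 'a" and h where "infinite D" by (rule separated_pairs[OF assms(1) DM]) (rule that)
  have inf: "infinite B" if "|B| =o metric_density M" for B :: "'b set"
    using that \<open>infinite D\<close> unfolding D by (metis card_of_ordIso_finite)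
  have fwd: "sequentially_homeomorphic (free_space_weak M e) (free_space_weak N e')"
    if S: ?Schur and e': "e' \<in> mspace N" and N: "complete_discrete N" "|mspace N| =o metric_density M"
    for N :: "'b metric" and e'
  proof (rule sequentially_homeomorphic_of_Schur[OF assms(2) e' S Schur_complete_discrete[OF N(1) e']])
    have "|D| =o metric_density N"
      using ordIso_symmetric[OF N(2)] unfolding D metric_density_complete_discrete[OF N(1)] .
    then have "free_image N e' homeomorphic ell1_on D"
      by (rule free_image_homeomorphic_ell1[OF inf[OF N(2)] e'])
    then show "free_image M e homeomorphic free_image N e'"
      using free_image_homeomorphic_ell1[OF assms(1,2) DM] homeomorphic_sym homeomorphic_trans by blast
  qed
  have bwd: ?Schur
    if "e' \<in> mspace N" "complete_discrete N" "sequentially_homeomorphic (free_space_weak M e) (free_space_weak N e')"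
    for N :: "'b metric" and e'
    using Schur_of_sequentially_homeomorphic[OF assms(2) that(1) Schur_complete_discrete[OF that(2,1)] that(3)] .
  obtain B :: "'b set" where B: "|B| =o metric_density M" using type_large_enough by blast
  obtain N0 :: "'b metric" where N0: "mspace N0 = B" "complete_discrete N0" using complete_discrete_exists[of B] by blast
  obtain e0 where e0: "e0 \<in> mspace N0" using inf[OF B] N0(1) by (metis ex_in_conv finite.emptyI)
  have N0_card: "|mspace N0| =o metric_density M" using B by (simp add: N0(1))
  show ?thesis
  proof (intro conjI iffI)
    assume ?Schur
    then show "\<forall>N :: 'b metric. \<forall>e' \<in> mspace N. complete_discrete N \<and> |mspace N| =o metric_density M \<longrightarrow>
          sequentially_homeomorphic (free_space_weak M e) (free_space_weak N e')"
      using fwd by blast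
  next
    assume "\<forall>N :: 'b metric. \<forall>e' \<in> mspace N. complete_discrete N \<and> |mspace N| =o metric_density M \<longrightarrow>
          sequentially_homeomorphic (free_space_weak M e) (free_space_weak N e')"
    then have "sequentially_homeomorphic (free_space_weak M e) (free_space_weak N0 e0)" using e0 N0(2) N0_card by blast
    then show ?Schur by (rule bwd[OF e0 N0(2)])
  next
    assume ?Schur
    then show "\<exists>N :: 'b metric. \<exists>e' \<in> mspace N. complete_discrete N \<and> |mspace N| =o metric_density M \<and>
          sequentially_homeomorphic (free_space_weak M e) (free_space_weak N e')"
      using fwd[OF _ e0 N0(2) N0_card] e0 N0(2) N0_card by blast
  next
    assume "\<exists>N :: 'b metric. \<exists>e' \<in> mspace N. complete_discrete N \<and> |mspace N| =o metric_density M \<and>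
          sequentially_homeomorphic (free_space_weak M e) (free_space_weak N e')"
    then show ?Schur using bwd by blast
  qed
qed

end
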